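(* For any real resonance point $r_\lambda$ of a line $\{H_r=H_0+rV:r\in\mathbb R\}$ regular at an essentially regular point $\lambda$, the signatures of the two resonance matrices $Q_{\lambda\mp i0}(r_\lambda)JP_{\lambda\pm i0}(r_\lambda)$ of $r_\lambda$ are the same and are equal to the resonance index of the triple $(\lambda,H_{r_\lambda},V)$; that is, $$\operatorname{sign}\bigl(Q_{\lambda\mp i0}(r_\lambda)JP_{\lambda\pm i0}(r_\lambda)\bigr)=\operatorname{ind}_{res}(\lambda;H_{r_\lambda},V).$$
   Context: Setting. $\mathcal H,\mathcal K$ are complex separable Hilbert spaces. $F:\mathcal H\to\mathcal K$ is a closed densely defined operator with trivial kernel and co-kernel. $\{H_r=H_0+rV:r\in\mathbb R\}$ is a line of self-adjoint operators on $\mathcal H$, $V=F^*JF$ self-adjoint with $J$ bounded self-adjoint on $\mathcal K$. Standing assumptions: all $H_r$ have a common dense domain $\mathcal D$, $\mathcal D\subset\operatorname{dom}(F)\cap\operatorname{dom}(V)$, $V$ is relatively compact with respect to each $H_r$, and for non-real $z$ the operator $T_z(H_r):=F(H_r-z)^{-1}F^*$ (densely defined on $\operatorname{dom}F^*$) extends to a compact operator on $\mathcal K$, also denoted $T_z(H_r)$. $\Lambda(H_r,F)$ is the set of real $\lambda$ for which the norm limits $T_{\lambda\pm i0}(H_r):=\lim_{y\to0^+}T_{\lambda\pm iy}(H_r)$ exist (assumed of full Lebesgue measure). It is assumed that $\lambda\in\Lambda(H_r,F)$ for some real $r$ (that is, the line is regular at $\lambda$); a real $r$ is non-resonant if $\lambda\in\Lambda(H_r,F)$,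 otherwise it is a real resonance point. For $z$ non-real and real $s$, or $z=\lambda\pm i0$ and non-resonant $s$, put $A_z(s)=T_z(H_s)J$ and $B_z(s)=JT_z(H_s)$; as functions of $s$ they extend meromorphically to $\mathbb C$; poles of $A_z(s)$ are called resonance points corresponding to $z$, and for $z=\lambda\pm i0$ the real ones are exactly the real resonance points. For a pole $r_z$, $P_z(r_z)=\frac1{2\pi i}\oint_{C(r_z)}A_z(s)\,ds$ and $Q_z(r_z)=\frac1{2\pi i}\oint_{C(r_z)}B_z(s)\,ds$, with $C(r_z)$ a small counter-clockwise circle around $r_z$ enclosing no other poles; these are finite-rank idempotents and $P_z(r_z)^*=Q_{\bar z}(\bar r_z)$ (the conjugate of $\lambda\pm i0$ being $\lambda\mp i0$), so $Q_{\lambda\mp i0}(r_\lambda)JP_{\lambda\pm i0}(r_\lambda)$ are finite-rank and self-adjoint. The signature of a finite-rank self-adjoint operator is the rank of its positive part minus the rank of its negative part. Resonance index: when $\lambda+i0$ is replaced by $\lambda+iy$ with small $y>0$, the pole $r_\lambda$ of $A_{\lambda+i0}(s)$ splits into poles $r^1_{\lambda+iy},\ldots,r^N_{\lambda+iy}$ of $A_{\lambda+iy}(s)$ (counted with algebraic multiplicities, that is, ranks of $P_{\lambda+iy}$) converging to $r_\lambda$ as $y\to0^+$, none of which is real. If $N_+$ (respectively $N_-$) of them lie in the open upper (respectively lower) half-plane, then $\operatorname{ind}_{res}(\lambda;H_{r_\lambda},V)=N_+-N_-$. *)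

theory Defs
  imports "HOL-Complex_Analysis.Complex_Analysis"
begin

section \<open>Complex Hilbert spaces\<close>

class complex_vector = real_vector +
  fixes scaleC :: "complex \<Rightarrow> 'a \<Rightarrow> 'a" (infixr \<open>*\<^sub>C\<close> 75)
  assumes scaleC_right_distrib: "c *\<^sub>C (x + y) = c *\<^sub>C x + c *\<^sub>C y"
    and scaleC_left_distrib: "(c + d) *\<^sub>C x = c *\<^sub>C x + d *\<^sub>C x"
    and scaleC_scaleC: "c *\<^sub>C d *\<^sub>C x = (c * d) *\<^sub>C x"
    and scaleC_of_real: "complex_of_real a *\<^sub>C x = a *\<^sub>R x"

global_interpretation complex_vector: vector_space "scaleC :: complex \<Rightarrow> 'a \<Rightarrow> 'a::complex_vector"
  defines cdim = complex_vector.dim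
proof
  show "1 *\<^sub>C x = x" for x :: 'a
    using scaleC_of_real[of 1 x] by simp
qed (simp_all add: scaleC_right_distrib scaleC_left_distrib scaleC_scaleC)

class complex_normed_vector = complex_vector + real_normed_vector +
  assumes norm_scaleC: "norm (c *\<^sub>C x) = cmod c * norm x"

text \<open>The inner product is linear in the second argument.\<close>

class complex_inner = complex_normed_vector +
  fixes cinner :: "'a \<Rightarrow> 'a \<Rightarrow> complex"
  assumes cinner_commute: "cinner x y = cnj (cinner y x)"
    and cinner_add_right: "cinner x (y + z) = cinner x y + cinner x z"
    and cinner_scaleC_right: "cinner x (c *\<^sub>C y) = c * cinner x y"
    and norm_eq_sqrt_cinner: "norm x = sqrt (Re (cinner x x))"

class complex_hilbert = complex_inner + complete_space

lemma bounded_linear_scaleC_right: "bounded_linear (\<lambda>x::'a::complex_normed_vector. c *\<^sub>C x)"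
proof (rule bounded_linear_intro[where K = "cmod c"])
  fix r :: real and x y :: 'a
  show "c *\<^sub>C (x + y) = c *\<^sub>C x + c *\<^sub>C y"
    by (rule scaleC_right_distrib)
  show "c *\<^sub>C r *\<^sub>R x = r *\<^sub>R c *\<^sub>C x"
    by (simp add: scaleC_of_real[symmetric] scaleC_scaleC mult.commute)
  show "norm (c *\<^sub>C x) \<le> norm x * cmod c"
    by (simp add: norm_scaleC mult.commute)
qed

section \<open>Bounded operators\<close>

text \<open>
  Bounded operators are elements of the library type of bounded real-linear maps, with its operator
  norm; complex linearity is a separate predicate.
\<close>

instantiation blinfun :: (real_normed_vector, complex_normed_vector) complex_normed_vector
begin

lift_definition scaleC_blinfun :: "complex \<Rightarrow> 'a \<Rightarrow>\<^sub>L 'b \<Rightarrow> 'a \<Rightarrow>\<^sub>L 'b"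
  is "\<lambda>c T x. c *\<^sub>C T x"
  by (rule bounded_linear_compose[OF bounded_linear_scaleC_right])

instance
proof
  fix c d :: complex and a :: real and S T :: "'a \<Rightarrow>\<^sub>L 'b"
  show "c *\<^sub>C (S + T) = c *\<^sub>C S + c *\<^sub>C T"
    by transfer (simp add: scaleC_right_distrib)
  show "(c + d) *\<^sub>C T = c *\<^sub>C T + d *\<^sub>C T"
    by transfer (simp add: scaleC_left_distrib)
  show "c *\<^sub>C d *\<^sub>C T = (c * d) *\<^sub>C T"
    by transfer (simp add: scaleC_scaleC)
  show "complex_of_real a *\<^sub>C T = a *\<^sub>R T"
    by transfer (simp add: scaleC_of_real)
  show "norm (c *\<^sub>C T) = cmod c * norm T"
  proof (rule antisym)
    have le: "norm (e *\<^sub>C U) \<le> cmod e * norm U" for e and U :: "'a \<Rightarrow>\<^sub>L 'b"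
      by (rule norm_blinfun_bound)
        (auto simp: scaleC_blinfun.rep_eq norm_scaleC mult.assoc intro: mult_left_mono norm_blinfun)
    show "norm (c *\<^sub>C T) \<le> cmod c * norm T"
      by (rule le)
    show "cmod c * norm T \<le> norm (c *\<^sub>C T)"
    proof (cases "c = 0")
      case False
      have "inverse c *\<^sub>C c *\<^sub>C T = T"
        using False by transfer (simp add: scaleC_scaleC fun_eq_iff)
      then have "norm T \<le> inverse (cmod c) * norm (c *\<^sub>C T)"
        using le[of "inverse c" "c *\<^sub>C T"] by (simp add: norm_inverse)
      then show ?thesis
        using False by (simp add: field_simps)
    qed simp
  qed
qed

end

definition clinear_blinfun :: "'a::complex_normed_vector \<Rightarrow>\<^sub>L 'b::complex_normed_vector \<Rightarrow> bool" where
  "clinear_blinfun T \<longleftrightarrow> (\<forall>c x. T (c *\<^sub>C x) = c *\<^sub>C T x)"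

definition compact_blinfun :: "'a::real_normed_vector \<Rightarrow>\<^sub>L 'b::real_normed_vector \<Rightarrow> bool" where
  "compact_blinfun T \<longleftrightarrow> (\<forall>B. bounded B \<longrightarrow> compact (closure (blinfun_apply T ` B)))"

definition selfadjoint_blinfun :: "'a::complex_inner \<Rightarrow>\<^sub>L 'a \<Rightarrow> bool" where
  "selfadjoint_blinfun T \<longleftrightarrow>
     clinear_blinfun T \<and> (\<forall>x y. cinner (T x) y = cinner x (T y))"

definition positive_blinfun :: "'a::complex_inner \<Rightarrow>\<^sub>L 'a \<Rightarrow> bool" where
  "positive_blinfun T \<longleftrightarrow> selfadjoint_blinfun T \<and> (\<forall>x. 0 \<le> Re (cinner x (T x)))"

definition crank :: "'a::complex_normed_vector \<Rightarrow>\<^sub>L 'b::complex_normed_vector \<Rightarrow> nat" where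
  "crank T = cdim (range (blinfun_apply T))"

text \<open>
  The positive part \<open>T\<^sub>+\<close> and negative part \<open>T\<^sub>-\<close> of a self-adjoint \<open>T\<close> are determined by
  \<open>T = T\<^sub>+ - T\<^sub>-\<close>, \<open>T\<^sub>+ T\<^sub>- = 0\<close> and \<open>T\<^sub>+, T\<^sub>- \<ge> 0\<close>.
\<close>

definition pos_part :: "'a::complex_inner \<Rightarrow>\<^sub>L 'a \<Rightarrow> 'a \<Rightarrow>\<^sub>L 'a" where
  "pos_part T = (THE P. \<exists>N. positive_blinfun P \<and> positive_blinfun N \<and> T = P - N \<and> P o\<^sub>L N = 0)"

definition neg_part :: "'a::complex_inner \<Rightarrow>\<^sub>L 'a \<Rightarrow> 'a \<Rightarrow>\<^sub>L 'a" where
  "neg_part T = (THE N. \<exists>P. positive_blinfun P \<and> positive_blinfun N \<and> T = P - N \<and> P o\<^sub>L N = 0)"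

definition op_signature :: "'a::complex_inner \<Rightarrow>\<^sub>L 'a \<Rightarrow> int" where
  "op_signature T = int (crank (pos_part T)) - int (crank (neg_part T))"

section \<open>Unbounded operators\<close>

text \<open>
  An unbounded operator is its graph, so \<^const>\<open>Domain\<close> is its domain, \<^const>\<open>converse\<close> its inverse
  and \<open>S O T\<close> is the composition ``first \<open>S\<close>, then \<open>T\<close>'' on its maximal domain.
\<close>

type_synonym ('a, 'b) uop = "('a \<times> 'b) set"

definition uop_of_blinfun :: "'a::real_normed_vector \<Rightarrow>\<^sub>L 'b::real_normed_vector \<Rightarrow> ('a, 'b) uop" where
  "uop_of_blinfun T = {(x, T x) | x. True}"

definition linear_uop :: "('a::complex_vector, 'b::complex_vector) uop \<Rightarrow> bool" where
  "linear_uop T \<longleftrightarrow> single_valued T \<and> (0, 0) \<in> T \<and>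
     (\<forall>x u y v. (x, u) \<in> T \<longrightarrow> (y, v) \<in> T \<longrightarrow> (x + y, u + v) \<in> T) \<and>
     (\<forall>c x u. (x, u) \<in> T \<longrightarrow> (c *\<^sub>C x, c *\<^sub>C u) \<in> T)"

definition densely_defined :: "('a::topological_space, 'b) uop \<Rightarrow> bool" where
  "densely_defined T \<longleftrightarrow> closure (Domain T) = UNIV"

definition uop_adj :: "('a::complex_inner, 'b::complex_inner) uop \<Rightarrow> ('b, 'a) uop" where
  "uop_adj T = {(y, v). \<forall>(x, u) \<in> T. cinner u y = cinner x v}"

definition uop_kernel :: "('a, 'b::zero) uop \<Rightarrow> 'a set" where
  "uop_kernel T = {x. (x, 0) \<in> T}"

definition selfadjoint_uop :: "('a::complex_inner, 'a) uop \<Rightarrow> bool" where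
  "selfadjoint_uop T \<longleftrightarrow> linear_uop T \<and> densely_defined T \<and> uop_adj T = T"

definition uop_add :: "('a, 'b::plus) uop \<Rightarrow> ('a, 'b) uop \<Rightarrow> ('a, 'b) uop" where
  "uop_add S T = {(x, u + v) | x u v. (x, u) \<in> S \<and> (x, v) \<in> T}"

definition uop_scale :: "complex \<Rightarrow> ('a, 'b::complex_vector) uop \<Rightarrow> ('a, 'b) uop" where
  "uop_scale c T = {(x, c *\<^sub>C u) | x u. (x, u) \<in> T}"

definition resolvent :: "('a::complex_vector, 'a) uop \<Rightarrow> complex \<Rightarrow> ('a, 'a) uop" where
  "resolvent T z = (uop_add T (uop_scale (- z) Id))\<inverse>"

text \<open>
  For self-adjoint \<open>H\<close> compactness of \<open>V (H - z)\<inverse>\<close> does not depend on the choice of a non-real \<open>z\<close>.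
\<close>

definition relatively_compact :: "('a::complex_hilbert, 'a) uop \<Rightarrow> ('a, 'a) uop \<Rightarrow> bool" where
  "relatively_compact V H \<longleftrightarrow> Domain H \<subseteq> Domain V \<and>
     (\<exists>z. Im z \<noteq> 0 \<and> (\<exists>K. compact_blinfun K \<and> resolvent H z O V = uop_of_blinfun K))"

section \<open>Meromorphic operator-valued functions\<close>

definition vholomorphic_on :: "(complex \<Rightarrow> 'a::complex_normed_vector) \<Rightarrow> complex set \<Rightarrow> bool" where
  "vholomorphic_on f S \<longleftrightarrow> (\<forall>s\<in>S. \<exists>D. (f has_derivative (\<lambda>h. h *\<^sub>C D)) (at s within S))"

definition vmeromorphic :: "(complex \<Rightarrow> 'a::complex_normed_vector) \<Rightarrow> bool" where
  "vmeromorphic f \<longleftrightarrow>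
     (\<forall>w. \<exists>n::nat. \<exists>e>0. \<exists>g. vholomorphic_on g (ball w e) \<and>
        (\<forall>s\<in>ball w e - {w}. (s - w) ^ n *\<^sub>C f s = g s))"

text \<open>
  The extension from a set \<open>S\<close> of real numbers to the complex plane. As for
  \<^const>\<open>nicely_meromorphic_on\<close>, the value at a pole is \<open>0\<close> and removable singularities are
  removed; this makes the extension unique as soon as \<open>S\<close> has a limit point.
\<close>

definition meromorphic_extension ::
    "real set \<Rightarrow> (real \<Rightarrow> 'a::complex_normed_vector) \<Rightarrow> complex \<Rightarrow> 'a" where
  "meromorphic_extension S f =
     (THE g. vmeromorphic g \<and>
        (\<forall>w. is_pole g w \<and> g w = 0 \<or> g \<midarrow>w\<rightarrow> g w) \<and>
        (\<forall>s\<in>S. g (complex_of_real s) = f s))"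

definition has_vcontour_integral ::
    "(complex \<Rightarrow> 'a::complex_normed_vector) \<Rightarrow> 'a \<Rightarrow> (real \<Rightarrow> complex) \<Rightarrow> bool" where
  "has_vcontour_integral f I \<gamma> \<longleftrightarrow>
     ((\<lambda>t. vector_derivative \<gamma> (at t within {0..1}) *\<^sub>C f (\<gamma> t)) has_integral I) {0..1}"

text \<open>The analogue of \<^const>\<open>residue\<close>.\<close>

definition vresidue :: "(complex \<Rightarrow> 'a::complex_normed_vector) \<Rightarrow> complex \<Rightarrow> 'a" where
  "vresidue f w = (THE R. \<exists>e>0. \<forall>\<epsilon>>0. \<epsilon> < e \<longrightarrow>
     has_vcontour_integral f ((2 * of_real pi * \<i>) *\<^sub>C R) (circlepath w \<epsilon>))"

section \<open>Resonance points\<close>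

text \<open>
  The spectral parameter \<open>z\<close> is either a non-real number or one of \<open>\<lambda> + i0\<close>, \<open>\<lambda> - i0\<close>
  with \<open>\<lambda>\<close> real.
\<close>

datatype spectral_param = Nonreal complex | Above real | Below real

text \<open>\<open>sandwiched F H z\<close> is the bounded extension of \<open>F (H - z)\<inverse> F\<^sup>*\<close>.\<close>

definition sandwiched ::
    "('h::complex_hilbert, 'k::complex_hilbert) uop \<Rightarrow> ('h, 'h) uop \<Rightarrow> complex \<Rightarrow> 'k \<Rightarrow>\<^sub>L 'k" where
  "sandwiched F H z = (THE T. uop_adj F O resolvent H z O F \<subseteq> uop_of_blinfun T)"

definition regular_set ::
    "('h::complex_hilbert, 'h) uop \<Rightarrow> ('h, 'k::complex_hilbert) uop \<Rightarrow> real set" where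
  "regular_set H F = {lam.
     (\<exists>L. ((\<lambda>y. sandwiched F H (Complex lam y)) \<longlongrightarrow> L) (at_right 0)) \<and>
     (\<exists>L. ((\<lambda>y. sandwiched F H (Complex lam (- y))) \<longlongrightarrow> L) (at_right 0))}"

fun T_op :: "('h::complex_hilbert, 'k::complex_hilbert) uop \<Rightarrow> spectral_param \<Rightarrow> ('h, 'h) uop \<Rightarrow> 'k \<Rightarrow>\<^sub>L 'k" where
  "T_op F (Nonreal z) H = sandwiched F H z"
| "T_op F (Above lam) H = Lim (at_right 0) (\<lambda>y. sandwiched F H (Complex lam y))"
| "T_op F (Below lam) H = Lim (at_right 0) (\<lambda>y. sandwiched F H (Complex lam (- y)))"

text \<open>In the following \<open>H\<close> is the line \<open>r \<mapsto> H\<^sub>r\<close> and \<open>lam\<close> stands for \<open>\<lambda>\<close>.\<close>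

definition resonance_point ::
    "('h::complex_hilbert, 'k::complex_hilbert) uop \<Rightarrow> (real \<Rightarrow> ('h, 'h) uop) \<Rightarrow> real \<Rightarrow> real \<Rightarrow> bool" where
  "resonance_point F H lam r \<longleftrightarrow> lam \<notin> regular_set (H r) F"

fun nonresonant_set ::
    "('h::complex_hilbert, 'k::complex_hilbert) uop \<Rightarrow> (real \<Rightarrow> ('h, 'h) uop) \<Rightarrow> spectral_param \<Rightarrow> real set" where
  "nonresonant_set F H (Nonreal z) = UNIV"
| "nonresonant_set F H (Above lam) = {s. \<not> resonance_point F H lam s}"
| "nonresonant_set F H (Below lam) = {s. \<not> resonance_point F H lam s}"

definition A_op ::
    "('h::complex_hilbert, 'k::complex_hilbert) uop \<Rightarrow> 'k \<Rightarrow>\<^sub>L 'k \<Rightarrow> (real \<Rightarrow> ('h, 'h) uop) \<Rightarrow>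
      spectral_param \<Rightarrow> complex \<Rightarrow> 'k \<Rightarrow>\<^sub>L 'k" where
  "A_op F J H z = meromorphic_extension (nonresonant_set F H z) (\<lambda>s. T_op F z (H s) o\<^sub>L J)"

definition B_op ::
    "('h::complex_hilbert, 'k::complex_hilbert) uop \<Rightarrow> 'k \<Rightarrow>\<^sub>L 'k \<Rightarrow> (real \<Rightarrow> ('h, 'h) uop) \<Rightarrow>
      spectral_param \<Rightarrow> complex \<Rightarrow> 'k \<Rightarrow>\<^sub>L 'k" where
  "B_op F J H z = meromorphic_extension (nonresonant_set F H z) (\<lambda>s. J o\<^sub>L T_op F z (H s))"

definition P_op ::
    "('h::complex_hilbert, 'k::complex_hilbert) uop \<Rightarrow> 'k \<Rightarrow>\<^sub>L 'k \<Rightarrow> (real \<Rightarrow> ('h, 'h) uop) \<Rightarrow>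
      spectral_param \<Rightarrow> complex \<Rightarrow> 'k \<Rightarrow>\<^sub>L 'k" where
  "P_op F J H z r = vresidue (A_op F J H z) r"

definition Q_op ::
    "('h::complex_hilbert, 'k::complex_hilbert) uop \<Rightarrow> 'k \<Rightarrow>\<^sub>L 'k \<Rightarrow> (real \<Rightarrow> ('h, 'h) uop) \<Rightarrow>
      spectral_param \<Rightarrow> complex \<Rightarrow> 'k \<Rightarrow>\<^sub>L 'k" where
  "Q_op F J H z r = vresidue (B_op F J H z) r"

text \<open>
  The poles of \<open>A\<^bsub>\<lambda>+iy\<^esub>\<close> which converge to \<open>r\<close> as \<open>y\<close> decreases to \<open>0\<close> are those lying in a fixed
  small disc around \<open>r\<close> for all small \<open>y\<close>. \<open>split_count F J H lam r X\<close> is the number of those of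
  them in the half-plane \<open>X\<close>, each counted with its algebraic multiplicity.
\<close>

definition split_count ::
    "('h::complex_hilbert, 'k::complex_hilbert) uop \<Rightarrow> 'k \<Rightarrow>\<^sub>L 'k \<Rightarrow> (real \<Rightarrow> ('h, 'h) uop) \<Rightarrow>
      real \<Rightarrow> real \<Rightarrow> complex set \<Rightarrow> nat" where
  "split_count F J H lam r X =
     (THE N. \<forall>\<^sub>F \<epsilon> in at_right 0. \<forall>\<^sub>F y in at_right 0.
        (\<Sum>w | w \<in> ball (of_real r) \<epsilon> \<inter> X \<and> is_pole (A_op F J H (Nonreal (Complex lam y))) w.
           crank (P_op F J H (Nonreal (Complex lam y)) w)) = N)"

definition resonance_index ::
    "('h::complex_hilbert, 'k::complex_hilbert) uop \<Rightarrow> 'k \<Rightarrow>\<^sub>L 'k \<Rightarrow> (real \<Rightarrow> ('h, 'h) uop) \<Rightarrow>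
      real \<Rightarrow> real \<Rightarrow> int" where
  "resonance_index F J H lam r =
     int (split_count F J H lam r {w. Im w > 0}) - int (split_count F J H lam r {w. Im w < 0})"

end

theory Submission
  imports Defs
begin

text \<open>
  Fix a regular real \<open>r\<close> and put \<open>T(y) = T\<^bsub>\<lambda>+iy\<^esub>(H\<^sub>r)\<close>, \<open>K(y) = T(y) J\<close>. The poles of \<open>A\<^bsub>\<lambda>+iy\<^esub>\<close> are the points where
  \<open>1 + (s - r) K(y)\<close> is not invertible. Since \<open>Im T(y) \<ge> 0\<close>, the operator \<open>K(y)\<close> is dissipative for the
  hermitian form \<open>[x, x] = \<langle>x, J x\<rangle>\<close>, strictly so for \<open>y > 0\<close>; hence for \<open>y > 0\<close> the form is positive definite on
  the sum \<open>V\<^sub>+\<close> of the root spaces of the poles near \<open>r\<^sub>\<lambda>\<close> in the upper half-plane and negative definite on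
  the corresponding \<open>V\<^sub>-\<close>. The projection onto \<open>V\<^sub>+ + V\<^sub>-\<close> is a contour integral of the resolvent family and
  converges in norm to \<open>P\<^bsub>\<lambda>+i0\<^esub>(r\<^sub>\<lambda>)\<close>. The resonance matrix represents the form on the range of the limit
  projection, and it is non-degenerate there: a vector in its radical would satisfy \<open>Im T(0) J x = 0\<close>, which
  produces a common eigenvector of \<open>T J\<close> and \<open>T\<^sup>* J\<close>. So no signature is lost in the limit \<open>y \<rightarrow> 0\<close>. The second
  matrix is treated in the same way with \<open>-T(y)\<^sup>*\<close> and \<open>-J\<close>, the poles being reflected in the real axis.
\<close>

text \<open>The definite subspaces for \<open>y > 0\<close> are not followed into the limit. Four
  ranks are squeezed instead. A vector on which the limit matrix is positive with a gap cannot be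
  annihilated by the projection onto \<open>V\<^sub>+\<close>, so its positive rank is at most the
  number of upper poles, and likewise for the lower ones. Norm convergence bounds the total number
  of poles by the rank of the limit projection. Injectivity of the matrix on that range bounds this
  rank by the sum of the positive and negative ranks. Hence all the inequalities are equalities.
  Strict dissipativity comes from closedness of \<open>F\<close>: Im <u, T u> is a limit of y
  |x_n|^2 with F x_n tending to T u, so if it vanishes, T u is a value of \<open>F\<close> at 0.
  Sandwiched operators, meromorphic extensions, residues, positive parts and pole counts are all
  definite descriptions, so much of the work is uniqueness: density of the domain of the adjoint,
  the identity theorem, independence of the radius, uniqueness of the spectral splitting.
  Operator-valued analysis is reduced to scalar functions by pairing with vectors, and an adjoint
  appears only as a relation between two given operators.\<close>

section \<open>Inner products\<close>

instance complex_hilbert \<subseteq> banach ..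

lemma cinner_add_left: "cinner (x + y) z = cinner x z + cinner y z"
  for x y z :: "'a::complex_inner"
  by (metis cinner_commute cinner_add_right complex_cnj_add)

lemma cinner_scaleC_left: "cinner (c *\<^sub>C x) y = cnj c * cinner x y"
  for x y :: "'a::complex_inner"
  by (metis cinner_commute cinner_scaleC_right complex_cnj_mult)

lemma scaleC_minus1: "(- 1) *\<^sub>C x = - x" for x :: "'a::complex_vector"
  using scaleC_of_real[of "-1" x] by simp

lemma cinner_minus_right [simp]: "cinner x (- y) = - cinner x y"
  for x y :: "'a::complex_inner"
  using cinner_scaleC_right[of x "-1" y] by (simp add: scaleC_minus1)

lemma cinner_minus_left [simp]: "cinner (- x) y = - cinner x y"
  for x y :: "'a::complex_inner"
  using cinner_scaleC_left[of "-1" x y] by (simp add: scaleC_minus1)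

lemma cinner_diff_right: "cinner x (y - z) = cinner x y - cinner x z"
  for x y z :: "'a::complex_inner"
  using cinner_add_right[of x y "-z"] by simp

lemma cinner_diff_left: "cinner (x - y) z = cinner x z - cinner y z"
  for x y z :: "'a::complex_inner"
  using cinner_add_left[of x "-y" z] by simp

lemma cinner_zero_right [simp]: "cinner x 0 = 0" for x :: "'a::complex_inner"
  using cinner_diff_right[of x 0 0] by simp

lemma cinner_zero_left [simp]: "cinner 0 x = 0" for x :: "'a::complex_inner"
  using cinner_diff_left[of 0 0 x] by simp

lemma cinner_sum_right: "cinner x (\<Sum>i\<in>I. f i) = (\<Sum>i\<in>I. cinner x (f i))"
  for x :: "'a::complex_inner"
  by (induction I rule: infinite_finite_induct) (simp_all add: cinner_add_right)

lemma Im_cinner_self [simp]: "Im (cinner x x) = 0" for x :: "'a::complex_inner"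
  using cinner_commute[of x x] by (simp add: complex_eq_iff)

lemma cinner_self: "cinner x x = complex_of_real ((norm x)\<^sup>2)" for x :: "'a::complex_inner"
proof -
  have "0 \<le> Re (cinner x x)"
    using norm_ge_zero[of x] by (simp add: norm_eq_sqrt_cinner)
  then show ?thesis
    by (simp add: complex_eq_iff norm_eq_sqrt_cinner)
qed

lemma norm_add_sq: "(norm (x + y))\<^sup>2 = (norm x)\<^sup>2 + (norm y)\<^sup>2 + 2 * Re (cinner x y)"
  for x y :: "'a::complex_inner"
proof -
  have "complex_of_real ((norm (x + y))\<^sup>2)
      = complex_of_real ((norm x)\<^sup>2) + complex_of_real ((norm y)\<^sup>2) + (cinner x y + cnj (cinner x y))"
    unfolding cinner_self[symmetric]
    by (simp add: cinner_add_left cinner_add_right cinner_commute[of y x])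
  then show ?thesis
    by (simp add: complex_eq_iff)
qed

lemma norm_diff_sq: "(norm (x - y))\<^sup>2 = (norm x)\<^sup>2 + (norm y)\<^sup>2 - 2 * Re (cinner x y)"
  for x y :: "'a::complex_inner"
  using norm_add_sq[of x "-y"] by simp

lemma Re_cinner_le: "Re (cinner x y) \<le> norm x * norm y" for x y :: "'a::complex_inner"
proof -
  have "(norm (x + y))\<^sup>2 \<le> (norm x + norm y)\<^sup>2"
    by (intro power_mono norm_triangle_ineq) simp
  then show ?thesis
    unfolding norm_add_sq by (simp add: power2_sum)
qed

lemma norm_cinner_le: "cmod (cinner x y) \<le> norm x * norm y" for x y :: "'a::complex_inner"
proof -
  \<comment> \<open>Rotating \<open>y\<close> by a phase turns the inner product into its modulus,
    so the bound on real parts suffices.\<close>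
  obtain c where c: "cmod c = 1" "c * cinner x y = complex_of_real (cmod (cinner x y))"
  proof (cases "cinner x y = 0")
    case True
    then show ?thesis using that[of 1] by simp
  next
    case False
    then have "inverse (sgn (cinner x y)) * cinner x y = cmod (cinner x y)"
      by (simp add: sgn_eq)
    then show ?thesis using that[of "inverse (sgn (cinner x y))"] False
      by (simp add: norm_inverse norm_sgn)
  qed
  have "cmod (cinner x y) = Re (cinner x (c *\<^sub>C y))"
    by (simp add: cinner_scaleC_right c)
  also have "\<dots> \<le> norm x * norm y"
    using Re_cinner_le[of x "c *\<^sub>C y"] by (simp add: norm_scaleC c)
  finally show ?thesis .
qed

lemma bounded_bilinear_cinner: "bounded_bilinear (cinner :: 'a::complex_inner \<Rightarrow> 'a \<Rightarrow> complex)"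
proof
  fix r :: real and a b :: 'a
  show "cinner (r *\<^sub>R a) b = r *\<^sub>R cinner a b"
    using cinner_scaleC_left[of "of_real r" a b] by (simp add: scaleC_of_real scaleR_conv_of_real)
  show "cinner a (r *\<^sub>R b) = r *\<^sub>R cinner a b"
    using cinner_scaleC_right[of a "of_real r" b] by (simp add: scaleC_of_real scaleR_conv_of_real)
  show "\<exists>K. \<forall>a b::'a. cmod (cinner a b) \<le> norm a * norm b * K"
    by (rule exI[of _ 1]) (simp add: norm_cinner_le)
qed (simp_all add: cinner_add_left cinner_add_right)

lemmas bounded_linear_cinner_right = bounded_bilinear.bounded_linear_right[OF bounded_bilinear_cinner]
lemmas tendsto_cinner [tendsto_intros] = bounded_bilinear.tendsto[OF bounded_bilinear_cinner]
lemmas continuous_on_cinner [continuous_intros] =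
  bounded_bilinear.continuous_on[OF bounded_bilinear_cinner]

lemma bounded_bilinear_scaleC:
  "bounded_bilinear (scaleC :: complex \<Rightarrow> 'a::complex_normed_vector \<Rightarrow> 'a)"
proof
  fix r :: real and c :: complex and x :: 'a
  show "(r *\<^sub>R c) *\<^sub>C x = r *\<^sub>R c *\<^sub>C x"
    by (simp add: scaleC_of_real[symmetric] scaleC_scaleC scaleR_conv_of_real)
  show "c *\<^sub>C (r *\<^sub>R x) = r *\<^sub>R c *\<^sub>C x"
    by (simp add: scaleC_of_real[symmetric] scaleC_scaleC mult.commute)
  show "\<exists>K. \<forall>c. \<forall>x::'a. norm (c *\<^sub>C x) \<le> norm c * norm x * K"
    by (rule exI[of _ 1]) (simp add: norm_scaleC)
qed (simp_all add: scaleC_left_distrib scaleC_right_distrib)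

lemmas tendsto_scaleC [tendsto_intros] = bounded_bilinear.tendsto[OF bounded_bilinear_scaleC]
lemmas continuous_on_scaleC [continuous_intros] =
  bounded_bilinear.continuous_on[OF bounded_bilinear_scaleC]

lemma scaleC_simps [simp]:
  fixes x :: "'a::complex_vector"
  shows "0 *\<^sub>C x = 0" "c *\<^sub>C (0::'a) = 0" "1 *\<^sub>C x = x"
    "(- c) *\<^sub>C x = - (c *\<^sub>C x)" "c *\<^sub>C (- x) = - (c *\<^sub>C x)"
  by simp_all

lemma scaleC_diff_right: "c *\<^sub>C (x - y) = c *\<^sub>C x - c *\<^sub>C y" for x y :: "'a::complex_vector"
  by (rule complex_vector.scale_right_diff_distrib)

lemma scaleC_diff_left: "(c - d) *\<^sub>C x = c *\<^sub>C x - d *\<^sub>C x" for x :: "'a::complex_vector"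
  by (rule complex_vector.scale_left_diff_distrib)

lemma cinner_eqI:
  fixes x y :: "'a::complex_inner"
  assumes "\<And>u. cinner u x = cinner u y"
  shows "x = y"
  using assms[of "x - y"] cinner_self[of "x - y"] by (simp add: cinner_diff_right)

lemma norm_le_if_cinner_le:
  fixes x :: "'a::complex_inner"
  assumes "\<And>u. cmod (cinner u x) \<le> C * norm u" "0 \<le> C"
  shows "norm x \<le> C"
proof (cases "x = 0")
  case False
  have "norm x * norm x \<le> C * norm x"
    using assms(1)[of x] by (simp add: cinner_self norm_power power2_eq_square norm_mult)
  then show ?thesis using False by simp
qed (use assms in simp)

section \<open>Orthogonal projections\<close>

lemma parallelogram_law:
  "(norm (x + y))\<^sup>2 + (norm (x - y))\<^sup>2 = 2 * (norm x)\<^sup>2 + 2 * (norm y)\<^sup>2"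
  for x y :: "'a::complex_inner"
  by (simp add: norm_add_sq norm_diff_sq)

lemma norm_Pair_sq: "(norm p)\<^sup>2 = (norm (fst p))\<^sup>2 + (norm (snd p))\<^sup>2"
  by (simp add: norm_prod_def)

text \<open>
  The parallelogram law is an assumption because the lemma is also used for the product of two
  Hilbert spaces, which carries no inner product here.
\<close>

lemma closest_point_exists:
  fixes M :: "'a::banach set"
  assumes para: "\<And>x y::'a. (norm (x + y))\<^sup>2 + (norm (x - y))\<^sup>2 = 2 * (norm x)\<^sup>2 + 2 * (norm y)\<^sup>2"
    and M: "closed M" "subspace M"
  obtains p where "p \<in> M" "\<And>m. m \<in> M \<Longrightarrow> norm (a - p) \<le> norm (a - m)"
proof -
  define \<delta> where "\<delta> = Inf ((\<lambda>m. norm (a - m)) ` M)"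
  have ne: "M \<noteq> {}" using subspace_0[OF M(2)] by auto
  have bdd: "bdd_below ((\<lambda>m. norm (a - m)) ` M)"
    by (rule bdd_belowI[of _ 0]) auto
  have low: "\<delta> \<le> norm (a - m)" if "m \<in> M" for m
    unfolding \<delta>_def by (rule cInf_lower) (use that bdd in auto)
  have d0: "0 \<le> \<delta>" unfolding \<delta>_def by (rule cInf_greatest) (use ne in auto)
  have "\<exists>m\<in>M. norm (a - m) < \<delta> + inverse (real (Suc n))" for n
    using cInf_lessD[of "(\<lambda>m. norm (a - m)) ` M" "\<delta> + inverse (real (Suc n))"] ne
    unfolding \<delta>_def by auto
  then obtain m where m: "\<And>n. m n \<in> M" "\<And>n. norm (a - m n) < \<delta> + inverse (real (Suc n))"
    by metis
  \<comment> \<open>The parallelogram law for \<open>a - m i\<close> and \<open>a - m j\<close>: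
    their sum is twice the vector to the midpoint, which lies in \<open>M\<close> and so has
    distance at least \<open>\<delta>\<close> from \<open>a\<close>.\<close>
  have key: "(norm (m i - m j))\<^sup>2 \<le> 2 * ((norm (a - m i))\<^sup>2 - \<delta>\<^sup>2) + 2 * ((norm (a - m j))\<^sup>2 - \<delta>\<^sup>2)"
    for i j
  proof -
    have "(1/2) *\<^sub>R (m i + m j) \<in> M"
      using M(2) m by (simp add: subspace_add subspace_scale)
    then have "\<delta> \<le> norm (a - (1/2) *\<^sub>R (m i + m j))" by (rule low)
    then have "\<delta>\<^sup>2 \<le> (norm (a - (1/2) *\<^sub>R (m i + m j)))\<^sup>2" using d0 by (rule power_mono)
    moreover have "(a - m i) + (a - m j) = 2 *\<^sub>R (a - (1/2) *\<^sub>R (m i + m j))"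
      by (simp add: algebra_simps scaleR_2)
    then have "(norm ((a - m i) + (a - m j)))\<^sup>2 = 4 * (norm (a - (1/2) *\<^sub>R (m i + m j)))\<^sup>2"
      by (simp add: power_mult_distrib)
    moreover have "norm ((a - m i) - (a - m j)) = norm (m i - m j)"
      by (simp add: norm_minus_commute)
    ultimately show ?thesis using para[of "a - m i" "a - m j"] by (simp add: algebra_simps)
  qed
  have lim: "(\<lambda>n. norm (a - m n)) \<longlonglongrightarrow> \<delta>"
  proof (rule tendsto_sandwich[of "\<lambda>n. \<delta>" _ _ "\<lambda>n. \<delta> + inverse (real (Suc n))"])
    show "(\<lambda>n. \<delta> + inverse (real (Suc n))) \<longlonglongrightarrow> \<delta>"
      using tendsto_add[OF tendsto_const LIMSEQ_inverse_real_of_nat, of \<delta>] by simp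
  qed (use m(2) low[OF m(1)] in \<open>auto intro!: always_eventually less_imp_le simp del: of_nat_Suc\<close>)
  have sqlim: "(\<lambda>n. (norm (a - m n))\<^sup>2 - \<delta>\<^sup>2) \<longlonglongrightarrow> 0"
    using tendsto_diff[OF tendsto_power[OF lim, of 2] tendsto_const[of "\<delta>\<^sup>2"]] by simp
  have "Cauchy m"
  proof (rule metric_CauchyI)
    fix e :: real assume e: "0 < e"
    then obtain N where N: "\<And>n. n \<ge> N \<Longrightarrow> (norm (a - m n))\<^sup>2 - \<delta>\<^sup>2 < e\<^sup>2 / 4"
      using order_tendstoD(2)[OF sqlim, of "e\<^sup>2 / 4"] by (auto simp: eventually_sequentially)
    show "\<exists>M. \<forall>i\<ge>M. \<forall>j\<ge>M. dist (m i) (m j) < e"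
    proof (intro exI allI impI)
      fix i j assume "N \<le> i" "N \<le> j"
      then have "(norm (m i - m j))\<^sup>2 < e\<^sup>2"
        using key[of i j] N[of i] N[of j] by simp
      then show "dist (m i) (m j) < e"
        using e by (simp add: dist_norm power_less_imp_less_base)
    qed
  qed
  then obtain p where p: "m \<longlonglongrightarrow> p" using Cauchy_convergent_iff convergent_def by blast
  have "p \<in> M" using closed_sequentially[OF M(1) _ p] m(1) by auto
  moreover have "norm (a - p) = \<delta>"
    using LIMSEQ_unique[OF tendsto_norm[OF tendsto_diff[OF tendsto_const p]] lim] by simp
  ultimately show ?thesis using that low by metis
qed

text \<open>A quadratic without constant term that is never negative has its minimum at 0, so its
  linear coefficient vanishes. It is the variational step behind orthogonality and behind null
  vectors of semidefinite forms.\<close>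

lemma real_minimum_zero:
  fixes a b :: real
  assumes "\<And>t. 0 \<le> t\<^sup>2 * b - 2 * t * a"
  shows "a = 0"
proof (rule ccontr)
  assume a: "a \<noteq> 0"
  \<comment> \<open>Positive and larger than \<open>b\<close>, so that the value at t = a/c is at
    most - a^2 / c.\<close>
  define c where "c = \<bar>b\<bar> + 1"
  have c: "c > 0" "b < c" by (auto simp: c_def)
  have "0 \<le> (a/c)\<^sup>2 * b - 2 * (a/c) * a" by (rule assms)
  also have "\<dots> \<le> (a/c)\<^sup>2 * c - 2 * (a/c) * a"
    using c by (intro diff_right_mono mult_left_mono) auto
  also have "\<dots> = - (a\<^sup>2 / c)" using c by (simp add: field_simps power2_eq_square)
  also have "\<dots> < 0" using a c by simp
  finally show False by simp
qed

lemma csubspace_imp_subspace: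
  assumes "complex_vector.subspace (M :: 'a::complex_vector set)"
  shows "subspace M"
  using assms unfolding subspace_def complex_vector.subspace_def
  by (metis scaleC_of_real)

lemma orthogonal_vector_exists:
  fixes M :: "'a::complex_hilbert set"
  assumes M: "closed M" "complex_vector.subspace M" "M \<noteq> UNIV"
  obtains v where "v \<noteq> 0" "\<And>m. m \<in> M \<Longrightarrow> cinner m v = 0"
proof -
  obtain a where a: "a \<notin> M" using M(3) by auto
  obtain p where p: "p \<in> M" "\<And>m. m \<in> M \<Longrightarrow> norm (a - p) \<le> norm (a - m)"
    using closest_point_exists[OF parallelogram_law M(1) csubspace_imp_subspace[OF M(2)], of a] by metis
  have re: "Re (cinner (a - p) m) = 0" if m: "m \<in> M" for m
  proof (rule real_minimum_zero)
    fix t :: real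
    have "p + t *\<^sub>R m \<in> M"
      using csubspace_imp_subspace[OF M(2)] p m by (simp add: subspace_add subspace_scale)
    from p(2)[OF this] have "(norm (a - p))\<^sup>2 \<le> (norm ((a - p) - t *\<^sub>R m))\<^sup>2"
      by (intro power_mono) (simp_all add: algebra_simps)
    then show "0 \<le> t\<^sup>2 * (norm m)\<^sup>2 - 2 * t * Re (cinner (a - p) m)"
      unfolding norm_diff_sq
      by (simp add: scaleC_of_real[symmetric] cinner_scaleC_right norm_scaleC power_mult_distrib)
  qed
  \<comment> \<open>Real variations control only the real part; applying the result to
    \<open>\<i> *\<^sub>C m\<close> as well removes the imaginary part.\<close>
  have "cinner m (a - p) = 0" if m: "m \<in> M" for m
  proof -
    have "\<i> *\<^sub>C m \<in> M" using M(2) m by (simp add: complex_vector.subspace_scale)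
    from re[OF m] re[OF this] have "cinner (a - p) m = 0"
      by (simp add: cinner_scaleC_right complex_eq_iff)
    then show ?thesis using cinner_commute[of m "a - p"] by simp
  qed
  moreover have "a - p \<noteq> 0" using a p by auto
  ultimately show ?thesis using that by blast
qed

section \<open>Linear algebra in finite dimension for possibly indefinite forms\<close>

section \<open>Finite-dimensional subspaces\<close>

text \<open>Finite dimension has to be carried explicitly: \<open>cdim\<close> is 0 on
  infinite-dimensional spaces, so an inequality of dimensions alone would say nothing. Inclusion in
  a finite span makes the notion hereditary for arbitrary subsets.\<close>

definition finite_dim :: "'a::complex_vector set \<Rightarrow> bool" where
  "finite_dim V \<longleftrightarrow> (\<exists>B. finite B \<and> V \<subseteq> complex_vector.span B)"

lemma finite_dim_subset: "finite_dim W \<Longrightarrow> V \<subseteq> W \<Longrightarrow> finite_dim V"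
  unfolding finite_dim_def by blast

lemma finite_dim_basis:
  assumes "finite_dim V"
  obtains B where "finite B" "B \<subseteq> V" "complex_vector.independent B"
    "V \<subseteq> complex_vector.span B" "card B = cdim V"
proof -
  obtain C where C: "finite C" "V \<subseteq> complex_vector.span C"
    using assms unfolding finite_dim_def by blast
  obtain B where B: "B \<subseteq> V" "complex_vector.independent B" "V \<subseteq> complex_vector.span B" "card B = cdim V"
    using complex_vector.basis_exists by blast
  have "finite B" using complex_vector.independent_span_bound[OF C(1) B(2)] B(1) C(2) by auto
  with B show ?thesis using that by blast
qed

text \<open>The image of a basis of \<open>V\<close> is independent inside the span of a basis of
  \<open>W\<close>. Injectivity is asked for on \<open>V\<close> only, because the maps used later
  are mostly projections or finite-rank operators with a large kernel.\<close>

lemma linear_inj_cdim_le: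
  fixes V :: "'a::complex_vector set" and W :: "'b::complex_vector set"
  assumes f: "Vector_Spaces.linear scaleC scaleC f" and V: "complex_vector.subspace V"
    and inj: "\<And>x. x \<in> V \<Longrightarrow> f x = 0 \<Longrightarrow> x = 0" and W: "f ` V \<subseteq> W" "finite_dim W"
  shows "finite_dim V" "cdim V \<le> cdim W"
proof -
  interpret f: Vector_Spaces.linear scaleC scaleC f by (rule f)
  obtain B where B: "B \<subseteq> V" "complex_vector.independent B" "V \<subseteq> complex_vector.span B" "card B = cdim V"
    using complex_vector.basis_exists by blast
  obtain C where C: "finite C" "W \<subseteq> complex_vector.span C" "card C = cdim W"
    using finite_dim_basis[OF W(2)] by metis
  have span: "complex_vector.span B \<subseteq> V" using V B(1) by (rule complex_vector.span_minimal[rotated])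
  have inj_on: "inj_on f (complex_vector.span B)"
  proof (rule inj_onI)
    fix x y assume xy: "x \<in> complex_vector.span B" "y \<in> complex_vector.span B" "f x = f y"
    have "x - y \<in> V" using xy span V by (auto intro: complex_vector.subspace_diff)
    moreover have "f (x - y) = 0" using xy by (simp add: f.diff)
    ultimately show "x = y" using inj by fastforce
  qed
  have ind: "complex_vector.independent (f ` B)" using B(2) inj_on by (rule f.independent_injective_image)
  have "f ` B \<subseteq> complex_vector.span C" using B(1) W(1) C(2) by blast
  from complex_vector.independent_span_bound[OF C(1) ind this]
  have fin: "finite (f ` B)" "card (f ` B) \<le> card C" by auto
  have injB: "inj_on f B" using inj_on by (rule inj_on_subset) (rule complex_vector.span_superset)
  show "finite_dim V" unfolding finite_dim_def using fin(1) injB B(3) finite_imageD by blast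
  show "cdim V \<le> cdim W" using fin(2) injB B(4) C(3) by (simp add: card_image)
qed

section \<open>Hermitian forms\<close>

text \<open>Besides the inner product, the instances are \<open>\<lambda>x z. cinner x (J z)\<close>
  and its negative, which may be indefinite; definiteness is therefore imposed on subspaces, by
  \<open>positive_on\<close>.\<close>

locale hermitian_form =
  fixes h :: "'a::complex_vector \<Rightarrow> 'a \<Rightarrow> complex"
  assumes commute: "h x y = cnj (h y x)"
    and add_right: "h x (y + z) = h x y + h x z"
    and scale_right: "h x (c *\<^sub>C y) = c * h x y"
begin

lemma add_left: "h (x + y) z = h x z + h y z"
  by (metis commute add_right complex_cnj_add)

lemma scale_left: "h (c *\<^sub>C x) y = cnj c * h x y"
  by (metis commute scale_right complex_cnj_mult)

lemma minus_right: "h x (- y) = - h x y"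
  using scale_right[of x "-1" y] by simp

lemma minus_left: "h (- x) y = - h x y"
  using scale_left[of "-1" x y] by simp

lemma diff_right: "h x (y - z) = h x y - h x z"
  using add_right[of x y "-z"] by (simp add: minus_right)

lemma zero_right [simp]: "h x 0 = 0"
  using scale_right[of x 0 0] by simp

lemma zero_left [simp]: "h 0 x = 0"
  using scale_left[of 0 0 x] by simp

lemma sum_right: "h x (\<Sum>i\<in>I. f i) = (\<Sum>i\<in>I. h x (f i))"
  by (induction I rule: infinite_finite_induct) (simp_all add: add_right)

lemma Im_self [simp]: "Im (h x x) = 0"
  using commute[of x x] by (simp add: complex_eq_iff)

lemma self_real: "h x x = complex_of_real (Re (h x x))"
  by (simp add: complex_eq_iff)

lemma uminus: "hermitian_form (\<lambda>x y. - h x y)"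
  by unfold_locales (simp_all add: add_right scale_right commute[symmetric]) 

definition positive_on :: "'a set \<Rightarrow> bool" where
  "positive_on V \<longleftrightarrow> (\<forall>x\<in>V. x \<noteq> 0 \<longrightarrow> 0 < Re (h x x))"

definition orthonormal :: "'a set \<Rightarrow> bool" where
  "orthonormal E \<longleftrightarrow> (\<forall>e\<in>E. \<forall>e'\<in>E. h e e' = (if e = e' then 1 else 0))"

definition proj :: "'a set \<Rightarrow> 'a \<Rightarrow> 'a" where
  "proj E x = (\<Sum>e\<in>E. h e x *\<^sub>C e)"

lemma proj_in_span: "proj E x \<in> complex_vector.span E"
  unfolding proj_def
  by (intro complex_vector.span_sum complex_vector.span_scale complex_vector.span_base)

lemma orthogonal_span:
  assumes "\<And>e. e \<in> E \<Longrightarrow> h e y = 0" "u \<in> complex_vector.span E"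
  shows "h u y = 0"
  using assms(2)
  by (induction rule: complex_vector.span_induct_alt) (simp_all add: add_left scale_left assms(1))

lemma proj_orthogonal_base:
  assumes "finite E" "orthonormal E" "e \<in> E"
  shows "h e (x - proj E x) = 0"
proof -
  have "h e (proj E x) = (\<Sum>e'\<in>E. h e' x * h e e')"
    by (simp add: proj_def sum_right scale_right)
  also have "\<dots> = (\<Sum>e'\<in>E. if e' = e then h e x else 0)"
    using assms by (intro sum.cong) (auto simp: orthonormal_def)
  finally show ?thesis using assms by (simp add: diff_right)
qed

lemma proj_orthogonal:
  assumes "finite E" "orthonormal E" "u \<in> complex_vector.span E"
  shows "h u (x - proj E x) = 0"
  using orthogonal_span[OF proj_orthogonal_base[OF assms(1,2)] assms(3)] .

text \<open>Positivity on the span of \<open>B\<close> is all that the orthonormalization uses, so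
  it also runs inside a positive subspace of an indefinite form. \<open>B\<close> may be dependent,
  in which case vectors are dropped.\<close>

lemma gram_schmidt:
  assumes "finite B" "positive_on (complex_vector.span B)"
  shows "\<exists>E. finite E \<and> complex_vector.span E = complex_vector.span B \<and> orthonormal E"
  using assms
proof (induction B)
  case empty
  show ?case by (rule exI[of _ "{}"]) (simp add: orthonormal_def)
next
  case (insert b B)
  have "complex_vector.span B \<subseteq> complex_vector.span (insert b B)"
    by (rule complex_vector.span_mono) auto
  with insert obtain E where E: "finite E" "complex_vector.span E = complex_vector.span B" "orthonormal E"
    unfolding positive_on_def by blast
  define b' where "b' = b - proj E b"
  have span_b: "complex_vector.span (insert b B) = complex_vector.span (insert b E)"
    by (simp add: complex_vector.span_insert E(2))
  have span_b': "complex_vector.span (insert b E) = complex_vector.span (insert b' E)"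
    by (rule complex_vector.eq_span_insert_eq) (simp add: b'_def proj_in_span)
  have orth: "h e b' = 0" if "e \<in> E" for e
    unfolding b'_def by (rule proj_orthogonal_base[OF E(1,3) that])
  show ?case
  proof (cases "b' = 0")
    case True
    then have "complex_vector.span (insert b B) = complex_vector.span E"
      unfolding span_b span_b' by (simp add: complex_vector.span_insert_0)
    then show ?thesis using E by blast
  next
    case False
    have "b' \<in> complex_vector.span (insert b B)"
      unfolding span_b span_b' by (rule complex_vector.span_base) simp
    then have pos: "0 < Re (h b' b')" using False insert.prems by (simp add: positive_on_def)
    define c where "c = complex_of_real (1 / sqrt (Re (h b' b')))"
    define e0 where "e0 = c *\<^sub>C b'"
    have c0: "c \<noteq> 0" using pos by (simp add: c_def)
    have one: "h e0 e0 = 1"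
    proof -
      define r where "r = Re (h b' b')"
      have "h e0 e0 = cnj c * c * complex_of_real r"
        unfolding e0_def r_def by (subst self_real[symmetric]) (simp add: scale_left scale_right)
      also have "cnj c * c = complex_of_real (1 / r)"
        using pos by (simp add: c_def r_def[symmetric] flip: of_real_mult)
      finally show ?thesis using pos by (simp add: r_def[symmetric])
    qed
    have e0: "h e e0 = 0" if "e \<in> E" for e
      using orth[OF that] by (simp add: e0_def scale_right)
    have e0': "h e0 e = 0" if "e \<in> E" for e
      using e0[OF that] commute[of e0 e] by simp
    have "complex_vector.span (insert e0 E) = complex_vector.span (insert b' E)"
    proof (intro equalityI complex_vector.span_minimal complex_vector.subspace_span insert_subsetI)
      show "e0 \<in> complex_vector.span (insert b' E)"
        unfolding e0_def by (intro complex_vector.span_scale complex_vector.span_base) simp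
      have "b' = inverse c *\<^sub>C e0" using c0 by (simp add: e0_def scaleC_scaleC)
      then show "b' \<in> complex_vector.span (insert e0 E)"
        by (metis complex_vector.span_scale complex_vector.span_base insertI1)
    qed (auto intro: complex_vector.span_base)
    moreover have "orthonormal (insert e0 E)"
      using E(3) one e0 e0' unfolding orthonormal_def by auto
    ultimately show ?thesis
      unfolding span_b span_b' using E(1) by (intro exI[of _ "insert e0 E"]) auto
  qed
qed

text \<open>The form gives no norm in which a closest point could be sought; the complement comes
  from an orthonormal basis of the finite-dimensional positive subspace \<open>V\<close>.\<close>

lemma orthogonal_decomposition:
  assumes "finite_dim V" "complex_vector.subspace V" "positive_on V"
  obtains w where "w \<in> V" "\<And>u. u \<in> V \<Longrightarrow> h u (x - w) = 0"
proof -
  obtain B where B: "finite B" "B \<subseteq> V" "V \<subseteq> complex_vector.span B"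
    using finite_dim_basis[OF assms(1)] by metis
  then have span: "complex_vector.span B = V"
    using complex_vector.span_minimal[OF B(2) assms(2)] by auto
  obtain E where E: "finite E" "complex_vector.span E = V" "orthonormal E"
    using gram_schmidt[OF B(1)] assms(3) unfolding span by blast
  show ?thesis
    using that[of "proj E x"] proj_in_span[of E x] proj_orthogonal[OF E(1,3)] E(2) by auto
qed

end

interpretation cinner: hermitian_form "cinner :: 'a::complex_inner \<Rightarrow> 'a \<Rightarrow> complex"
  by unfold_locales (rule cinner_commute cinner_add_right cinner_scaleC_right)+

lemma cinner_positive_on: "cinner.positive_on V"
  unfolding cinner.positive_on_def by (simp add: cinner_self)

section \<open>Complex linear operators\<close>

abbreviation one_op :: "'a::real_normed_vector \<Rightarrow>\<^sub>L 'a" where "one_op \<equiv> id_blinfun"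

lemma clinear_blinfunD: "clinear_blinfun T \<Longrightarrow> T (c *\<^sub>C x) = c *\<^sub>C T x"
  by (simp add: clinear_blinfun_def)

lemma scaleC_blinfun_apply [simp]: "blinfun_apply (c *\<^sub>C T) x = c *\<^sub>C T x"
  by (simp add: scaleC_blinfun.rep_eq)

lemma clinear_linear:
  assumes "clinear_blinfun T" shows "Vector_Spaces.linear scaleC scaleC (blinfun_apply T)"
  by unfold_locales (simp_all add: blinfun.add_right clinear_blinfunD[OF assms])

lemma clinear_blinfun_intros [simp, intro]:
  "clinear_blinfun (0 :: 'a::complex_normed_vector \<Rightarrow>\<^sub>L 'b::complex_normed_vector)"
  "clinear_blinfun (one_op :: 'a \<Rightarrow>\<^sub>L 'a)"
  "clinear_blinfun S \<Longrightarrow> clinear_blinfun T \<Longrightarrow> clinear_blinfun (S + T)"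
  "clinear_blinfun S \<Longrightarrow> clinear_blinfun T \<Longrightarrow> clinear_blinfun (S - T)"
  "clinear_blinfun S \<Longrightarrow> clinear_blinfun (- S)"
  "clinear_blinfun S \<Longrightarrow> clinear_blinfun (c *\<^sub>C S)"
  for S T :: "'a::complex_normed_vector \<Rightarrow>\<^sub>L 'b::complex_normed_vector"
  by (simp_all add: clinear_blinfun_def blinfun.add_left blinfun.diff_left blinfun.minus_left
      scaleC_right_distrib scaleC_diff_right scaleC_scaleC mult.commute)

lemma clinear_blinfun_compose [simp, intro]:
  "clinear_blinfun S \<Longrightarrow> clinear_blinfun T \<Longrightarrow> clinear_blinfun (S o\<^sub>L T)"
  by (simp add: clinear_blinfun_def)

lemma clinear_blinfun_sum [intro]:
  "(\<And>i. i \<in> I \<Longrightarrow> clinear_blinfun (f i)) \<Longrightarrow> clinear_blinfun (\<Sum>i\<in>I. f i)"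
  by (induction I rule: infinite_finite_induct) auto

lemma clinear_blinfun_limit:
  assumes "(f \<longlongrightarrow> T) G" "G \<noteq> bot" "\<forall>\<^sub>F x in G. clinear_blinfun (f x)"
  shows "clinear_blinfun T"
  unfolding clinear_blinfun_def
proof (intro allI)
  fix c x
  have "((\<lambda>y. f y (c *\<^sub>C x)) \<longlongrightarrow> T (c *\<^sub>C x)) G"
    by (intro tendsto_intros assms)
  moreover have "((\<lambda>y. c *\<^sub>C f y x) \<longlongrightarrow> c *\<^sub>C T x) G"
    by (intro tendsto_intros assms)
  then have "((\<lambda>y. f y (c *\<^sub>C x)) \<longlongrightarrow> c *\<^sub>C T x) G"
    by (rule Lim_transform_eventually) (use assms(3) in eventually_elim, simp add: clinear_blinfunD)
  ultimately show "T (c *\<^sub>C x) = c *\<^sub>C T x" using assms(2) tendsto_unique by blast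
qed

lemma compose_simps:
  fixes S T U :: "'a::complex_normed_vector \<Rightarrow>\<^sub>L 'a"
  shows "(S o\<^sub>L T) o\<^sub>L U = S o\<^sub>L (T o\<^sub>L U)"
    "(S + T) o\<^sub>L U = (S o\<^sub>L U) + (T o\<^sub>L U)" "(S - T) o\<^sub>L U = (S o\<^sub>L U) - (T o\<^sub>L U)"
    "S o\<^sub>L (T + U) = (S o\<^sub>L T) + (S o\<^sub>L U)" "S o\<^sub>L (T - U) = (S o\<^sub>L T) - (S o\<^sub>L U)"
    "(c *\<^sub>C S) o\<^sub>L T = c *\<^sub>C (S o\<^sub>L T)" "S o\<^sub>L one_op = S" "one_op o\<^sub>L S = S"
    "clinear_blinfun S \<Longrightarrow> S o\<^sub>L (c *\<^sub>C T) = c *\<^sub>C (S o\<^sub>L T)"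
    "0 o\<^sub>L S = 0" "S o\<^sub>L 0 = 0" "(- S) o\<^sub>L T = - (S o\<^sub>L T)" "S o\<^sub>L (- T) = - (S o\<^sub>L T)"
  by (auto intro!: blinfun_eqI simp: blinfun.add_left blinfun.diff_left blinfun.add_right
      blinfun.diff_right blinfun.minus_left blinfun.minus_right clinear_blinfunD)

lemma subspace_range:
  assumes "clinear_blinfun T" shows "complex_vector.subspace (range (blinfun_apply T))"
proof (rule complex_vector.subspaceI)
  show "0 \<in> range (blinfun_apply T)" by (rule range_eqI[of _ _ 0]) simp
  fix x y c assume "x \<in> range (blinfun_apply T)"
  then obtain a where a: "x = T a" by auto
  then show "c *\<^sub>C x \<in> range (blinfun_apply T)"
    by (intro range_eqI[of _ _ "c *\<^sub>C a"]) (simp add: clinear_blinfunD[OF assms])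
  assume "y \<in> range (blinfun_apply T)"
  then obtain b where "y = T b" by auto
  with a show "x + y \<in> range (blinfun_apply T)"
    by (intro range_eqI[of _ _ "a + b"]) (simp add: blinfun.add_right)
qed

lemma subspace_kernel: "clinear_blinfun T \<Longrightarrow> complex_vector.subspace {x. T x = 0}"
  by (rule complex_vector.subspaceI) (simp_all add: blinfun.add_right clinear_blinfunD)

section \<open>Compact operators, inverses and the analytic Fredholm alternative\<close>

section \<open>Operators approximable by finite-rank operators\<close>

definition rank_one :: "'a::complex_inner \<Rightarrow> 'a \<Rightarrow> 'a \<Rightarrow>\<^sub>L 'a" where
  "rank_one u v = Blinfun (\<lambda>x. cinner v x *\<^sub>C u)"

lemma rank_one_apply [simp]: "blinfun_apply (rank_one u v) x = cinner v x *\<^sub>C u"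
proof -
  have "bounded_linear (\<lambda>x. cinner v x *\<^sub>C u)"
    using bounded_linear_compose[OF bounded_bilinear.bounded_linear_left[OF bounded_bilinear_scaleC, of u]
        bounded_linear_cinner_right[of v]] by simp
  then show ?thesis by (simp add: rank_one_def bounded_linear_Blinfun_apply)
qed

lemma clinear_rank_one [simp, intro]: "clinear_blinfun (rank_one u v)"
  by (simp add: clinear_blinfun_def cinner_scaleC_right scaleC_scaleC)

text \<open>The bounded factor \<open>B\<close> stands where one would apply the adjoint of
  \<open>B\<close> to \<open>v\<close>; in this form the class is stable under right multiplication
  without any adjoint being constructed.\<close>

inductive finite_rank :: "('a::complex_inner \<Rightarrow>\<^sub>L 'a) \<Rightarrow> bool" where
  zero: "finite_rank 0"
| add: "finite_rank D \<Longrightarrow> clinear_blinfun B \<Longrightarrow> finite_rank (D + (rank_one u v o\<^sub>L B))"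

lemma finite_rank_clinear: "finite_rank D \<Longrightarrow> clinear_blinfun D"
  by (induction rule: finite_rank.induct) auto

lemma finite_rank_compose_left:
  "finite_rank D \<Longrightarrow> clinear_blinfun L \<Longrightarrow> finite_rank (L o\<^sub>L D)"
proof (induction rule: finite_rank.induct)
  case (add D B u v)
  have "(L o\<^sub>L (D + (rank_one u v o\<^sub>L B))) = (L o\<^sub>L D) + (rank_one (L u) v o\<^sub>L B)"
    using add.prems by (intro blinfun_eqI) (simp add: blinfun.add_left blinfun.add_right clinear_blinfunD)
  then show ?case using add by (simp add: finite_rank.add)
qed (simp add: compose_simps finite_rank.zero)

lemma finite_rank_compose_right:
  "finite_rank D \<Longrightarrow> clinear_blinfun L \<Longrightarrow> finite_rank (D o\<^sub>L L)"
proof (induction rule: finite_rank.induct)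
  case (add D B u v)
  have "(D + (rank_one u v o\<^sub>L B)) o\<^sub>L L = (D o\<^sub>L L) + (rank_one u v o\<^sub>L (B o\<^sub>L L))"
    by (simp add: compose_simps)
  then show ?case using add by (simp add: finite_rank.add)
qed (simp add: compose_simps finite_rank.zero)

lemma finite_rank_range: "finite_rank D \<Longrightarrow> finite_dim (range (blinfun_apply D))"
proof (induction rule: finite_rank.induct)
  case zero
  show ?case unfolding finite_dim_def by (rule exI[of _ "{}"]) auto
next
  case (add D B u v)
  then obtain C where C: "finite C" "range D \<subseteq> complex_vector.span C"
    unfolding finite_dim_def by blast
  have "blinfun_apply (D + (rank_one u v o\<^sub>L B)) x \<in> complex_vector.span (insert u C)" for x
  proof -
    have "D x \<in> complex_vector.span (insert u C)"
      using C(2) complex_vector.span_mono[of C "insert u C"] by auto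
    moreover have "cinner v (B x) *\<^sub>C u \<in> complex_vector.span (insert u C)"
      by (intro complex_vector.span_scale complex_vector.span_base) simp
    ultimately show ?thesis by (simp add: blinfun.add_left complex_vector.span_add)
  qed
  then show ?case unfolding finite_dim_def using C(1) by (intro exI[of _ "insert u C"]) auto
qed

lemma finite_rank_sum:
  "finite I \<Longrightarrow> clinear_blinfun B \<Longrightarrow> finite_rank (\<Sum>i\<in>I. rank_one (f i) (g i) o\<^sub>L B)"
proof (induction rule: finite_induct)
  case (insert i I)
  then show ?case
    using finite_rank.add[of "\<Sum>i\<in>I. rank_one (f i) (g i) o\<^sub>L B" B] by (simp add: add.commute)
qed (simp add: finite_rank.zero)

text \<open>On a Hilbert space these are the compact complex linear operators. Approximation is the
  working notion because it passes at once to norm limits and products, and because the Fredholm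
  alternative starts from a finite-rank approximation.\<close>

definition approximable :: "('a::complex_inner \<Rightarrow>\<^sub>L 'a) \<Rightarrow> bool" where
  "approximable K \<longleftrightarrow> (\<forall>e>0. \<exists>D. finite_rank D \<and> norm (K - D) < e)"

lemma approximable_limit:
  assumes "(f \<longlongrightarrow> K) G" "G \<noteq> bot" "\<forall>\<^sub>F x in G. approximable (f x)"
  shows "approximable K"
  unfolding approximable_def
proof (intro allI impI)
  fix e :: real assume e: "0 < e"
  then have "\<forall>\<^sub>F x in G. dist (f x) K < e / 2" using assms(1) by (intro tendstoD) auto
  with assms(3) have "\<forall>\<^sub>F x in G. approximable (f x) \<and> dist (f x) K < e / 2" by (rule eventually_conj)
  then obtain x where x: "approximable (f x)" "dist (f x) K < e / 2"
    using assms(2) eventually_happens' by blast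
  then obtain D where D: "finite_rank D" "norm (f x - D) < e / 2"
    using e unfolding approximable_def by (meson half_gt_zero)
  have "norm (K - D) \<le> norm (K - f x) + norm (f x - D)"
    by (rule order.trans[OF _ norm_triangle_ineq]) simp
  also have "\<dots> < e" using x(2) D(2) by (simp add: dist_norm norm_minus_commute)
  finally show "\<exists>D. finite_rank D \<and> norm (K - D) < e" using D(1) by blast
qed

lemma approximable_compose:
  assumes K: "approximable K" and L: "clinear_blinfun L"
  shows "approximable (L o\<^sub>L K)" "approximable (K o\<^sub>L L)"
proof -
  have "\<exists>D. finite_rank D \<and> norm ((L o\<^sub>L K) - D) < e \<and>
      (\<exists>D'. finite_rank D' \<and> norm ((K o\<^sub>L L) - D') < e)" if e: "0 < e" for e
  proof -
    have "0 < e / (norm L + 1)" using e by (simp add: add_nonneg_pos)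
    then obtain D where D: "finite_rank D" "norm (K - D) < e / (norm L + 1)"
      using K unfolding approximable_def by blast
    have b: "norm L * norm (K - D) < e"
    proof -
      have "norm L * norm (K - D) \<le> (norm L + 1) * norm (K - D)" by (simp add: mult_right_mono)
      also have "\<dots> < e" using D(2) by (simp add: pos_less_divide_eq add_nonneg_pos mult.commute)
      finally show ?thesis .
    qed
    have "norm ((L o\<^sub>L K) - (L o\<^sub>L D)) < e"
      using norm_blinfun_compose[of L "K - D"] b by (simp add: compose_simps)
    moreover have "norm ((K o\<^sub>L L) - (D o\<^sub>L L)) < e"
      using norm_blinfun_compose[of "K - D" L] b by (simp add: compose_simps mult.commute)
    ultimately show ?thesis
      using finite_rank_compose_left[OF D(1) L] finite_rank_compose_right[OF D(1) L] by blast
  qed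
  then show "approximable (L o\<^sub>L K)" "approximable (K o\<^sub>L L)"
    unfolding approximable_def by blast+
qed

lemma approximable_uminus: 
  assumes "approximable K" shows "approximable (- K)"
  using approximable_compose(1)[OF assms, of "- one_op"] by (simp add: compose_simps)

text \<open>A \<open>D\<close> at distance less than 1 from \<open>G\<close> cannot annihilate a
  non-zero fixed vector of \<open>G\<close>, hence embeds \<open>V\<close> into its own
  finite-dimensional range.\<close>

lemma approximable_fixed_finite_dim:
  assumes G: "approximable G" and V: "complex_vector.subspace V" "\<And>x. x \<in> V \<Longrightarrow> G x = x"
  shows "finite_dim V"
proof -
  obtain D where D: "finite_rank D" "norm (G - D) < 1"
    using G unfolding approximable_def by (meson zero_less_one)
  show ?thesis
  proof (rule linear_inj_cdim_le(1)[OF clinear_linear[OF finite_rank_clinear[OF D(1)]] V(1)])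
    fix x assume x: "x \<in> V" "D x = 0"
    then have "x = (G - D) x" using V(2) by (simp add: blinfun.diff_left)
    then have "norm x \<le> norm (G - D) * norm x" using norm_blinfun[of "G - D" x] by simp
    then show "x = 0" using D(2) mult_less_cancel_right2[of "norm (G - D)" "norm x"] by fastforce
  qed (use finite_rank_range[OF D(1)] in auto)
qed

text \<open>The approximants are \<open>K\<close> followed by the orthogonal projection onto the
  span of a finite net for the image of the unit ball.\<close>

lemma compact_approximable:
  assumes K: "compact_blinfun K" "clinear_blinfun K"
  shows "approximable K"
  unfolding approximable_def
proof (intro allI impI)
  fix e :: real assume e: "0 < e"
  have "compact (closure (blinfun_apply K ` cball 0 1))"
    using K(1) unfolding compact_blinfun_def by (simp add: bounded_cball)
  then obtain B where B: "finite B" "closure (blinfun_apply K ` cball 0 1) \<subseteq> (\<Union>x\<in>B. ball x (e/2))"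
    unfolding compact_eq_totally_bounded using e by (meson half_gt_zero)
  obtain E where E: "finite E" "complex_vector.span E = complex_vector.span B" "cinner.orthonormal E"
    using cinner.gram_schmidt[OF B(1) cinner_positive_on] by blast
  define D where "D = (\<Sum>e\<in>E. rank_one e e o\<^sub>L K)"
  have Dx: "D x = cinner.proj E (K x)" for x
    by (simp add: D_def cinner.proj_def blinfun.sum_left)
  have small: "norm ((K - D) x) \<le> e/2" if x: "norm x \<le> 1" for x
  proof -
    have "K x \<in> closure (blinfun_apply K ` cball 0 1)"
      using x by (intro closure_subset[THEN subsetD]) auto
    then obtain b where b: "b \<in> B" "norm (b - K x) < e/2" using B(2) by (auto simp: dist_norm)
    define p where "p = cinner.proj E (K x)"
    \<comment> \<open>Pythagoras: the projection \<open>p\<close> is at least as close to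
      \<open>K x\<close> as the net point \<open>b\<close>.\<close>
    have "p - b \<in> complex_vector.span E"
      unfolding p_def using E(2) b(1)
      by (intro complex_vector.span_diff cinner.proj_in_span) (auto intro: complex_vector.span_base)
    then have "cinner (p - b) (K x - p) = 0"
      unfolding p_def using cinner.proj_orthogonal[OF E(1,3)] by blast
    then have "(norm ((p - b) + (K x - p)))\<^sup>2 = (norm (p - b))\<^sup>2 + (norm (K x - p))\<^sup>2"
      by (simp only: norm_add_sq) simp
    then have "(norm (K x - p))\<^sup>2 \<le> (norm (K x - b))\<^sup>2" by simp
    then have "norm (K x - p) \<le> norm (K x - b)" by (rule power2_le_imp_le) simp
    then show ?thesis using b(2) by (simp add: blinfun.diff_left Dx p_def norm_minus_commute)
  qed
  have "norm (K - D) \<le> e/2"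
  proof (rule norm_blinfun_bound)
    fix x show "norm ((K - D) x) \<le> e/2 * norm x"
    proof (cases "x = 0")
      case False
      have "norm ((K - D) ((1 / norm x) *\<^sub>R x)) \<le> e/2" by (rule small) simp
      then show ?thesis using False by (simp add: blinfun.scaleR_right field_simps)
    qed simp
  qed (use e in simp)
  then show "\<exists>D. finite_rank D \<and> norm (K - D) < e"
    using e finite_rank_sum[OF E(1) K(2), of "\<lambda>e. e" "\<lambda>e. e"]
    by (intro exI[of _ D]) (simp add: D_def)
qed

section \<open>Invertible operators\<close>

definition is_inverse :: "('a::real_normed_vector \<Rightarrow>\<^sub>L 'a) \<Rightarrow> ('a \<Rightarrow>\<^sub>L 'a) \<Rightarrow> bool" where
  "is_inverse M N \<longleftrightarrow> M o\<^sub>L N = one_op \<and> N o\<^sub>L M = one_op"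

definition invertible_op :: "('a::real_normed_vector \<Rightarrow>\<^sub>L 'a) \<Rightarrow> bool" where
  "invertible_op M \<longleftrightarrow> (\<exists>N. is_inverse M N)"

definition inv_op :: "('a::real_normed_vector \<Rightarrow>\<^sub>L 'a) \<Rightarrow> 'a \<Rightarrow>\<^sub>L 'a" where
  "inv_op M = (THE N. is_inverse M N)"

lemma is_inverse_apply:
  assumes "is_inverse M N" shows "M (N x) = x" "N (M x) = x"
  using assms unfolding is_inverse_def by (metis blinfun_apply_blinfun_compose id_blinfun.rep_eq)+

lemma is_inverse_unique: "is_inverse M N \<Longrightarrow> is_inverse M N' \<Longrightarrow> N = N'"
  by (metis blinfun_eqI is_inverse_apply)

lemma inv_op_eqI: "is_inverse M N \<Longrightarrow> inv_op M = N"
  unfolding inv_op_def using is_inverse_unique by blast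

lemma invertible_opI: "is_inverse M N \<Longrightarrow> invertible_op M"
  unfolding invertible_op_def by blast

lemma is_inverse_inv_op: "invertible_op M \<Longrightarrow> is_inverse M (inv_op M)"
  unfolding invertible_op_def using inv_op_eqI by metis

lemma clinear_inverse:
  assumes "is_inverse M N" "clinear_blinfun M" shows "clinear_blinfun N"
  unfolding clinear_blinfun_def
proof (intro allI)
  fix c x
  have "c *\<^sub>C x = M (c *\<^sub>C N x)" by (simp add: clinear_blinfunD[OF assms(2)] is_inverse_apply[OF assms(1)])
  then show "N (c *\<^sub>C x) = c *\<^sub>C N x" by (simp add: is_inverse_apply[OF assms(1)])
qed

lemma neumann_series:
  fixes X :: "'a::banach \<Rightarrow>\<^sub>L 'a"
  assumes X: "norm X < 1"
  obtains N where "is_inverse (one_op + X) N" "norm N \<le> 1 / (1 - norm X)"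
proof -
  define p where "p n = (((o\<^sub>L) (- X)) ^^ n) one_op" for n
  have p0: "p 0 = one_op" and pS: "p (Suc n) = - X o\<^sub>L p n" for n by (simp_all add: p_def)
  \<comment> \<open>The powers satisfy both recursions; multiplying the series by \<open>- X\<close>
    from the left and from the right gives the two halves of the inverse.\<close>
  have pS': "p (Suc n) = p n o\<^sub>L - X" for n
  proof (induction n)
    case (Suc n)
    have "p (Suc (Suc n)) = - X o\<^sub>L (p n o\<^sub>L - X)" by (subst pS, subst Suc) simp
    also have "\<dots> = p (Suc n) o\<^sub>L - X" by (simp add: pS blinfun_eqI)
    finally show ?case .
  qed (simp add: pS p0 blinfun_eqI)
  have norm: "norm (p n) \<le> norm X ^ n" for n
  proof (induction n)
    case (Suc n)
    have "norm (p (Suc n)) \<le> norm X * norm (p n)"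
      unfolding pS by (rule order.trans[OF norm_blinfun_compose]) simp
    then show ?case using Suc by (simp add: order.trans[OF _ mult_left_mono])
  qed (simp add: p0 norm_blinfun_id_le)
  have geo: "summable (\<lambda>n. norm X ^ n)" using X by simp
  have sum: "summable p" by (rule summable_comparison_test'[OF geo]) (rule norm)
  define N where "N = suminf p"
  have shift: "(\<Sum>n. p (Suc n)) = N - one_op"
    unfolding N_def by (subst suminf_split_head[OF sum]) (simp add: p0)
  have "(- X) o\<^sub>L N = (\<Sum>n. p (Suc n))"
    unfolding N_def pS
    by (rule bounded_linear.suminf[OF bounded_bilinear.bounded_linear_right[OF bounded_bilinear_blinfun_compose] sum])
  then have e1: "- X o\<^sub>L N = N - one_op" using shift by simp
  have 1: "(one_op + X) o\<^sub>L N = one_op"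
  proof (rule blinfun_eqI)
    fix x
    have "- X (N x) = N x - x"
      using arg_cong[OF e1, of "\<lambda>T. blinfun_apply T x"] by (simp add: blinfun.diff_left blinfun.minus_left)
    then have "X (N x) = x - N x" by (metis minus_diff_eq minus_minus)
    then show "((one_op + X) o\<^sub>L N) x = one_op x"
      by (simp add: blinfun.add_left)
  qed
  have "N o\<^sub>L - X = (\<Sum>n. p (Suc n))"
    unfolding N_def pS'
    by (rule bounded_linear.suminf[OF bounded_bilinear.bounded_linear_left[OF bounded_bilinear_blinfun_compose] sum])
  then have e: "N o\<^sub>L - X = N - one_op" using shift by simp
  have 2: "N o\<^sub>L (one_op + X) = one_op"
  proof (rule blinfun_eqI)
    fix x
    have "N (- X x) = N x - x"
      using arg_cong[OF e, of "\<lambda>T. blinfun_apply T x"] by (simp add: blinfun.diff_left blinfun.minus_left)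
    then have "N (X x) = x - N x" by (simp add: blinfun.minus_right) (metis minus_diff_eq minus_minus)
    then show "(N o\<^sub>L (one_op + X)) x = one_op x"
      by (simp add: blinfun.add_left blinfun.add_right)
  qed
  have "norm N \<le> (\<Sum>n. norm X ^ n)"
    unfolding N_def by (rule norm_suminf_le[OF norm geo])
  also have "\<dots> = 1 / (1 - norm X)" using X by (simp add: suminf_geometric)
  finally show ?thesis using that 1 2 unfolding is_inverse_def by blast
qed

text \<open>Factor M + E as (1 + E N) M and invert the first factor by the Neumann series. The bound
  on the new inverse makes later estimates uniform on circles.\<close>

lemma is_inverse_perturb:
  fixes M :: "'a::banach \<Rightarrow>\<^sub>L 'a"
  assumes MN: "is_inverse M N" and small: "norm E * norm N < 1"
  obtains N' where "is_inverse (M + E) N'" "norm N' \<le> norm N / (1 - norm E * norm N)"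
proof -
  have le: "norm (E o\<^sub>L N) \<le> norm E * norm N" by (rule norm_blinfun_compose)
  then obtain G where G: "is_inverse (one_op + (E o\<^sub>L N)) G" "norm G \<le> 1 / (1 - norm (E o\<^sub>L N))"
    using neumann_series[of "E o\<^sub>L N"] small by auto
  have fact: "(M + E) x = (one_op + (E o\<^sub>L N)) (M x)" for x
    using is_inverse_apply[OF MN] by (simp add: blinfun.add_left)
  have "is_inverse (M + E) (N o\<^sub>L G)"
    unfolding is_inverse_def
  proof (intro conjI blinfun_eqI)
    fix x
    show "((M + E) o\<^sub>L (N o\<^sub>L G)) x = one_op x"
      using is_inverse_apply[OF MN] is_inverse_apply[OF G(1)] fact[of "N (G x)"] by simp
    show "((N o\<^sub>L G) o\<^sub>L (M + E)) x = one_op x"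
      using is_inverse_apply[OF MN] is_inverse_apply[OF G(1)] fact[of x] by simp
  qed
  moreover have "norm (N o\<^sub>L G) \<le> norm N / (1 - norm E * norm N)"
  proof -
    have "norm (N o\<^sub>L G) \<le> norm N * norm G" by (rule norm_blinfun_compose)
    also have "\<dots> \<le> norm N * (1 / (1 - norm (E o\<^sub>L N)))" by (intro mult_left_mono G(2)) simp
    also have "\<dots> \<le> norm N * (1 / (1 - norm E * norm N))"
      using le small by (intro mult_left_mono divide_left_mono) auto
    finally show ?thesis by simp
  qed
  ultimately show ?thesis using that by blast
qed

section \<open>Holomorphic operator-valued functions\<close>

text \<open>Test functionals: holomorphy, contour integrals and residues of operator-valued
  functions are studied after applying them, and the resulting equalities are lifted back by varying
  the vectors in the inner product.\<close>

definition cfunctional :: "('a::complex_normed_vector \<Rightarrow> complex) \<Rightarrow> bool" where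
  "cfunctional \<phi> \<longleftrightarrow> bounded_linear \<phi> \<and> (\<forall>c x. \<phi> (c *\<^sub>C x) = c * \<phi> x)"

lemma cfunctional_cinner:
  assumes "clinear_blinfun L"
  shows "cfunctional (\<lambda>T :: 'a::complex_normed_vector \<Rightarrow>\<^sub>L 'b::complex_inner. cinner u (L (T x)))"
  unfolding cfunctional_def
proof (intro conjI allI)
  have "bounded_linear (\<lambda>T :: 'a \<Rightarrow>\<^sub>L 'b. L (T x))"
    by (intro bounded_linear_compose[OF blinfun.bounded_linear_right] blinfun.bounded_linear_left)
  then show "bounded_linear (\<lambda>T :: 'a \<Rightarrow>\<^sub>L 'b. cinner u (L (T x)))"
    by (rule bounded_linear_compose[OF bounded_linear_cinner_right])
  show "cinner u (L ((c *\<^sub>C T) x)) = c * cinner u (L (T x))" for c and T :: "'a \<Rightarrow>\<^sub>L 'b"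
    by (simp add: clinear_blinfunD[OF assms] cinner_scaleC_right)
qed

lemma cfunctional_cinner':
  "cfunctional (\<lambda>T :: 'a::complex_normed_vector \<Rightarrow>\<^sub>L 'b::complex_inner. cinner u (T x))"
  using cfunctional_cinner[of "one_op" u x] by simp

lemma vholomorphic_functional:
  assumes f: "vholomorphic_on f S" and \<phi>: "cfunctional \<phi>"
  shows "(\<lambda>s. \<phi> (f s)) holomorphic_on S"
  unfolding holomorphic_on_def field_differentiable_def
proof
  fix s assume "s \<in> S"
  then obtain D where "(f has_derivative (\<lambda>h. h *\<^sub>C D)) (at s within S)"
    using f unfolding vholomorphic_on_def by blast
  then have "((\<lambda>s. \<phi> (f s)) has_derivative (\<lambda>h. \<phi> (h *\<^sub>C D))) (at s within S)"
    using \<phi> unfolding cfunctional_def by (metis bounded_linear.has_derivative)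
  moreover have "(\<lambda>h. \<phi> (h *\<^sub>C D)) = (*) (\<phi> D)"
    using \<phi> unfolding cfunctional_def by (simp add: fun_eq_iff mult.commute)
  ultimately show "\<exists>D. ((\<lambda>s. \<phi> (f s)) has_field_derivative D) (at s within S)"
    unfolding has_field_derivative_def by (intro exI[of _ "\<phi> D"]) simp
qed

lemma vholomorphic_continuous:
  assumes "vholomorphic_on f S" shows "continuous_on S f"
  unfolding continuous_on_eq_continuous_within
proof
  fix s assume "s \<in> S"
  then obtain D where "(f has_derivative (\<lambda>h. h *\<^sub>C D)) (at s within S)"
    using assms unfolding vholomorphic_on_def by blast
  then show "continuous (at s within S) f" by (rule has_derivative_continuous)
qed

lemma vholomorphic_subset: "vholomorphic_on f S \<Longrightarrow> T \<subseteq> S \<Longrightarrow> vholomorphic_on f T"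
  unfolding vholomorphic_on_def using has_derivative_subset by blast

lemma vholomorphic_const: "vholomorphic_on (\<lambda>s. c) S"
  unfolding vholomorphic_on_def by (intro ballI exI[of _ 0]) simp

lemma vholomorphic_diff:
  assumes "vholomorphic_on f S" "vholomorphic_on g S"
  shows "vholomorphic_on (\<lambda>s. f s - g s) S"
  unfolding vholomorphic_on_def
proof
  fix s assume "s \<in> S"
  then obtain D where D: "(f has_derivative (\<lambda>h. h *\<^sub>C D)) (at s within S)"
    using assms(1) unfolding vholomorphic_on_def by blast
  obtain D' where D': "(g has_derivative (\<lambda>h. h *\<^sub>C D')) (at s within S)"
    using assms(2) \<open>s \<in> S\<close> unfolding vholomorphic_on_def by blast
  from has_derivative_diff[OF D D']
  show "\<exists>D. ((\<lambda>s. f s - g s) has_derivative (\<lambda>h. h *\<^sub>C D)) (at s within S)"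
    by (intro exI[of _ "D - D'"]) (simp add: scaleC_diff_right)
qed

lemma vholomorphic_scaleC:
  assumes "c holomorphic_on S" "vholomorphic_on f S"
  shows "vholomorphic_on (\<lambda>s. c s *\<^sub>C f s) S"
  unfolding vholomorphic_on_def
proof
  fix s assume "s \<in> S"
  then obtain D where D: "(f has_derivative (\<lambda>h. h *\<^sub>C D)) (at s within S)"
    using assms(2) unfolding vholomorphic_on_def by blast
  obtain D' where D': "(c has_derivative (\<lambda>h. D' * h)) (at s within S)"
    using assms(1) \<open>s \<in> S\<close> unfolding holomorphic_on_def field_differentiable_def
      has_field_derivative_def by blast
  from bounded_bilinear.FDERIV[OF bounded_bilinear_scaleC D' D]
  show "\<exists>D. ((\<lambda>s. c s *\<^sub>C f s) has_derivative (\<lambda>h. h *\<^sub>C D)) (at s within S)"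
    by (intro exI[of _ "c s *\<^sub>C D + D' *\<^sub>C f s"])
       (simp add: scaleC_right_distrib scaleC_scaleC mult.commute)
qed

lemma vholomorphic_compose:
  fixes f g :: "complex \<Rightarrow> 'a::complex_normed_vector \<Rightarrow>\<^sub>L 'a"
  assumes "vholomorphic_on f S" "vholomorphic_on g S" "\<And>s. s \<in> S \<Longrightarrow> clinear_blinfun (f s)"
  shows "vholomorphic_on (\<lambda>s. f s o\<^sub>L g s) S"
  unfolding vholomorphic_on_def
proof
  fix s assume s: "s \<in> S"
  then obtain D where D: "(f has_derivative (\<lambda>h. h *\<^sub>C D)) (at s within S)"
    using assms(1) unfolding vholomorphic_on_def by blast
  obtain D' where D': "(g has_derivative (\<lambda>h. h *\<^sub>C D')) (at s within S)"
    using assms(2) \<open>s \<in> S\<close> unfolding vholomorphic_on_def by blast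
  from bounded_bilinear.FDERIV[OF bounded_bilinear_blinfun_compose D D']
  show "\<exists>D. ((\<lambda>s. f s o\<^sub>L g s) has_derivative (\<lambda>h. h *\<^sub>C D)) (at s within S)"
    by (intro exI[of _ "(f s o\<^sub>L D') + (D o\<^sub>L g s)"])
       (simp add: scaleC_right_distrib compose_simps assms(3)[OF s])
qed

section \<open>The analytic Fredholm alternative\<close>

definition pencil :: "('a::complex_normed_vector \<Rightarrow>\<^sub>L 'a) \<Rightarrow> complex \<Rightarrow> complex \<Rightarrow> 'a \<Rightarrow>\<^sub>L 'a" where
  "pencil K r s = one_op + (s - r) *\<^sub>C K"

lemma pencil_apply: "pencil K r s x = x + (s - r) *\<^sub>C K x"
  by (simp add: pencil_def blinfun.add_left)

lemma clinear_pencil [simp, intro]: "clinear_blinfun K \<Longrightarrow> clinear_blinfun (pencil K r s)"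
  unfolding pencil_def by auto

lemma pencil_shift: "pencil K r s' = pencil K r s + (s' - s) *\<^sub>C K"
  unfolding pencil_def by (simp add: add.assoc flip: scaleC_left_distrib)

text \<open>The resolvent identity \<open>diff\<close> is used twice: first for continuity, then,
  divided by \<open>s' - s\<close>, for the derivative
  \<open>- (N s o\<^sub>L (K o\<^sub>L N s))\<close>.\<close>

lemma inverse_pencil_holomorphic:
  fixes K :: "'a::complex_hilbert \<Rightarrow>\<^sub>L 'a"
  assumes K: "clinear_blinfun K" and N: "\<And>s. s \<in> S \<Longrightarrow> is_inverse (pencil K r s) (N s)"
    and S: "open S"
  shows "vholomorphic_on N S"
proof -
  have lin: "clinear_blinfun (N s)" if "s \<in> S" for s
    using clinear_inverse[OF N[OF that]] K by auto
  have diff: "N s' - N s = (s - s') *\<^sub>C (N s o\<^sub>L (K o\<^sub>L N s'))" if s: "s \<in> S" "s' \<in> S" for s s'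
  proof (rule blinfun_eqI)
    fix x
    note i = is_inverse_apply[OF N[OF s(1)]] is_inverse_apply[OF N[OF s(2)]]
    have "N s (pencil K r s (N s' x)) = N s (pencil K r s' (N s' x) + (s - s') *\<^sub>C K (N s' x))"
      by (subst pencil_shift[of K r s s']) (simp add: blinfun.add_left)
    then show "(N s' - N s) x = ((s - s') *\<^sub>C (N s o\<^sub>L (K o\<^sub>L N s'))) x"
      by (simp add: i blinfun.add_right clinear_blinfunD[OF lin[OF s(1)]] blinfun.diff_left diff_eq_eq add.commute)
  qed
  have cont: "(N \<longlongrightarrow> N s) (at s)" if s: "s \<in> S" for s
  proof -
    obtain e where e: "e > 0" "ball s e \<subseteq> S" using S s open_contains_ball by blast
    define C where "C = norm (N s) * norm K"
    have C0: "C \<ge> 0" by (simp add: C_def)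
    \<comment> \<open>The second bound makes \<open>norm (s' - s) * C\<close> at most 1/2, so that
      the term with the unknown \<open>norm (N s')\<close> can be absorbed into the left-hand
      side.\<close>
    define \<delta> where "\<delta> = min e (1 / (2 * (C + 1)))"
    have \<delta>: "\<delta> > 0" using e C0 by (simp add: \<delta>_def)
    have bound: "norm (N s' - N s) \<le> 2 * C * norm (N s) * norm (s' - s)" if s': "s' \<in> ball s \<delta>" for s'
    proof -
      have s'S: "s' \<in> S" using s' e by (auto simp: \<delta>_def)
      have d: "norm (s' - s) * C \<le> 1/2"
      proof -
        have "norm (s' - s) \<le> 1 / (2 * (C + 1))" using s' by (auto simp: \<delta>_def dist_norm norm_minus_commute)
        then have "norm (s' - s) * C \<le> 1 / (2 * (C + 1)) * C" using C0 by (rule mult_right_mono)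
        also have "\<dots> \<le> 1/2" using C0 by (simp add: field_simps)
        finally show ?thesis .
      qed
      have "norm (N s' - N s) = norm (s' - s) * norm (N s o\<^sub>L (K o\<^sub>L N s'))"
        by (simp add: diff[OF s s'S] norm_scaleC norm_minus_commute)
      also have "norm (N s o\<^sub>L (K o\<^sub>L N s')) \<le> norm (N s) * (norm K * norm (N s'))"
        by (rule order.trans[OF norm_blinfun_compose mult_left_mono[OF norm_blinfun_compose]]) simp
      finally have *: "norm (N s' - N s) \<le> norm (s' - s) * C * norm (N s')"
        by (simp add: C_def mult_left_mono mult.assoc)
      also have "\<dots> \<le> 1/2 * norm (N s')" by (intro mult_right_mono d) simp
      finally have "norm (N s') \<le> 2 * norm (N s)"
        using norm_triangle_ineq2[of "N s'" "N s"] by simp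
      then have "norm (s' - s) * C * norm (N s') \<le> norm (s' - s) * C * (2 * norm (N s))"
        using C0 by (intro mult_left_mono) auto
      with * show ?thesis by (simp add: mult_ac)
    qed
    have "((\<lambda>s'. 2 * C * norm (N s) * norm (s' - s)) \<longlongrightarrow> 0) (at s)"
      by (auto intro!: tendsto_eq_intros)
    moreover have "\<forall>\<^sub>F s' in at s. norm (N s' - N s) \<le> 2 * C * norm (N s) * norm (s' - s)"
      using bound \<delta> unfolding eventually_at by (auto simp: dist_commute)
    ultimately have "((\<lambda>s'. N s' - N s) \<longlongrightarrow> 0) (at s)"
      by (rule Lim_null_comparison[rotated])
    then show ?thesis by (simp add: LIM_zero_cancel)
  qed
  show ?thesis
    unfolding vholomorphic_on_def
  proof
    fix s assume s: "s \<in> S"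
    define D where "D = - (N s o\<^sub>L (K o\<^sub>L N s))"
    have "(N has_derivative (\<lambda>h. h *\<^sub>C D)) (at s)"
      unfolding has_derivative_within
    proof
      show "bounded_linear (\<lambda>h. h *\<^sub>C D)"
        by (rule bounded_bilinear.bounded_linear_left[OF bounded_bilinear_scaleC])
      have lim0: "((\<lambda>s'. norm ((N s o\<^sub>L (K o\<^sub>L N s')) + D)) \<longlongrightarrow> 0) (at s)"
        unfolding D_def tendsto_norm_zero_iff
        by (auto intro!: tendsto_eq_intros bounded_bilinear.tendsto[OF bounded_bilinear_blinfun_compose] cont s)
      have ev: "\<forall>\<^sub>F s' in at s. norm ((N s o\<^sub>L (K o\<^sub>L N s')) + D)
          = norm ((1 / norm (s' - s)) *\<^sub>R (N s' - (N s + (s' - s) *\<^sub>C D)))"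
        using eventually_at_in_open'[OF S s] eventually_neq_at_within[of s s]
      proof eventually_elim
        case (elim s')
        have "N s' - (N s + (s' - s) *\<^sub>C D) = (s - s') *\<^sub>C (N s o\<^sub>L (K o\<^sub>L N s')) - (s' - s) *\<^sub>C D"
          using diff[OF s, of s'] elim by (simp add: algebra_simps)
        also have "\<dots> = (s - s') *\<^sub>C ((N s o\<^sub>L (K o\<^sub>L N s')) + D)"
          by (simp add: scaleC_right_distrib scaleC_diff_left)
        finally show ?case using elim by (simp add: norm_scaleC norm_minus_commute)
      qed
      have "((\<lambda>s'. norm ((1 / norm (s' - s)) *\<^sub>R (N s' - (N s + (s' - s) *\<^sub>C D)))) \<longlongrightarrow> 0) (at s)"
        by (rule Lim_transform_eventually[OF lim0 ev])
      then show "((\<lambda>s'. (1 / norm (s' - s)) *\<^sub>R (N s' - (N s + (s' - s) *\<^sub>C D))) \<longlongrightarrow> 0) (at s)"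
        by (simp only: tendsto_norm_zero_iff)
    qed
    then show "\<exists>D. (N has_derivative (\<lambda>h. h *\<^sub>C D)) (at s within S)"
      by (intro exI[of _ D]) (rule has_derivative_at_withinI)
  qed
qed

text \<open>
  \<open>d\<close> plays the role of a Fredholm determinant and \<open>N\<close> of the adjugate. A rank-one perturbation
  multiplies \<open>d\<close> by a scalar holomorphic factor which is again non-zero at the base point.
\<close>

definition fredholm_pencil :: "real \<Rightarrow> complex \<Rightarrow> ('a::complex_hilbert \<Rightarrow>\<^sub>L 'a) \<Rightarrow> bool" where
  "fredholm_pencil R r K \<longleftrightarrow> clinear_blinfun K \<and> (\<exists>d N. d holomorphic_on ball r R \<and> d r \<noteq> 0 \<and>
     vholomorphic_on N (ball r R) \<and>
     (\<forall>s\<in>ball r R. clinear_blinfun (N s) \<and> (pencil K r s o\<^sub>L N s) = d s *\<^sub>C one_op \<and>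
        (N s o\<^sub>L pencil K r s) = d s *\<^sub>C one_op))"

lemma fredholm_pencil_small:
  fixes K :: "'a::complex_hilbert \<Rightarrow>\<^sub>L 'a"
  assumes K: "clinear_blinfun K" "norm K * R < 1"
  shows "fredholm_pencil R r K"
proof -
  have inv: "is_inverse (pencil K r s) (inv_op (pencil K r s))" if "s \<in> ball r R" for s
  proof -
    have "cmod (s - r) * norm K \<le> R * norm K"
      using that by (intro mult_right_mono) (auto simp: dist_norm norm_minus_commute)
    then have "norm ((s - r) *\<^sub>C K) < 1" using K(2) by (simp add: norm_scaleC mult.commute)
    then obtain N where "is_inverse (pencil K r s) N"
      unfolding pencil_def by (rule neumann_series)
    then show ?thesis by (intro is_inverse_inv_op invertible_opI)
  qed
  have "vholomorphic_on (\<lambda>s. inv_op (pencil K r s)) (ball r R)"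
    by (rule inverse_pencil_holomorphic[OF K(1) _ open_ball]) (rule inv)
  moreover have "clinear_blinfun (inv_op (pencil K r s))" if "s \<in> ball r R" for s
    using clinear_inverse[OF inv[OF that] clinear_pencil[OF K(1)]] .
  ultimately show ?thesis unfolding fredholm_pencil_def using inv K(1)
    by (intro conjI exI[of _ "\<lambda>s. 1"] exI[of _ "\<lambda>s. inv_op (pencil K r s)"])
       (simp_all add: is_inverse_def)
qed

text \<open>The Sherman-Morrison formula with cleared denominators. The inverse of the old pencil is
  \<open>N s\<close> divided by \<open>d s\<close>; the scalar that decides invertibility of the new
  one is 1 + (s - r) <v, B N(s) u> / d(s), and \<open>m s\<close> is this scalar times
  \<open>d s\<close>. The new inverse is \<open>N' s\<close> divided by
  \<open>m s * d s\<close>.\<close>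

lemma fredholm_pencil_rank_one:
  assumes K: "fredholm_pencil R r K" and B: "clinear_blinfun B"
  shows "fredholm_pencil R r (K + (rank_one u v o\<^sub>L B))"
proof -
  obtain d N where d: "d holomorphic_on ball r R" "d r \<noteq> 0"
    and N: "vholomorphic_on N (ball r R)" "\<And>s. s \<in> ball r R \<Longrightarrow> clinear_blinfun (N s)"
      "\<And>s. s \<in> ball r R \<Longrightarrow> (pencil K r s o\<^sub>L N s) = d s *\<^sub>C one_op"
      "\<And>s. s \<in> ball r R \<Longrightarrow> (N s o\<^sub>L pencil K r s) = d s *\<^sub>C one_op"
    using K unfolding fredholm_pencil_def by blast
  have linK: "clinear_blinfun K" using K unfolding fredholm_pencil_def by blast
  define m where "m s = d s + (s - r) * cinner v (B (N s u))" for s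
  define K' where "K' = K + (rank_one u v o\<^sub>L B)"
  define N' where "N' s = m s *\<^sub>C N s - (s - r) *\<^sub>C (N s o\<^sub>L (rank_one u v o\<^sub>L (B o\<^sub>L N s)))" for s
  have hm: "m holomorphic_on ball r R"
    unfolding m_def
    by (intro holomorphic_intros d vholomorphic_functional[OF N(1) cfunctional_cinner[OF B]])
  have hN': "vholomorphic_on N' (ball r R)"
    unfolding N'_def
    by (intro vholomorphic_diff vholomorphic_scaleC vholomorphic_compose vholomorphic_const
        holomorphic_intros hm N(1)) (auto intro: N(2) B)
  have lin: "clinear_blinfun (N' s)" if "s \<in> ball r R" for s
    unfolding N'_def using N(2)[OF that] B by auto
  have "(pencil K' r s o\<^sub>L N' s) = (m s * d s) *\<^sub>C one_op \<and> (N' s o\<^sub>L pencil K' r s) = (m s * d s) *\<^sub>C one_op"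
    if s: "s \<in> ball r R" for s
  proof -
    have 1: "pencil K r s (N s x) = d s *\<^sub>C x" "N s (pencil K r s x) = d s *\<^sub>C x" for x
      using N(3,4)[OF s, THEN arg_cong[of _ _ "\<lambda>T. blinfun_apply T x"]] by simp_all
    have p': "pencil K' r s x = pencil K r s x + ((s - r) * cinner v (B x)) *\<^sub>C u" for x
      by (simp add: pencil_apply K'_def blinfun.add_left scaleC_right_distrib scaleC_scaleC)
    have n': "N' s x = m s *\<^sub>C N s x - ((s - r) * cinner v (B (N s x))) *\<^sub>C N s u" for x
      by (simp add: N'_def blinfun.diff_left scaleC_scaleC clinear_blinfunD[OF N(2)[OF s]])
    note l = clinear_blinfunD[OF N(2)[OF s]] clinear_blinfunD[OF B] clinear_blinfunD[OF clinear_pencil[OF linK]]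
    have "pencil K' r s (N' s x) = (m s * d s) *\<^sub>C x" for x
    proof -
      have "pencil K' r s (N' s x) = m s *\<^sub>C d s *\<^sub>C x
          - ((s - r) * cinner v (B (N s x))) *\<^sub>C d s *\<^sub>C u
          + ((s - r) * cinner v (B (N' s x))) *\<^sub>C u"
        unfolding p' by (subst n') (simp add: blinfun.diff_right l 1)
      also have "cinner v (B (N' s x))
          = m s * cinner v (B (N s x)) - (s - r) * cinner v (B (N s x)) * cinner v (B (N s u))"
        by (simp add: n' blinfun.diff_right l cinner_diff_right cinner_scaleC_right)
      also have "(s - r) * (m s * cinner v (B (N s x)) - (s - r) * cinner v (B (N s x)) * cinner v (B (N s u)))
          = (s - r) * cinner v (B (N s x)) * d s"
        by (simp add: m_def algebra_simps)
      finally show ?thesis by (simp add: scaleC_scaleC)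
    qed
    moreover have "N' s (pencil K' r s x) = (m s * d s) *\<^sub>C x" for x
    proof -
      have "N s (pencil K' r s x) = d s *\<^sub>C x + ((s - r) * cinner v (B x)) *\<^sub>C N s u"
        by (simp add: p' blinfun.add_right 1 l)
      then have "N' s (pencil K' r s x) = m s *\<^sub>C d s *\<^sub>C x + (m s * ((s - r) * cinner v (B x))) *\<^sub>C N s u
          - ((s - r) * (d s * cinner v (B x) + (s - r) * cinner v (B x) * cinner v (B (N s u)))) *\<^sub>C N s u"
        by (simp add: n' blinfun.add_right l cinner_add_right cinner_scaleC_right scaleC_right_distrib scaleC_scaleC)
      also have "(s - r) * (d s * cinner v (B x) + (s - r) * cinner v (B x) * cinner v (B (N s u)))
          = m s * ((s - r) * cinner v (B x))"
        by (simp add: m_def algebra_simps)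
      finally show ?thesis by (simp add: scaleC_scaleC)
    qed
    ultimately show ?thesis by (auto intro!: blinfun_eqI)
  qed
  \<comment> \<open>The perturbing term carries the factor \<open>s - r\<close>, so \<open>m\<close>
    and \<open>d\<close> agree at the base point.\<close>
  moreover have "m r * d r \<noteq> 0" using d(2) by (simp add: m_def)
  moreover have "(\<lambda>s. m s * d s) holomorphic_on ball r R" by (intro holomorphic_intros hm d)
  moreover have "clinear_blinfun K'" unfolding K'_def using linK B by auto
  ultimately have "fredholm_pencil R r K'"
    unfolding fredholm_pencil_def using hN' lin
    by (intro conjI exI[of _ "\<lambda>s. m s * d s"] exI[of _ N']) auto
  then show ?thesis unfolding K'_def .
qed

lemma fredholm_pencil_finite_rank:
  "finite_rank D \<Longrightarrow> fredholm_pencil R r K \<Longrightarrow> fredholm_pencil R r (K + D)"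
proof (induction rule: finite_rank.induct)
  case (add D B u v)
  then show ?case
    using fredholm_pencil_rank_one[of R r "K + D" B u v] by (simp only: add.assoc simp_thms)
qed simp

text \<open>Choose a finite-rank \<open>D\<close> so close to \<open>K\<close> that the pencil of
  the difference is invertible on the whole disc by the Neumann series, then add \<open>D\<close>
  back one rank at a time.\<close>

lemma approximable_fredholm:
  fixes K :: "'a::complex_hilbert \<Rightarrow>\<^sub>L 'a"
  assumes K: "approximable K" "clinear_blinfun K" and R: "R > 0"
  shows "fredholm_pencil R r K"
proof -
  obtain D where D: "finite_rank D" "norm (K - D) < 1 / R"
    using K(1) R unfolding approximable_def by (metis divide_pos_pos zero_less_one)
  have "norm (K - D) * R < 1" using D(2) R by (simp add: pos_less_divide_eq)
  then have "fredholm_pencil R r (K - D)"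
    using K(2) finite_rank_clinear[OF D(1)] by (intro fredholm_pencil_small) auto
  then show ?thesis using fredholm_pencil_finite_rank[OF D(1), of R r "K - D"] by simp
qed

section \<open>Meromorphy of the resolvent family and uniqueness of meromorphic extensions\<close>

section \<open>The resolvent family\<close>

text \<open>
  For \<open>K = T\<^sub>z(H\<^sub>r) J\<close> the second resolvent identity says that \<open>pres K r s = T\<^sub>z(H\<^sub>s) J\<close> for real \<open>s\<close>, so
  that \<open>pres K r\<close> is the meromorphic continuation of \<open>A\<^sub>z\<close>.
\<close>

definition pres :: "('a::complex_normed_vector \<Rightarrow>\<^sub>L 'a) \<Rightarrow> complex \<Rightarrow> complex \<Rightarrow> 'a \<Rightarrow>\<^sub>L 'a" where
  "pres K r s = (if invertible_op (pencil K r s) then inv_op (pencil K r s) o\<^sub>L K else 0)"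

lemma pres_eqI:
  assumes "is_inverse (pencil K r s) N" shows "pres K r s = N o\<^sub>L K"
  using assms by (simp add: pres_def invertible_opI inv_op_eqI)

text \<open>The inverse of the pencil is \<open>N\<close> over \<open>d\<close>; dividing out the
  zero of \<open>d\<close> at \<open>w\<close> leaves at most a pole of order \<open>n\<close> there
  and no other singularity nearby.\<close>

lemma pres_local:
  fixes K :: "'a::complex_hilbert \<Rightarrow>\<^sub>L 'a"
  assumes K: "approximable K" "clinear_blinfun K"
  obtains n :: nat and e g where "e > 0" "vholomorphic_on g (ball w e)"
    "\<And>s. s \<in> ball w e - {w} \<Longrightarrow> invertible_op (pencil K r s)"
    "\<And>s. s \<in> ball w e - {w} \<Longrightarrow> (s - w) ^ n *\<^sub>C pres K r s = g s"
proof -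
  \<comment> \<open>The disc has to contain \<open>w\<close> and the base point, where
    \<open>d\<close> does not vanish; hence a zero of \<open>d\<close> at \<open>w\<close> has
    finite order.\<close>
  define R where "R = cmod (w - r) + 1"
  have w: "w \<in> ball r R" and r: "r \<in> ball r R"
    by (auto simp: R_def dist_norm norm_minus_commute add_nonneg_pos)
  have "fredholm_pencil R r K" by (rule approximable_fredholm[OF K]) (simp add: R_def add_nonneg_pos)
  then obtain d N where d: "d holomorphic_on ball r R" "d r \<noteq> 0"
    and N: "vholomorphic_on N (ball r R)" "\<And>s. s \<in> ball r R \<Longrightarrow> clinear_blinfun (N s)"
      "\<And>s. s \<in> ball r R \<Longrightarrow> (pencil K r s o\<^sub>L N s) = d s *\<^sub>C one_op"
      "\<And>s. s \<in> ball r R \<Longrightarrow> (N s o\<^sub>L pencil K r s) = d s *\<^sub>C one_op"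
    unfolding fredholm_pencil_def by blast
  have "\<exists>n e h. e > 0 \<and> ball w e \<subseteq> ball r R \<and> h holomorphic_on ball w e \<and>
      (\<forall>s\<in>ball w e. d s = (s - w) ^ n * h s \<and> h s \<noteq> 0)"
  proof (cases "d w = 0")
    case True
    have "\<not> d constant_on ball r R"
      using True d(2) w r unfolding constant_on_def by metis
    from holomorphic_factor_zero_nonconstant[OF d(1) open_ball connected_ball w True this]
    obtain h e n where "0 < (n::nat)" "0 < e" "ball w e \<subseteq> ball r R" "h holomorphic_on ball w e"
      "\<And>s. s \<in> ball w e \<Longrightarrow> d s = (s - w) ^ n * h s" "\<And>s. s \<in> ball w e \<Longrightarrow> h s \<noteq> 0"
      by metis
    then show ?thesis by blast
  next
    case False
    have "continuous (at w) d"
      using holomorphic_on_imp_continuous_on[OF d(1)] w by (simp add: continuous_on_eq_continuous_at)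
    then have "\<forall>\<^sub>F s in nhds w. d s \<noteq> 0"
      using False tendsto_imp_eventually_ne[of d "d w" "nhds w" 0]
      by (simp add: isCont_def tendsto_at_iff_tendsto_nhds)
    moreover have "\<forall>\<^sub>F s in nhds w. s \<in> ball r R" using w by (intro eventually_nhds_in_open) auto
    ultimately have "\<forall>\<^sub>F s in nhds w. d s \<noteq> 0 \<and> s \<in> ball r R" by (rule eventually_conj)
    then obtain e where "e > 0" "\<forall>s. dist s w < e \<longrightarrow> d s \<noteq> 0 \<and> s \<in> ball r R"
      unfolding eventually_nhds_metric by blast
    then have "e > 0" "ball w e \<subseteq> ball r R" "\<forall>s\<in>ball w e. d s \<noteq> 0"
      by (auto simp: dist_commute)
    then show ?thesis using d(1)
      by (intro exI[of _ 0] exI[of _ e] exI[of _ d]) (auto intro: holomorphic_on_subset)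
  qed
  then obtain n e h where e: "e > 0" "ball w e \<subseteq> ball r R" and h: "h holomorphic_on ball w e"
    "\<And>s. s \<in> ball w e \<Longrightarrow> d s = (s - w) ^ n * h s" "\<And>s. s \<in> ball w e \<Longrightarrow> h s \<noteq> 0"
    by blast
  define g where "g s = (1 / h s) *\<^sub>C (N s o\<^sub>L K)" for s
  have g: "vholomorphic_on g (ball w e)"
    unfolding g_def
    by (intro vholomorphic_scaleC vholomorphic_compose vholomorphic_const holomorphic_intros h
        vholomorphic_subset[OF N(1) e(2)]) (use e(2) N(2) h(3) in auto)
  have inv: "is_inverse (pencil K r s) ((1 / d s) *\<^sub>C N s)" if s: "s \<in> ball w e - {w}" for s
  proof -
    have "d s \<noteq> 0" "s \<in> ball r R" using s h e by auto
    then show ?thesis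
      using N(3,4)[of s] K(2) unfolding is_inverse_def by (simp add: compose_simps scaleC_scaleC clinear_pencil)
  qed
  have "(s - w) ^ n *\<^sub>C pres K r s = g s" if s: "s \<in> ball w e - {w}" for s
    using s h(2)[of s] h(3)[of s] by (simp add: pres_eqI[OF inv[OF s]] g_def scaleC_scaleC compose_simps)
  then show ?thesis using that e(1) g invertible_opI[OF inv] by blast
qed

section \<open>Uniqueness of meromorphic extensions\<close>

definition normalized :: "(complex \<Rightarrow> 'a::complex_normed_vector) \<Rightarrow> bool" where
  "normalized g \<longleftrightarrow> (\<forall>w. is_pole g w \<and> g w = 0 \<or> g \<midarrow>w\<rightarrow> g w)"

lemma vholomorphic_identity:
  fixes k :: "complex \<Rightarrow> 'a::complex_normed_vector \<Rightarrow>\<^sub>L 'b::complex_inner"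
  assumes k: "vholomorphic_on k (ball w e)" and lim: "\<xi> islimpt {s \<in> ball w e. k s = 0}"
    "\<xi> \<in> ball w e" and s: "s \<in> ball w e"
  shows "k s = 0"
proof (intro blinfun_eqI cinner_eqI)
  fix x u
  have "cinner u (k s x) = 0"
    by (rule analytic_continuation[OF vholomorphic_functional[OF k cfunctional_cinner'] open_ball
          connected_ball _ lim(2,1) _ s]) auto
  then show "cinner u (k s x) = cinner u ((0::'a \<Rightarrow>\<^sub>L 'b) x)" by simp
qed

text \<open>Clearing both possible poles at \<open>w\<close> gives a holomorphic \<open>k\<close>,
  equal to \<open>(s - w) ^ (n + m) *\<^sub>C (f s - g s)\<close> off \<open>w\<close>, whose zeros
  accumulate at \<open>w\<close>.\<close>

lemma vmeromorphic_agree_near_limit_point: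
  fixes f g :: "complex \<Rightarrow> 'a::complex_normed_vector \<Rightarrow>\<^sub>L 'b::complex_inner"
  assumes f: "vmeromorphic f" and g: "vmeromorphic g" and lim: "w islimpt {s. f s = g s}"
  shows "\<exists>e>0. \<forall>s\<in>ball w e - {w}. f s = g s"
proof -
  obtain n e1 f' where e1: "e1 > 0" "vholomorphic_on f' (ball w e1)"
    "\<And>s. s \<in> ball w e1 - {w} \<Longrightarrow> (s - w) ^ n *\<^sub>C f s = f' s"
    using f unfolding vmeromorphic_def by metis
  obtain m e2 g' where e2: "e2 > 0" "vholomorphic_on g' (ball w e2)"
    "\<And>s. s \<in> ball w e2 - {w} \<Longrightarrow> (s - w) ^ m *\<^sub>C g s = g' s"
    using g unfolding vmeromorphic_def by metis
  define e where "e = min e1 e2"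
  have e: "e > 0" "ball w e \<subseteq> ball w e1" "ball w e \<subseteq> ball w e2" using e1 e2 by (auto simp: e_def)
  define k where "k s = (s - w) ^ m *\<^sub>C f' s - (s - w) ^ n *\<^sub>C g' s" for s
  have hk: "vholomorphic_on k (ball w e)"
    unfolding k_def
    by (intro vholomorphic_diff vholomorphic_scaleC holomorphic_intros
        vholomorphic_subset[OF e1(2) e(2)] vholomorphic_subset[OF e2(2) e(3)])
  have k: "k s = (s - w) ^ (n + m) *\<^sub>C (f s - g s)" if "s \<in> ball w e - {w}" for s
    using e1(3)[of s, symmetric] e2(3)[of s, symmetric] that e
    by (auto simp: k_def e_def scaleC_scaleC scaleC_diff_right power_add mult.commute)
  have "w islimpt {s \<in> ball w e. k s = 0}"
    unfolding islimpt_approachable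
  proof (intro allI impI)
    fix d :: real assume "0 < d"
    then have "0 < min d e" using e by simp
    then obtain s where "s \<in> {s. f s = g s}" "s \<noteq> w" "dist s w < min d e"
      using lim unfolding islimpt_approachable by meson
    then show "\<exists>s\<in>{s \<in> ball w e. k s = 0}. s \<noteq> w \<and> dist s w < d"
      using k[of s] by (intro bexI[of _ s]) (auto simp: dist_commute)
  qed
  then have k0: "k s = 0" if "s \<in> ball w e" for s
    using vholomorphic_identity[OF hk _ _ that] e by simp
  have "f s = g s" if "s \<in> ball w e - {w}" for s
    using k[OF that] k0[of s] that by auto
  then show ?thesis using e(1) by blast
qed

text \<open>Connectedness: the set \<open>Z\<close> of points with agreement on a punctured
  neighbourhood is open, and closed because it consists of the limit points of the agreement set.
  Normalization then fixes the value at each point, either as a limit or as 0 at a pole.\<close>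

lemma vmeromorphic_unique:
  fixes f g :: "complex \<Rightarrow> 'a::complex_normed_vector \<Rightarrow>\<^sub>L 'b::complex_inner"
  assumes f: "vmeromorphic f" "normalized f" and g: "vmeromorphic g" "normalized g"
    and lim: "w0 islimpt {s. f s = g s}"
  shows "f = g"
proof -
  define Z where "Z = {w. \<exists>e>0. \<forall>s\<in>ball w e - {w}. f s = g s}"
  have limZ: "w \<in> Z" if "w islimpt {s. f s = g s}" for w
    using vmeromorphic_agree_near_limit_point[OF f(1) g(1) that] by (simp add: Z_def)
  have Zlim: "w islimpt {s. f s = g s}" if w: "w \<in> Z" for w
    unfolding islimpt_approachable
  proof (intro allI impI)
    fix d :: real assume d: "0 < d"
    obtain e where e: "e > 0" "\<forall>s\<in>ball w e - {w}. f s = g s" using w by (auto simp: Z_def)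
    define s where "s = w + of_real (min d e / 2)"
    have "dist s w = min d e / 2" using d e by (simp add: s_def dist_norm)
    then show "\<exists>s\<in>{s. f s = g s}. s \<noteq> w \<and> dist s w < d"
      using d e by (intro bexI[of _ s]) (auto simp: dist_commute)
  qed
  have "Z = {w. w islimpt {s. f s = g s}}" using limZ Zlim by blast
  then have "closed Z" by (simp add: closed_limpts)
  moreover have "open Z"
    unfolding open_contains_ball
  proof
    fix w assume "w \<in> Z"
    then obtain e where e: "e > 0" "\<forall>s\<in>ball w e - {w}. f s = g s" by (auto simp: Z_def)
    have "w' \<in> Z" if w': "w' \<in> ball w e" for w'
    proof (cases "w' = w")
      case False
      then have "w' \<in> ball w e - {w}" using w' by simp
      moreover have "open (ball w e - {w})" by (simp add: open_delete)
      ultimately obtain d where "d > 0" "ball w' d \<subseteq> ball w e - {w}"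
        using open_contains_ball by blast
      then show ?thesis using e unfolding Z_def by blast
    qed (use \<open>w \<in> Z\<close> in simp)
    then show "\<exists>e>0. ball w e \<subseteq> Z" using e(1) by blast
  qed
  ultimately have Z: "Z = UNIV" using clopen[of Z] limZ[OF lim] by auto
  show ?thesis
  proof
    fix w
    obtain e where e: "e > 0" "\<forall>s\<in>ball w e - {w}. f s = g s" using Z by (auto simp: Z_def)
    then have ev: "\<forall>\<^sub>F s in at w. f s = g s"
      unfolding eventually_at by (auto simp: dist_commute)
    have pole: "is_pole f w \<longleftrightarrow> is_pole g w" using ev by (rule is_pole_cong) simp
    have lim: "(f \<longlongrightarrow> l) (at w) \<longleftrightarrow> (g \<longlongrightarrow> l) (at w)" for l
      by (rule tendsto_cong[OF ev])
    have no: "\<not> (is_pole h w \<and> (h \<longlongrightarrow> l) (at w))" for h :: "complex \<Rightarrow> 'a \<Rightarrow>\<^sub>L 'b" and l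
      unfolding is_pole_def using not_tendsto_and_filterlim_at_infinity[of "at w" h l] by auto
    show "f w = g w"
    proof (cases "is_pole f w")
      case True
      then show ?thesis using f(2) g(2) pole no unfolding normalized_def by metis
    next
      case False
      then have "(f \<longlongrightarrow> f w) (at w)" "(f \<longlongrightarrow> g w) (at w)"
        using f(2) g(2) pole lim unfolding normalized_def by metis+
      then show ?thesis using tendsto_unique trivial_limit_at by blast
    qed
  qed
qed

lemma meromorphic_extension_eqI:
  fixes f :: "real \<Rightarrow> 'a::complex_normed_vector \<Rightarrow>\<^sub>L 'b::complex_inner"
  assumes g: "vmeromorphic g" "normalized g" "\<And>s. s \<in> S \<Longrightarrow> g (complex_of_real s) = f s"
    and S: "r islimpt S"
  shows "meromorphic_extension S f = g"
  unfolding meromorphic_extension_def normalized_def[symmetric]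
proof (rule the_equality)
  fix g' assume g': "vmeromorphic g' \<and> normalized g' \<and> (\<forall>s\<in>S. g' (complex_of_real s) = f s)"
  have "complex_of_real r islimpt {s. g' s = g s}"
    unfolding islimpt_approachable
  proof (intro allI impI)
    fix e :: real assume "0 < e"
    then obtain s where "s \<in> S" "s \<noteq> r" "dist s r < e" using S unfolding islimpt_approachable by blast
    then show "\<exists>s\<in>{s. g' s = g s}. s \<noteq> complex_of_real r \<and> dist s (complex_of_real r) < e"
      using g g' by (intro bexI[of _ "complex_of_real s"]) (auto simp: dist_norm simp flip: of_real_diff)
  qed
  then show "g' = g" using vmeromorphic_unique g g' by blast
qed (use g in auto)

section \<open>Poles of the resolvent family\<close>

lemma open_invertible_pencil:
  fixes K :: "'a::complex_hilbert \<Rightarrow>\<^sub>L 'a"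
  shows "open {s. invertible_op (pencil K r s)}"
  unfolding open_dist
proof (intro ballI)
  fix s assume "s \<in> {s. invertible_op (pencil K r s)}"
  then obtain N where N: "is_inverse (pencil K r s) N" by (auto simp: invertible_op_def)
  define C where "C = norm K * norm N"
  have C: "C \<ge> 0" by (simp add: C_def)
  show "\<exists>e>0. \<forall>s'. dist s' s < e \<longrightarrow> s' \<in> {s. invertible_op (pencil K r s)}"
  proof (intro exI[of _ "1 / (C + 1)"] conjI allI impI)
    show "0 < 1 / (C + 1)" using C by simp
    fix s' assume "dist s' s < 1 / (C + 1)"
    then have "cmod (s' - s) * (C + 1) < 1" using C by (simp add: dist_norm pos_less_divide_eq)
    then have "norm ((s' - s) *\<^sub>C K) * norm N < 1"
      by (simp add: norm_scaleC C_def distrib_left mult.assoc) (smt (verit) norm_ge_zero)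
    then obtain N' where "is_inverse (pencil K r s + (s' - s) *\<^sub>C K) N'"
      using is_inverse_perturb[OF N] by metis
    then show "s' \<in> {s. invertible_op (pencil K r s)}"
      unfolding pencil_shift[symmetric] by (auto intro: invertible_opI)
  qed
qed

lemma pres_holomorphic:
  fixes K :: "'a::complex_hilbert \<Rightarrow>\<^sub>L 'a"
  assumes K: "clinear_blinfun K"
  shows "vholomorphic_on (pres K r) {s. invertible_op (pencil K r s)}"
proof -
  have "vholomorphic_on (\<lambda>s. inv_op (pencil K r s)) {s. invertible_op (pencil K r s)}"
    using is_inverse_inv_op by (intro inverse_pencil_holomorphic[OF K _ open_invertible_pencil]) auto
  then have "vholomorphic_on (\<lambda>s. inv_op (pencil K r s) o\<^sub>L K) {s. invertible_op (pencil K r s)}"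
    using clinear_inverse[OF is_inverse_inv_op clinear_pencil[OF K]]
    by (intro vholomorphic_compose vholomorphic_const) auto
  then show ?thesis
    unfolding vholomorphic_on_def
  proof (intro ballI)
    fix s assume *: "\<forall>s\<in>{s. invertible_op (pencil K r s)}. \<exists>D. ((\<lambda>s. inv_op (pencil K r s) o\<^sub>L K) has_derivative
        (\<lambda>h. h *\<^sub>C D)) (at s within {s. invertible_op (pencil K r s)})"
      and s: "s \<in> {s. invertible_op (pencil K r s)}"
    then obtain D where "((\<lambda>s. inv_op (pencil K r s) o\<^sub>L K) has_derivative
        (\<lambda>h. h *\<^sub>C D)) (at s within {s. invertible_op (pencil K r s)})" by blast
    then have "(pres K r has_derivative (\<lambda>h. h *\<^sub>C D)) (at s within {s. invertible_op (pencil K r s)})"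
      by (rule has_derivative_transform[OF s, rotated]) (simp add: pres_def)
    then show "\<exists>D. (pres K r has_derivative (\<lambda>h. h *\<^sub>C D)) (at s within {s. invertible_op (pencil K r s)})"
      by blast
  qed
qed

lemma pres_vmeromorphic:
  fixes K :: "'a::complex_hilbert \<Rightarrow>\<^sub>L 'a"
  assumes K: "approximable K" "clinear_blinfun K"
  shows "vmeromorphic (pres K r)"
  unfolding vmeromorphic_def
proof
  fix w
  obtain n :: nat and e g where "e > 0" "vholomorphic_on g (ball w e)"
    "\<And>s. s \<in> ball w e - {w} \<Longrightarrow> (s - w) ^ n *\<^sub>C pres K r s = g s"
    using pres_local[OF K, of w r] by metis
  then show "\<exists>n::nat. \<exists>e>0. \<exists>g. vholomorphic_on g (ball w e) \<and>
      (\<forall>s\<in>ball w e - {w}. (s - w) ^ n *\<^sub>C pres K r s = g s)" by blast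
qed

text \<open>Otherwise the perturbation argument started at \<open>s\<close> would reach
  \<open>w\<close>. So the inverse grows at least like the reciprocal of the distance to a point of
  non-invertibility.\<close>

lemma norm_inverse_pencil_ge:
  fixes K :: "'a::complex_hilbert \<Rightarrow>\<^sub>L 'a"
  assumes "is_inverse (pencil K r s) N" "\<not> invertible_op (pencil K r w)"
  shows "1 \<le> cmod (w - s) * norm K * norm N"
proof (rule ccontr)
  assume "\<not> ?thesis"
  then have "norm ((w - s) *\<^sub>C K) * norm N < 1" by (simp add: norm_scaleC)
  from is_inverse_perturb[OF assms(1) this] show False
    using assms(2) unfolding pencil_shift[symmetric] by (metis invertible_opI)
qed

text \<open>The inverse equals \<open>one_op - (s - r) *\<^sub>C pres K r s\<close>, so a blow-up of
  the inverse is inherited by \<open>pres\<close>.\<close>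

lemma norm_inverse_pencil_le:
  fixes K :: "'a::complex_hilbert \<Rightarrow>\<^sub>L 'a"
  assumes "is_inverse (pencil K r s) N" "clinear_blinfun K"
  shows "norm N \<le> 1 + cmod (s - r) * norm (pres K r s)"
proof -
  have "N = one_op - (s - r) *\<^sub>C pres K r s"
  proof (rule blinfun_eqI)
    fix x
    have "x = N (x + (s - r) *\<^sub>C K x)" using is_inverse_apply(2)[OF assms(1), of x] by (simp add: pencil_apply)
    also have "\<dots> = N x + (s - r) *\<^sub>C N (K x)"
      using clinear_inverse[OF assms(1)] assms(2) by (simp add: blinfun.add_right clinear_blinfunD)
    finally show "N x = (one_op - (s - r) *\<^sub>C pres K r s) x"
      by (simp add: pres_eqI[OF assms(1)] blinfun.diff_left eq_diff_eq)
  qed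
  then have "norm N \<le> norm (one_op :: 'a \<Rightarrow>\<^sub>L 'a) + norm ((s - r) *\<^sub>C pres K r s)"
    using norm_triangle_ineq4 by metis
  then show ?thesis using norm_blinfun_id_le[where 'a='a] by (simp add: norm_scaleC)
qed

text \<open>Meromorphy alone would leave room for a removable singularity at \<open>w\<close>; the
  two preceding norm bounds exclude it.\<close>

lemma pres_is_pole:
  fixes K :: "'a::complex_hilbert \<Rightarrow>\<^sub>L 'a"
  assumes K: "approximable K" "clinear_blinfun K" and w: "\<not> invertible_op (pencil K r w)"
  shows "is_pole (pres K r) w"
proof -
  define C where "C = cmod (w - r) + 1"
  define k where "k = norm K + 1"
  have C: "C > 0" and k: "k > 0" by (simp_all add: C_def k_def add_nonneg_pos)
  obtain e where e: "e > 0" "\<And>s. s \<in> ball w e - {w} \<Longrightarrow> invertible_op (pencil K r s)"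
    using pres_local[OF K, of w r] by metis
  have bound: "(inverse (cmod (s - w)) * inverse k - 1) * inverse C \<le> norm (pres K r s)"
    if s: "s \<in> ball w (min e 1) - {w}" for s
  proof -
    obtain N where N: "is_inverse (pencil K r s) N" using e(2)[of s] s by (auto simp: invertible_op_def)
    have "1 \<le> cmod (s - w) * (norm K * norm N)"
      using norm_inverse_pencil_ge[OF N w] by (simp add: norm_minus_commute mult.assoc)
    also have "\<dots> \<le> cmod (s - w) * (k * norm N)"
      by (intro mult_left_mono mult_right_mono) (simp_all add: k_def)
    finally have "inverse (cmod (s - w)) * inverse k \<le> norm N"
      using s k by (simp add: field_simps)
    also have "\<dots> \<le> 1 + cmod (s - r) * norm (pres K r s)" by (rule norm_inverse_pencil_le[OF N K(2)])
    also have "cmod (s - r) \<le> C"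
    proof -
      have "cmod (s - r) \<le> cmod (s - w) + cmod (w - r)" using norm_triangle_ineq[of "s - w" "w - r"] by simp
      then show ?thesis using s by (auto simp: C_def dist_norm norm_minus_commute)
    qed
    finally show ?thesis using C by (simp add: field_simps mult_right_mono)
  qed
  have "filterlim (\<lambda>s. cmod (s - w)) (at_right 0) (at w)"
    unfolding filterlim_at
    by (auto intro!: tendsto_eq_intros simp: eventually_at_filter)
  then have "filterlim (\<lambda>s. inverse (cmod (s - w))) at_top (at w)"
    by (rule filterlim_compose[OF filterlim_inverse_at_top_right])
  then have lim: "\<forall>\<^sub>F s in at w. Z \<le> inverse (cmod (s - w))" for Z
    by (simp add: filterlim_at_top)
  have "filterlim (\<lambda>s. (inverse (cmod (s - w)) * inverse k - 1) * inverse C) at_top (at w)"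
    unfolding filterlim_at_top
  proof
    fix Z
    show "\<forall>\<^sub>F s in at w. Z \<le> (inverse (cmod (s - w)) * inverse k - 1) * inverse C"
      using lim[of "(Z * C + 1) * k"]
    proof eventually_elim
      case (elim s)
      then have "Z * C + 1 \<le> inverse (cmod (s - w)) * inverse k"
        using k by (simp add: divide_inverse[symmetric] pos_le_divide_eq)
      then show ?case using C by (simp add: divide_inverse[symmetric] pos_le_divide_eq)
    qed
  qed
  moreover have "\<forall>\<^sub>F s in at w. (inverse (cmod (s - w)) * inverse k - 1) * inverse C \<le> norm (pres K r s)"
    unfolding eventually_at using bound e(1)
    by (intro exI[of _ "min e 1"]) (auto simp: dist_commute)
  ultimately have "filterlim (\<lambda>s. norm (pres K r s)) at_top (at w)"
    by (rule filterlim_at_top_mono)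
  then show ?thesis unfolding is_pole_def by (rule filterlim_norm_at_top_imp_at_infinity)
qed

lemma pres_tendsto:
  fixes K :: "'a::complex_hilbert \<Rightarrow>\<^sub>L 'a"
  assumes K: "clinear_blinfun K" and w: "invertible_op (pencil K r w)"
  shows "(pres K r \<longlongrightarrow> pres K r w) (at w)"
  using vholomorphic_continuous[OF pres_holomorphic[OF K, of r]] w
  by (simp add: continuous_on_eq_continuous_at[OF open_invertible_pencil] isCont_def)

lemma pres_normalized:
  fixes K :: "'a::complex_hilbert \<Rightarrow>\<^sub>L 'a"
  assumes K: "approximable K" "clinear_blinfun K"
  shows "normalized (pres K r)"
  unfolding normalized_def
proof
  fix w
  show "is_pole (pres K r) w \<and> pres K r w = 0 \<or> pres K r \<midarrow>w\<rightarrow> pres K r w"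
    using pres_is_pole[OF K] pres_tendsto[OF K(2)] by (cases "invertible_op (pencil K r w)") (auto simp: pres_def)
qed

lemma pres_is_pole_iff:
  fixes K :: "'a::complex_hilbert \<Rightarrow>\<^sub>L 'a"
  assumes K: "approximable K" "clinear_blinfun K"
  shows "is_pole (pres K r) w \<longleftrightarrow> \<not> invertible_op (pencil K r w)"
  using pres_is_pole[OF K] pres_tendsto[OF K(2)]
    not_tendsto_and_filterlim_at_infinity[of "at w" "pres K r" "pres K r w"]
  unfolding is_pole_def by auto

lemma finite_poles:
  fixes K :: "'a::complex_hilbert \<Rightarrow>\<^sub>L 'a"
  assumes K: "approximable K" "clinear_blinfun K"
  shows "finite {w \<in> cball a R. \<not> invertible_op (pencil K r w)}"
proof -
  have "\<not> w islimpt {w. \<not> invertible_op (pencil K r w)}" for w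
  proof
    assume lim: "w islimpt {w. \<not> invertible_op (pencil K r w)}"
    obtain e where e: "e > 0" "\<And>s. s \<in> ball w e - {w} \<Longrightarrow> invertible_op (pencil K r s)"
      using pres_local[OF K, of w r] by metis
    from lim e(1) obtain s where "\<not> invertible_op (pencil K r s)" "s \<noteq> w" "dist s w < e"
      unfolding islimpt_approachable by blast
    then show False using e(2)[of s] by (auto simp: dist_commute)
  qed
  then have "finite (cball a R \<inter> {w. \<not> invertible_op (pencil K r w)})"
    by (intro finite_not_islimpt_in_compact) auto
  then show ?thesis by (simp add: Int_def)
qed

section \<open>Residues as projections onto root spaces\<close>

section \<open>Residues\<close>

lemma cfunctional_contour_integral:
  assumes f: "has_vcontour_integral f I (circlepath w \<epsilon>)" and \<phi>: "cfunctional \<phi>"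
  shows "((\<lambda>s. \<phi> (f s)) has_contour_integral \<phi> I) (circlepath w \<epsilon>)"
proof -
  have "bounded_linear \<phi>" "\<And>c x. \<phi> (c *\<^sub>C x) = c * \<phi> x" using \<phi> by (auto simp: cfunctional_def)
  from has_integral_linear[OF f[unfolded has_vcontour_integral_def] this(1)] this(2)
  show ?thesis unfolding has_contour_integral_def by (simp add: o_def mult.commute)
qed

lemma vcontour_integral_exists:
  fixes f :: "complex \<Rightarrow> 'a::{complex_normed_vector, banach}" and \<epsilon> :: real
  assumes f: "continuous_on (sphere w \<epsilon>) f" and \<epsilon>: "0 < \<epsilon>"
  shows "\<exists>I. has_vcontour_integral f I (circlepath w \<epsilon>)"
proof -
  have "continuous_on {0..1} (\<lambda>t. (2 * of_real pi * \<i> * of_real \<epsilon> * exp (2 * of_real pi * \<i> * of_real t)) *\<^sub>C f (circlepath w \<epsilon> t))"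
  proof (intro continuous_intros)
    have "continuous_on {0..1} (circlepath w \<epsilon>)" using path_def path_circlepath by blast
    then show "continuous_on {0..1} (\<lambda>t. f (circlepath w \<epsilon> t))"
      using \<epsilon> path_image_circlepath[of w \<epsilon>]
      by (intro continuous_on_compose2[OF f]) (auto simp: path_image_def)
  qed
  then have "(\<lambda>t. (2 * of_real pi * \<i> * of_real \<epsilon> * exp (2 * of_real pi * \<i> * of_real t)) *\<^sub>C f (circlepath w \<epsilon> t)) integrable_on {0..1}"
    by (rule integrable_continuous_real)
  then obtain I where "((\<lambda>t. (2 * of_real pi * \<i> * of_real \<epsilon> * exp (2 * of_real pi * \<i> * of_real t)) *\<^sub>C f (circlepath w \<epsilon> t)) has_integral I) {0..1}"
    by blast
  then have "has_vcontour_integral f I (circlepath w \<epsilon>)"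
    unfolding has_vcontour_integral_def
    by (rule has_integral_eq[rotated]) (simp add: vector_derivative_circlepath01)
  then show ?thesis by blast
qed

text \<open>Independence of the radius is read off after pairing with vectors, where the scalar
  residue theorem applies. It makes the description in \<open>vresidue\<close> denote one operator,
  valid for every circle inside the punctured disc.\<close>

lemma vresidue_contour_integral:
  fixes f :: "complex \<Rightarrow> 'a::complex_normed_vector \<Rightarrow>\<^sub>L 'b::complex_hilbert"
  assumes f: "vholomorphic_on f (ball w e - {w})" and \<epsilon>: "0 < \<epsilon>" "\<epsilon> < e"
  shows "has_vcontour_integral f ((2 * of_real pi * \<i>) *\<^sub>C vresidue f w) (circlepath w \<epsilon>)"
proof -
  let ?c = "2 * of_real pi * \<i>"
  have "\<exists>I. has_vcontour_integral f I (circlepath w \<epsilon>)" if "0 < \<epsilon>" "\<epsilon> < e" for \<epsilon>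
    using that by (intro vcontour_integral_exists continuous_on_subset[OF vholomorphic_continuous[OF f]]) auto
  then obtain I where I: "\<And>\<epsilon>. 0 < \<epsilon> \<Longrightarrow> \<epsilon> < e \<Longrightarrow> has_vcontour_integral f (I \<epsilon>) (circlepath w \<epsilon>)"
    by metis
  have eq: "I \<epsilon> = I (e/2)" if \<epsilon>: "0 < \<epsilon>" "\<epsilon> < e" for \<epsilon>
  proof (intro blinfun_eqI cinner_eqI)
    fix x u
    let ?\<phi> = "\<lambda>T :: 'a \<Rightarrow>\<^sub>L 'b. cinner u (T x)"
    have e: "0 < e/2" "e/2 < e" using \<epsilon> by auto
    have hol: "(\<lambda>s. ?\<phi> (f s)) holomorphic_on ball w e - {w}"
      by (rule vholomorphic_functional[OF f cfunctional_cinner'])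
    have "((\<lambda>s. ?\<phi> (f s)) has_contour_integral 2 * pi * \<i> * residue (\<lambda>s. ?\<phi> (f s)) w) (circlepath w d)"
      if "0 < d" "d < e" for d
      using that by (intro base_residue[OF open_ball _ _ hol]) auto
    from this[OF \<epsilon>] this[OF e] cfunctional_contour_integral[OF I[OF \<epsilon>] cfunctional_cinner', of u x]
      cfunctional_contour_integral[OF I[OF e] cfunctional_cinner', of u x]
    show "cinner u (I \<epsilon> x) = cinner u (I (e/2) x)"
      by (metis has_contour_integral_unique)
  qed
  define R where "R = inverse ?c *\<^sub>C I (e/2)"
  have c0: "?c \<noteq> 0" by simp
  have cR: "?c *\<^sub>C R = I (e/2)" by (simp only: R_def scaleC_scaleC right_inverse[OF c0] scaleC_simps)
  have R: "has_vcontour_integral f (?c *\<^sub>C R) (circlepath w \<epsilon>)" if "0 < \<epsilon>" "\<epsilon> < e" for \<epsilon>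
    using I[OF that] unfolding cR eq[OF that] .
  have "vresidue f w = R"
    unfolding vresidue_def
  proof (rule the_equality)
    show "\<exists>e>0. \<forall>\<epsilon>>0. \<epsilon> < e \<longrightarrow> has_vcontour_integral f (?c *\<^sub>C R) (circlepath w \<epsilon>)"
      using R \<epsilon> by (intro exI[of _ e]) auto
    fix R' assume "\<exists>e>0. \<forall>\<epsilon>>0. \<epsilon> < e \<longrightarrow> has_vcontour_integral f (?c *\<^sub>C R') (circlepath w \<epsilon>)"
    then obtain e' where e': "e' > 0" "\<And>\<epsilon>. 0 < \<epsilon> \<Longrightarrow> \<epsilon> < e' \<Longrightarrow> has_vcontour_integral f (?c *\<^sub>C R') (circlepath w \<epsilon>)"
      by blast
    define d where "d = min e e' / 2"
    have "0 < d" "d < e" "d < e'" using \<epsilon> e'(1) by (auto simp: d_def)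
    then have "?c *\<^sub>C R' = ?c *\<^sub>C R"
      using R[of d] e'(2)[of d] has_integral_unique unfolding has_vcontour_integral_def by blast
    then have "inverse ?c *\<^sub>C ?c *\<^sub>C R' = inverse ?c *\<^sub>C ?c *\<^sub>C R" by simp
    then show "R' = R" by (simp only: scaleC_scaleC left_inverse[OF c0] scaleC_simps)
  qed
  then show ?thesis using R[OF \<epsilon>] by simp
qed

section \<open>Residue projections of the resolvent family\<close>

definition rproj :: "('a::complex_hilbert \<Rightarrow>\<^sub>L 'a) \<Rightarrow> complex \<Rightarrow> complex \<Rightarrow> 'a \<Rightarrow>\<^sub>L 'a" where
  "rproj K r w = vresidue (pres K r) w"

lemma rproj_contour:
  fixes K :: "'a::complex_hilbert \<Rightarrow>\<^sub>L 'a"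
  assumes K: "approximable K" "clinear_blinfun K"
  obtains e where "e > 0" "\<And>s. s \<in> ball w e - {w} \<Longrightarrow> invertible_op (pencil K r s)"
    "\<And>\<epsilon> \<phi>. 0 < \<epsilon> \<Longrightarrow> \<epsilon> < e \<Longrightarrow> cfunctional \<phi> \<Longrightarrow>
      ((\<lambda>s. \<phi> (pres K r s)) has_contour_integral (2 * of_real pi * \<i> * \<phi> (rproj K r w))) (circlepath w \<epsilon>)"
proof -
  obtain e where e: "e > 0" "\<And>s. s \<in> ball w e - {w} \<Longrightarrow> invertible_op (pencil K r s)"
    using pres_local[OF K, of w r] by metis
  have "vholomorphic_on (pres K r) (ball w e - {w})"
    using e(2) by (intro vholomorphic_subset[OF pres_holomorphic[OF K(2)]]) auto
  then have "((\<lambda>s. \<phi> (pres K r s)) has_contour_integral (2 * of_real pi * \<i> * \<phi> (rproj K r w))) (circlepath w \<epsilon>)"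
    if "0 < \<epsilon>" "\<epsilon> < e" "cfunctional \<phi>" for \<epsilon> \<phi>
    using cfunctional_contour_integral[OF vresidue_contour_integral that(3)] that
    unfolding rproj_def cfunctional_def by metis
  then show ?thesis using that e by blast
qed

lemma rproj_functional_zero:
  fixes K :: "'a::complex_hilbert \<Rightarrow>\<^sub>L 'a"
  assumes K: "approximable K" "clinear_blinfun K" and \<phi>: "cfunctional \<phi>"
    and h: "e > 0" "h holomorphic_on ball w e" "\<And>s. s \<in> ball w e - {w} \<Longrightarrow> \<phi> (pres K r s) = h s"
  shows "\<phi> (rproj K r w) = 0"
proof -
  obtain e' where e': "e' > 0" "\<And>\<epsilon> \<phi>. 0 < \<epsilon> \<Longrightarrow> \<epsilon> < e' \<Longrightarrow> cfunctional \<phi> \<Longrightarrow>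
      ((\<lambda>s. \<phi> (pres K r s)) has_contour_integral (2 * of_real pi * \<i> * \<phi> (rproj K r w))) (circlepath w \<epsilon>)"
    using rproj_contour[OF K] by metis
  define d where "d = min e e' / 2"
  have d: "0 < d" "d < e" "d < e'" using h(1) e'(1) by (auto simp: d_def)
  have "(h has_contour_integral 0) (circlepath w d)"
    using d by (intro Cauchy_theorem_convex_simple[OF h(2)]) auto
  then have "((\<lambda>s. \<phi> (pres K r s)) has_contour_integral 0) (circlepath w d)"
    by (rule has_contour_integral_eq) (use d h(3) in \<open>auto simp: dist_norm norm_minus_commute\<close>)
  with e'(2)[OF d(1,3) \<phi>] have "2 * of_real pi * \<i> * \<phi> (rproj K r w) = 0"
    by (rule has_contour_integral_unique)
  then show ?thesis by simp
qed

text \<open>Agreement is asked for only where both pencils are invertible; the exceptional points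
  are isolated, so small circles around \<open>w\<close> avoid them. Linearity of residues and their
  intertwining are both instances.\<close>

lemma rproj_functional_eq:
  fixes K :: "'a::complex_hilbert \<Rightarrow>\<^sub>L 'a" and K' :: "'b::complex_hilbert \<Rightarrow>\<^sub>L 'b"
  assumes K: "approximable K" "clinear_blinfun K" and K': "approximable K'" "clinear_blinfun K'"
    and \<phi>: "cfunctional \<phi>" "cfunctional \<phi>'"
    and eq: "\<And>s. invertible_op (pencil K r s) \<Longrightarrow> invertible_op (pencil K' r s) \<Longrightarrow>
       \<phi> (pres K r s) = \<phi>' (pres K' r s)"
  shows "\<phi> (rproj K r w) = \<phi>' (rproj K' r w)"
proof -
  obtain e where e: "e > 0" "\<And>s. s \<in> ball w e - {w} \<Longrightarrow> invertible_op (pencil K r s)"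
    "\<And>\<epsilon> \<phi>. 0 < \<epsilon> \<Longrightarrow> \<epsilon> < e \<Longrightarrow> cfunctional \<phi> \<Longrightarrow>
      ((\<lambda>s. \<phi> (pres K r s)) has_contour_integral (2 * of_real pi * \<i> * \<phi> (rproj K r w))) (circlepath w \<epsilon>)"
    using rproj_contour[OF K] by metis
  obtain e' where e': "e' > 0" "\<And>s. s \<in> ball w e' - {w} \<Longrightarrow> invertible_op (pencil K' r s)"
    "\<And>\<epsilon> \<phi>. 0 < \<epsilon> \<Longrightarrow> \<epsilon> < e' \<Longrightarrow> cfunctional \<phi> \<Longrightarrow>
      ((\<lambda>s. \<phi> (pres K' r s)) has_contour_integral (2 * of_real pi * \<i> * \<phi> (rproj K' r w))) (circlepath w \<epsilon>)"
    using rproj_contour[OF K'] by metis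
  define d where "d = min e e' / 2"
  have d: "0 < d" "d < e" "d < e'" using e(1) e'(1) by (auto simp: d_def)
  have "((\<lambda>s. \<phi> (pres K r s)) has_contour_integral 2 * of_real pi * \<i> * \<phi>' (rproj K' r w)) (circlepath w d)"
  proof (rule has_contour_integral_eq[OF e'(3)[OF d(1,3) \<phi>(2)]])
    fix s assume "s \<in> path_image (circlepath w d)"
    then have "dist w s = d" using d by (simp add: dist_norm norm_minus_commute)
    then have "s \<in> ball w e - {w}" "s \<in> ball w e' - {w}" using d by auto
    then show "\<phi>' (pres K' r s) = \<phi> (pres K r s)" using eq e(2) e'(2) by simp
  qed
  with e(3)[OF d(1,2) \<phi>(1)] have "2 * of_real pi * \<i> * \<phi> (rproj K r w) = 2 * of_real pi * \<i> * \<phi>' (rproj K' r w)"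
    by (rule has_contour_integral_unique)
  then show ?thesis by simp
qed

lemma pres_apply:
  assumes "invertible_op (pencil K r s)" and K: "clinear_blinfun K"
  shows "pencil K r s (pres K r s x) = K x" "pres K r s (pencil K r s x) = pres K r s x + (s - r) *\<^sub>C pres K r s (K x)"
proof -
  have inv: "is_inverse (pencil K r s) (inv_op (pencil K r s))" by (rule is_inverse_inv_op[OF assms(1)])
  show "pencil K r s (pres K r s x) = K x"
    by (simp add: pres_eqI[OF inv] is_inverse_apply[OF inv])
  have "clinear_blinfun (pres K r s)"
    using K clinear_inverse[OF inv] by (auto simp: pres_eqI[OF inv])
  then show "pres K r s (pencil K r s x) = pres K r s x + (s - r) *\<^sub>C pres K r s (K x)"
    by (simp add: pencil_apply blinfun.add_right clinear_blinfunD)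
qed

lemma clinear_pres:
  assumes "clinear_blinfun K" shows "clinear_blinfun (pres K r s)"
proof (cases "invertible_op (pencil K r s)")
  case True
  then have "is_inverse (pencil K r s) (inv_op (pencil K r s))" by (rule is_inverse_inv_op)
  then show ?thesis
    using clinear_inverse[of "pencil K r s"] assms by (simp add: pres_eqI)
qed (simp add: pres_def)

lemma pres_intertwine:
  fixes K :: "'a::complex_normed_vector \<Rightarrow>\<^sub>L 'a" and K' :: "'a \<Rightarrow>\<^sub>L 'a"
  assumes K: "clinear_blinfun K" "clinear_blinfun K'" and L: "clinear_blinfun L" "\<And>x. L (K x) = K' (L x)"
    and inv: "invertible_op (pencil K r s)" "invertible_op (pencil K' r s)"
  shows "L (pres K r s x) = pres K' r s (L x)"
proof -
  have i: "is_inverse (pencil K r s) (inv_op (pencil K r s))"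
    "is_inverse (pencil K' r s) (inv_op (pencil K' r s))" by (intro is_inverse_inv_op inv)+
  have "pencil K' r s (L (pres K r s x)) = L (pencil K r s (pres K r s x))"
    by (simp add: pencil_apply blinfun.add_right clinear_blinfunD[OF L(1)] L(2))
  also have "\<dots> = K' (L x)" by (simp add: pres_apply(1)[OF inv(1) K(1)] L(2))
  also have "\<dots> = pencil K' r s (pres K' r s (L x))" by (simp add: pres_apply(1)[OF inv(2) K(2)])
  finally show ?thesis by (metis is_inverse_apply(2)[OF i(2)])
qed

lemma rproj_intertwine:
  fixes K K' :: "'a::complex_hilbert \<Rightarrow>\<^sub>L 'a"
  assumes K: "approximable K" "clinear_blinfun K" and K': "approximable K'" "clinear_blinfun K'"
    and L: "clinear_blinfun L" "\<And>x. L (K x) = K' (L x)"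
  shows "L (rproj K r w x) = rproj K' r w (L x)"
proof (rule cinner_eqI)
  fix u
  show "cinner u (L (rproj K r w x)) = cinner u (rproj K' r w (L x))"
    by (rule rproj_functional_eq[OF K K' cfunctional_cinner[OF L(1)] cfunctional_cinner'])
       (simp add: pres_intertwine[OF K(2) K'(2) L])
qed

definition opow :: "('a::real_normed_vector \<Rightarrow>\<^sub>L 'a) \<Rightarrow> nat \<Rightarrow> 'a \<Rightarrow>\<^sub>L 'a" where
  "opow X n = ((o\<^sub>L) X ^^ n) one_op"

lemma opow_simps [simp]: "opow X 0 = one_op" "opow X (Suc n) = X o\<^sub>L opow X n"
  by (simp_all add: opow_def)

lemma opow_commute: "X (opow X n x) = opow X n (X x)"
  by (induction n arbitrary: x) simp_all

lemma clinear_opow: "clinear_blinfun X \<Longrightarrow> clinear_blinfun (opow X n)"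
  by (induction n) auto

text \<open>A polynomial in \<open>K\<close> kept in factorized form: repetition in the list is
  multiplicity of a root, and the kernel collects root vectors of the listed points.\<close>

primrec pencil_prod :: "('a::complex_normed_vector \<Rightarrow>\<^sub>L 'a) \<Rightarrow> complex \<Rightarrow> complex list \<Rightarrow> 'a \<Rightarrow>\<^sub>L 'a" where
  "pencil_prod K r [] = one_op"
| "pencil_prod K r (w # ws) = pencil K r w o\<^sub>L pencil_prod K r ws"

lemma clinear_pencil_prod: "clinear_blinfun K \<Longrightarrow> clinear_blinfun (pencil_prod K r ws)"
  by (induction ws) auto

lemma pencil_commute:
  "clinear_blinfun K \<Longrightarrow> pencil K r w (pencil K r w' x) = pencil K r w' (pencil K r w x)"
  by (simp add: pencil_apply blinfun.add_right clinear_blinfunD scaleC_right_distrib scaleC_scaleC mult.commute)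

lemma pencil_prod_commute:
  "clinear_blinfun K \<Longrightarrow> pencil_prod K r ws (pencil K r w x) = pencil K r w (pencil_prod K r ws x)"
  by (induction ws) (simp_all add: pencil_commute)

lemma pencil_prod_append: "pencil_prod K r (ws @ ws') x = pencil_prod K r ws (pencil_prod K r ws' x)"
  by (induction ws) simp_all

lemma pencil_prod_append_zero:
  assumes "clinear_blinfun K" "pencil_prod K r ws x = 0 \<or> pencil_prod K r ws' x = 0"
  shows "pencil_prod K r (ws @ ws') x = 0"
proof -
  have comm: "pencil_prod K r ws (pencil_prod K r ws' x) = pencil_prod K r ws' (pencil_prod K r ws x)"
    by (induction ws') (simp_all add: pencil_prod_commute[OF assms(1)])
  show ?thesis
    using assms(2)
  proof
    assume "pencil_prod K r ws x = 0"
    then show ?thesis by (simp add: pencil_prod_append comm)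
  qed (simp add: pencil_prod_append)
qed

lemma pencil_prod_replicate: "pencil_prod K r (replicate n w) = opow (pencil K r w) n"
  by (induction n) simp_all

lemma pencil_prod_decompose:
  "clinear_blinfun K \<Longrightarrow> \<exists>G. clinear_blinfun G \<and> pencil_prod K r ws = one_op + (K o\<^sub>L G)"
proof (induction ws)
  case Nil
  show ?case by (intro exI[of _ 0]) (simp add: compose_simps)
next
  case (Cons w ws)
  note K = Cons.prems
  from Cons obtain G where G: "clinear_blinfun G" "pencil_prod K r ws = one_op + (K o\<^sub>L G)" by blast
  have "pencil_prod K r (w # ws) = one_op + (K o\<^sub>L ((w - r) *\<^sub>C one_op + (pencil K r w o\<^sub>L G)))"
    by (rule blinfun_eqI)
       (simp add: G(2) pencil_apply blinfun.add_left blinfun.add_right clinear_blinfunD[OF K] scaleC_right_distrib)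
  then show ?case using G K by (intro exI[of _ "(w - r) *\<^sub>C one_op + (pencil K r w o\<^sub>L G)"]) auto
qed

text \<open>The product is 1 + K G with a bounded \<open>G\<close>, so its kernel consists of fixed
  vectors of the compact operator - K G.\<close>

lemma finite_dim_pencil_prod:
  assumes K: "approximable K" "clinear_blinfun K"
  shows "finite_dim {x. pencil_prod K r ws x = 0}"
proof -
  obtain G where G: "clinear_blinfun G" "pencil_prod K r ws = one_op + (K o\<^sub>L G)"
    using pencil_prod_decompose[OF K(2)] by blast
  have "approximable (K o\<^sub>L (- G))" using G(1) by (intro approximable_compose K) auto
  moreover have "complex_vector.subspace {x. pencil_prod K r ws x = 0}"
    using K by (intro subspace_kernel clinear_pencil_prod) auto
  moreover have "(K o\<^sub>L (- G)) x = x" if "x \<in> {x. pencil_prod K r ws x = 0}" for x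
  proof -
    have "x + K (G x) = 0" using that by (simp add: G(2) blinfun.add_left)
    then have "x = - K (G x)" by (simp add: eq_neg_iff_add_eq_0)
    then show ?thesis by (simp add: blinfun.minus_left blinfun.minus_right)
  qed
  ultimately show ?thesis by (rule approximable_fixed_finite_dim)
qed

context
  fixes K :: "'a::complex_hilbert \<Rightarrow>\<^sub>L 'a" and r :: complex
  assumes K: "approximable K" "clinear_blinfun K"
begin

lemma rproj_commute: "clinear_blinfun L \<Longrightarrow> (\<And>x. L (K x) = K (L x)) \<Longrightarrow> L (rproj K r w x) = rproj K r w (L x)"
  by (rule rproj_intertwine[OF K K])

lemma clinear_rproj: "clinear_blinfun (rproj K r w)"
  unfolding clinear_blinfun_def
proof (intro allI cinner_eqI)
  fix c x u
  have "cfunctional (\<lambda>T :: 'a \<Rightarrow>\<^sub>L 'a. cinner (cnj c *\<^sub>C u) (T x))" by (rule cfunctional_cinner')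
  from rproj_functional_eq[OF K K cfunctional_cinner'[of u "c *\<^sub>C x"] this, of r w]
  show "cinner u (rproj K r w (c *\<^sub>C x)) = cinner u (c *\<^sub>C rproj K r w x)"
    by (simp add: clinear_blinfunD[OF clinear_pres[OF K(2)]] cinner_scaleC_left cinner_scaleC_right)
qed

lemma pencil_pres:
  assumes "invertible_op (pencil K r s)"
  shows "pencil K r w (pres K r s x) = K x + (w - s) *\<^sub>C K (pres K r s x)"
  using pres_apply(1)[OF assms K(2), of x]
  by (subst pencil_shift[of K r w s]) (simp add: blinfun.add_left)

text \<open>Each factor \<open>pencil K r w\<close> replaces \<open>pres\<close> by an entire term
  plus \<open>w - s\<close> times K applied to \<open>pres\<close>. After \<open>n\<close> factors
  the power of \<open>w - s\<close> compensates a pole of order \<open>n\<close>.\<close>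

lemma pencil_power_pres:
  "\<exists>q. vholomorphic_on q UNIV \<and> (\<forall>s. invertible_op (pencil K r s) \<longrightarrow>
      opow (pencil K r w) n o\<^sub>L pres K r s = q s + (w - s) ^ n *\<^sub>C (opow K n o\<^sub>L pres K r s))"
proof (induction n)
  case 0
  show ?case by (intro exI[of _ "\<lambda>s. 0"]) (simp add: vholomorphic_const compose_simps)
next
  case (Suc n)
  then obtain q where q: "vholomorphic_on q UNIV" and eq: "\<And>s. invertible_op (pencil K r s) \<Longrightarrow>
      opow (pencil K r w) n o\<^sub>L pres K r s = q s + (w - s) ^ n *\<^sub>C (opow K n o\<^sub>L pres K r s)" by blast
  define q' where "q' s = (pencil K r w o\<^sub>L q s) - (- ((w - s) ^ n)) *\<^sub>C opow K (Suc n)" for s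
  have "vholomorphic_on q' UNIV"
    unfolding q'_def
    by (intro vholomorphic_diff vholomorphic_scaleC vholomorphic_compose vholomorphic_const q
        holomorphic_intros) (simp add: K)
  moreover have "opow (pencil K r w) (Suc n) o\<^sub>L pres K r s
      = q' s + (w - s) ^ Suc n *\<^sub>C (opow K (Suc n) o\<^sub>L pres K r s)" if s: "invertible_op (pencil K r s)" for s
  proof (rule blinfun_eqI)
    fix x
    let ?X = "pencil K r w" and ?p = "pres K r s"
    have lin: "clinear_blinfun ?X" "clinear_blinfun (opow K n)" using K by (auto intro: clinear_opow)
    have comm: "?X (opow K n y) = opow K n (?X y)" for y
      by (simp add: pencil_apply blinfun.add_right clinear_blinfunD[OF lin(2)] opow_commute)
    have "?X (opow ?X n (?p x)) = ?X (q s x + (w - s) ^ n *\<^sub>C opow K n (?p x))"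
      using eq[OF s, THEN arg_cong[of _ _ "\<lambda>T. blinfun_apply T x"]] by (simp add: blinfun.add_left)
    also have "\<dots> = ?X (q s x) + (w - s) ^ n *\<^sub>C opow K n (K x + (w - s) *\<^sub>C K (?p x))"
      by (simp add: blinfun.add_right clinear_blinfunD[OF lin(1)] comm pencil_pres[OF s])
    also have "\<dots> = ?X (q s x) + (w - s) ^ n *\<^sub>C K (opow K n x) + (w - s) ^ Suc n *\<^sub>C K (opow K n (?p x))"
      by (simp add: blinfun.add_right clinear_blinfunD[OF lin(2)] opow_commute scaleC_right_distrib
          scaleC_scaleC mult.commute)
    finally show "(opow ?X (Suc n) o\<^sub>L ?p) x = (q' s + (w - s) ^ Suc n *\<^sub>C (opow K (Suc n) o\<^sub>L ?p)) x"
      by (simp add: q'_def blinfun.add_left blinfun.diff_left)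
  qed
  ultimately show ?case by blast
qed

text \<open>With \<open>n\<close> bounding the order of the pole, the \<open>n\<close>-th power of
  the pencil at \<open>w\<close> makes \<open>pres\<close> holomorphic near \<open>w\<close>, so the
  residue is annihilated by this fixed operator.\<close>

lemma rproj_nilpotent: "\<exists>n. \<forall>x. opow (pencil K r w) n (rproj K r w x) = 0"
proof -
  obtain n :: nat and e g where g: "e > 0" "vholomorphic_on g (ball w e)"
    "\<And>s. s \<in> ball w e - {w} \<Longrightarrow> invertible_op (pencil K r s)"
    "\<And>s. s \<in> ball w e - {w} \<Longrightarrow> (s - w) ^ n *\<^sub>C pres K r s = g s"
    using pres_local[OF K, of w r] by metis
  obtain q where q: "vholomorphic_on q UNIV" "\<And>s. invertible_op (pencil K r s) \<Longrightarrow>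
      opow (pencil K r w) n o\<^sub>L pres K r s = q s + (w - s) ^ n *\<^sub>C (opow K n o\<^sub>L pres K r s)"
    using pencil_power_pres[of w n] by blast
  have linX: "clinear_blinfun (opow (pencil K r w) n)" and linK: "clinear_blinfun (opow K n)"
    using K by (auto intro: clinear_opow)
  have "opow (pencil K r w) n (rproj K r w x) = 0" for x
  proof (rule cinner_eqI)
    fix u
    have "cinner u (opow (pencil K r w) n (rproj K r w x)) = 0"
    proof (rule rproj_functional_zero[OF K cfunctional_cinner[OF linX] g(1)])
      show "(\<lambda>s. cinner u (q s x) + (- 1) ^ n * cinner u (opow K n (g s x))) holomorphic_on ball w e"
        by (intro holomorphic_intros vholomorphic_functional[OF g(2) cfunctional_cinner[OF linK]]
            vholomorphic_functional[OF vholomorphic_subset[OF q(1)] cfunctional_cinner']) auto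
      fix s assume s: "s \<in> ball w e - {w}"
      have "(w - s) ^ n *\<^sub>C opow K n (pres K r s x) = (- 1) ^ n *\<^sub>C opow K n (g s x)"
        by (simp add: g(4)[OF s, symmetric] clinear_blinfunD[OF linK] scaleC_scaleC flip: power_mult_distrib)
      then show "cinner u (opow (pencil K r w) n (pres K r s x))
          = cinner u (q s x) + (- 1) ^ n * cinner u (opow K n (g s x))"
        using q(2)[OF g(3)[OF s], THEN arg_cong[of _ _ "\<lambda>T. blinfun_apply T x"]]
        by (simp add: blinfun.add_left cinner_add_right cinner_scaleC_right)
    qed
    then show "cinner u (opow (pencil K r w) n (rproj K r w x)) = cinner u 0" by simp
  qed
  then show ?thesis by blast
qed

lemma finite_dim_nilpotent: "finite_dim {x. opow (pencil K r w) n x = 0}"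
  using finite_dim_pencil_prod[OF K, of r "replicate n w"] by (simp add: pencil_prod_replicate)

text \<open>On the kernel of \<open>K\<close> the pencil is the identity. Hence \<open>K\<close>,
  and any operator through which it factors, is injective on root spaces.\<close>

lemma nilpotent_kernel:
  assumes "opow (pencil K r w) n x = 0" "K x = 0" shows "x = 0"
proof -
  have "opow (pencil K r w) m x = x" for m
    by (induction m) (simp_all add: pencil_apply assms(2))
  then show ?thesis using assms(1) by simp
qed

end

text \<open>The part of order at least two of a principal part; it has a primitive off its pole.\<close>

inductive pole_tail :: "complex \<Rightarrow> (complex \<Rightarrow> 'a::complex_vector) \<Rightarrow> bool" for w where
  zero: "pole_tail w (\<lambda>s. 0)"
| add: "pole_tail w f \<Longrightarrow> pole_tail w (\<lambda>s. f s + (1 / (s - w) ^ (j + 2)) *\<^sub>C c)"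

lemma pole_tail_sum:
  assumes "pole_tail w g" "pole_tail w f" shows "pole_tail w (\<lambda>s. f s + g s)"
  using assms
proof (induction rule: pole_tail.induct)
  case (add g j c)
  then show ?case using pole_tail.add[of w "\<lambda>s. f s + g s" j c] by (simp add: add.assoc)
qed simp

lemma pole_tail_scale: "pole_tail w f \<Longrightarrow> pole_tail w (\<lambda>s. a *\<^sub>C f s)"
proof (induction rule: pole_tail.induct)
  case (add f j c)
  then show ?case using pole_tail.add[of w "\<lambda>s. a *\<^sub>C f s" j "a *\<^sub>C c"]
    by (simp add: scaleC_right_distrib scaleC_scaleC)
qed (simp add: pole_tail.zero)

lemma pole_tail_divide: "pole_tail w f \<Longrightarrow> pole_tail w (\<lambda>s. (1 / (s - w)) *\<^sub>C f s)"
proof (induction rule: pole_tail.induct)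
  case (add f j c)
  then show ?case using pole_tail.add[of w "\<lambda>s. (1 / (s - w)) *\<^sub>C f s" "Suc j" c]
    by (simp add: scaleC_right_distrib scaleC_scaleC)
qed (simp add: pole_tail.zero)

lemma pole_tail_base: "pole_tail w (\<lambda>s. (1 / (s - w) ^ 2) *\<^sub>C c)"
  using pole_tail.add[OF pole_tail.zero, of w 0 c] by (simp add: numeral_2_eq_2)

text \<open>Every term has a primitive off \<open>w\<close>, so the integral vanishes whether or not
  \<open>w\<close> is enclosed; the circle only has to avoid \<open>w\<close>.\<close>

lemma pole_tail_integral:
  fixes f :: "complex \<Rightarrow> 'a::complex_inner"
  assumes "pole_tail w f" "0 < \<epsilon>" "dist a w \<noteq> \<epsilon>"
  shows "((\<lambda>s. cinner u (f s)) has_contour_integral 0) (circlepath a \<epsilon>)"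
  using assms(1)
proof (induction rule: pole_tail.induct)
  case (add f j c)
  define p where "p s = - (cinner u c / (of_nat (Suc j) * (s - w) ^ Suc j))" for s
  have "((\<lambda>s. cinner u c / (s - w) ^ (j + 2)) has_contour_integral
      p (pathfinish (circlepath a \<epsilon>)) - p (pathstart (circlepath a \<epsilon>))) (circlepath a \<epsilon>)"
  proof (rule contour_integral_primitive[of "- {w}"])
    fix s assume s: "s \<in> - {w}"
    have e: "p = (\<lambda>s. - (cinner u c / of_nat (Suc j)) * (1 / (s - w) ^ Suc j))"
      by (rule ext) (simp add: p_def)
    have D: "((\<lambda>s. 1 / (s - w) ^ Suc j) has_field_derivative - (of_nat (Suc j) * (s - w) ^ j / ((s - w) ^ Suc j * (s - w) ^ Suc j)))
        (at s within - {w})"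
      using s by (auto intro!: derivative_eq_intros simp del: of_nat_Suc power_Suc)
    have q: "- (cinner u c / of_nat (Suc j)) * - (of_nat (Suc j) * q ^ j / (q ^ Suc j * q ^ Suc j))
        = cinner u c / q ^ (j + 2)" if "q \<noteq> 0" for q
      using that by (simp add: field_simps del: of_nat_Suc)
    from DERIV_cmult[OF D, of "- (cinner u c / of_nat (Suc j))"]
    show "(p has_field_derivative cinner u c / (s - w) ^ (j + 2)) (at s within - {w})"
      unfolding e by (rule DERIV_cong) (rule q, use s in simp)
  qed (use assms in \<open>auto simp: sphere_def\<close>)
  then have "((\<lambda>s. cinner u c / (s - w) ^ (j + 2)) has_contour_integral 0) (circlepath a \<epsilon>)" by simp
  from has_contour_integral_add[OF add.IH this]
  show ?case by (simp add: cinner_add_right cinner_scaleC_right)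
qed (simp add: has_contour_integral_0)

section \<open>Calculus of the residue projections\<close>

definition poles_in :: "('a::complex_normed_vector \<Rightarrow>\<^sub>L 'a) \<Rightarrow> complex \<Rightarrow> complex set \<Rightarrow> complex set" where
  "poles_in K r S = {w \<in> S. \<not> invertible_op (pencil K r w)}"

context
  fixes K :: "'a::complex_hilbert \<Rightarrow>\<^sub>L 'a" and r :: complex
  assumes K: "approximable K" "clinear_blinfun K"
begin

text \<open>Induction on the nilpotency order, passing from \<open>v\<close> to
  \<open>v' = pencil K r w v\<close>. For the images \<open>a\<close>, \<open>p\<close> of
  \<open>v\<close>, \<open>v'\<close> one has (s - w) a = v - v' + (s - r) p; the simple pole of
  \<open>p\<close> cancels the term with \<open>v'\<close>, and only \<open>v\<close> keeps a simple
  pole.\<close>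

lemma pres_on_nilpotent:
  assumes "opow (pencil K r w) n v = 0"
  shows "\<exists>f. pole_tail w f \<and> (\<forall>s. invertible_op (pencil K r s) \<longrightarrow> s \<noteq> w \<longrightarrow>
           pres K r s v = (1 / (s - w)) *\<^sub>C v + f s)"
  using assms
proof (induction n arbitrary: v)
  case 0
  then have "v = 0" by simp
  then show ?case by (intro exI[of _ "\<lambda>s. 0"]) (simp add: pole_tail.zero)
next
  case (Suc n)
  define v' where "v' = pencil K r w v"
  have "opow (pencil K r w) n v' = 0" using Suc.prems by (simp add: v'_def opow_commute)
  then obtain f where f: "pole_tail w f" "\<And>s. invertible_op (pencil K r s) \<Longrightarrow> s \<noteq> w \<Longrightarrow>
      pres K r s v' = (1 / (s - w)) *\<^sub>C v' + f s" using Suc.IH by blast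
  define g where "g s = f s + (w - r) *\<^sub>C ((1 / (s - w) ^ 2) *\<^sub>C v' + (1 / (s - w)) *\<^sub>C f s)" for s
  have "pole_tail w g"
    unfolding g_def by (intro pole_tail_sum pole_tail_scale pole_tail_divide pole_tail_base f(1))
  moreover have "pres K r s v = (1 / (s - w)) *\<^sub>C v + g s" if s: "invertible_op (pencil K r s)" "s \<noteq> w" for s
  proof -
    define a p where "a = pres K r s v" and "p = pres K r s v'"
    have lin: "clinear_blinfun (pres K r s)" by (rule clinear_pres[OF K(2)])
    have comm: "K (pres K r s x) = pres K r s (K x)" for x
      by (rule pres_intertwine[OF K(2) K(2) K(2) _ s(1) s(1)]) simp
    have 2: "a + (s - r) *\<^sub>C K a = K v"
      using pres_apply(1)[OF s(1) K(2), of v] by (simp add: a_def pencil_apply)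
    have 3: "v' = v + (w - r) *\<^sub>C K v" by (simp add: v'_def pencil_apply)
    have 1: "p = a + (w - r) *\<^sub>C K a"
      unfolding p_def 3 by (simp add: a_def comm blinfun.add_right clinear_blinfunD[OF lin])
    have "(s - w) *\<^sub>C a = v - v' + (s - r) *\<^sub>C p"
    proof -
      have "v - v' = (r - w) *\<^sub>C (a + (s - r) *\<^sub>C K a)"
        unfolding 2 3 by (simp flip: complex_vector.scale_minus_left)
      then have "v - v' + (s - r) *\<^sub>C p = ((r - w) + (s - r)) *\<^sub>C a + ((r - w) * (s - r) + (s - r) * (w - r)) *\<^sub>C K a"
        unfolding 1 by (simp only: scaleC_right_distrib scaleC_left_distrib scaleC_scaleC) (simp add: algebra_simps)
      also have "(r - w) * (s - r) + (s - r) * (w - r) = 0" by (simp add: algebra_simps)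
      finally show ?thesis by simp
    qed
    then have "(1 / (s - w)) *\<^sub>C (s - w) *\<^sub>C a = (1 / (s - w)) *\<^sub>C (v - v' + ((s - w) + (w - r)) *\<^sub>C p)" by simp
    moreover have "(1 / (s - w)) *\<^sub>C (s - w) *\<^sub>C a = a" using s(2) by (simp add: scaleC_scaleC)
    moreover have "(1 / (s - w)) *\<^sub>C (v - v' + ((s - w) + (w - r)) *\<^sub>C p)
        = (1 / (s - w)) *\<^sub>C v - (1 / (s - w)) *\<^sub>C v' + ((1 / (s - w)) * ((s - w) + (w - r))) *\<^sub>C p"
      by (simp only: scaleC_right_distrib scaleC_diff_right scaleC_scaleC)
    moreover have "(1 / (s - w)) * ((s - w) + (w - r)) = 1 + (w - r) * (1 / (s - w))"
      using s(2) by (simp add: field_simps)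
    ultimately have "a = (1 / (s - w)) *\<^sub>C v - (1 / (s - w)) *\<^sub>C v' + p + ((w - r) * (1 / (s - w))) *\<^sub>C p"
      by (simp only: scaleC_left_distrib scaleC_simps add.assoc)
    moreover have "p = (1 / (s - w)) *\<^sub>C v' + f s" using f(2)[OF s] by (simp add: p_def)
    ultimately have "a = (1 / (s - w)) *\<^sub>C v + (f s + ((w - r) * (1 / (s - w))) *\<^sub>C ((1 / (s - w)) *\<^sub>C v' + f s))"
      by (simp add: add.assoc)
    then show ?thesis
      by (simp add: a_def g_def scaleC_right_distrib scaleC_scaleC power2_eq_square)
  qed
  ultimately show ?case by blast
qed

text \<open>Only the simple pole survives integration. Together with \<open>rproj_nilpotent\<close>
  this yields idempotence and mutual annihilation of the residues, in place of the usual double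
  contour integral.\<close>

lemma rproj_on_nilpotent:
  assumes v: "opow (pencil K r w) n v = 0"
  shows "rproj K r a v = (if a = w then v else 0)"
proof -
  obtain f where f: "pole_tail w f" "\<And>s. invertible_op (pencil K r s) \<Longrightarrow> s \<noteq> w \<Longrightarrow>
      pres K r s v = (1 / (s - w)) *\<^sub>C v + f s" using pres_on_nilpotent[OF v] by blast
  obtain e where e: "e > 0" "\<And>s. s \<in> ball a e - {a} \<Longrightarrow> invertible_op (pencil K r s)"
    "\<And>\<epsilon> \<phi>. 0 < \<epsilon> \<Longrightarrow> \<epsilon> < e \<Longrightarrow> cfunctional \<phi> \<Longrightarrow>
      ((\<lambda>s. \<phi> (pres K r s)) has_contour_integral (2 * of_real pi * \<i> * \<phi> (rproj K r a))) (circlepath a \<epsilon>)"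
    using rproj_contour[OF K] by metis
  \<comment> \<open>For \<open>a = w\<close> any small circle serves; otherwise it has to leave
    \<open>w\<close> outside.\<close>
  define \<epsilon> where "\<epsilon> = (if a = w then e / 2 else min e (dist a w) / 2)"
  have \<epsilon>: "0 < \<epsilon>" "\<epsilon> < e" "dist a w \<noteq> \<epsilon>" and \<epsilon>': "a \<noteq> w \<Longrightarrow> \<epsilon> < dist a w"
    using e(1) by (auto simp: \<epsilon>_def min_def)
  show ?thesis
  proof (rule cinner_eqI)
    fix u
    have "((\<lambda>s. cinner u v / (s - w)) has_contour_integral
        2 * of_real pi * \<i> * cinner u (if a = w then v else 0)) (circlepath a \<epsilon>)"
    proof (cases "a = w")
      case True
      then show ?thesis
        using Cauchy_integral_circlepath_simple[of "\<lambda>s. cinner u v" a \<epsilon> a] \<epsilon>(1) by simp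
    next
      case False
      have "((\<lambda>s. cinner u v / (s - w)) has_contour_integral 0) (circlepath a \<epsilon>)"
      proof (rule Cauchy_theorem_convex_simple)
        show "(\<lambda>s. cinner u v / (s - w)) holomorphic_on ball a (dist a w)"
          by (intro holomorphic_intros) (auto simp: dist_commute)
      qed (use \<epsilon>'[OF False] \<epsilon>(1) in auto)
      then show ?thesis using False by simp
    qed
    from has_contour_integral_add[OF this pole_tail_integral[OF f(1) \<epsilon>(1,3)], of u]
    have "((\<lambda>s. cinner u v / (s - w) + cinner u (f s)) has_contour_integral
        2 * of_real pi * \<i> * cinner u (if a = w then v else 0)) (circlepath a \<epsilon>)" by simp
    then have "((\<lambda>s. cinner u (pres K r s v)) has_contour_integral
        2 * of_real pi * \<i> * cinner u (if a = w then v else 0)) (circlepath a \<epsilon>)"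
    proof (rule has_contour_integral_eq)
      fix s assume "s \<in> path_image (circlepath a \<epsilon>)"
      then have d: "dist a s = \<epsilon>" using \<epsilon>(1) by simp
      then have "s \<noteq> w" "s \<in> ball a e - {a}" using \<epsilon> by auto
      then show "cinner u v / (s - w) + cinner u (f s) = cinner u (pres K r s v)"
        using f(2)[OF e(2)] by (simp add: cinner_add_right cinner_scaleC_right)
    qed
    with e(3)[OF \<epsilon>(1,2) cfunctional_cinner'[of u v]]
    have "2 * of_real pi * \<i> * cinner u (rproj K r a v) = 2 * of_real pi * \<i> * cinner u (if a = w then v else 0)"
      by (rule has_contour_integral_unique)
    then show "cinner u (rproj K r a v) = cinner u (if a = w then v else 0)" by simp
  qed
qed

lemma rproj_rproj: "rproj K r a (rproj K r w x) = (if a = w then rproj K r w x else 0)"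
  using rproj_nilpotent[OF K, of r w] rproj_on_nilpotent by metis

lemma finite_dim_rproj: "finite_dim (range (blinfun_apply (rproj K r w)))"
proof -
  obtain n where "\<And>x. opow (pencil K r w) n (rproj K r w x) = 0"
    using rproj_nilpotent[OF K, of r w] by blast
  then show ?thesis by (intro finite_dim_subset[OF finite_dim_nilpotent[OF K, of r w n]]) auto
qed

lemma rproj_kernel: "K (rproj K r w x) = 0 \<Longrightarrow> rproj K r w x = 0"
  using rproj_nilpotent[OF K, of r w] nilpotent_kernel[OF K] by metis

lemma residue_pres:
  assumes \<phi>: "cfunctional \<phi>"
  shows "residue (\<lambda>s. \<phi> (pres K r s)) w = \<phi> (rproj K r w)"
proof -
  obtain e where e: "e > 0" "\<And>s. s \<in> ball w e - {w} \<Longrightarrow> invertible_op (pencil K r s)"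
    "\<And>\<epsilon> \<phi>. 0 < \<epsilon> \<Longrightarrow> \<epsilon> < e \<Longrightarrow> cfunctional \<phi> \<Longrightarrow>
      ((\<lambda>s. \<phi> (pres K r s)) has_contour_integral (2 * of_real pi * \<i> * \<phi> (rproj K r w))) (circlepath w \<epsilon>)"
    using rproj_contour[OF K] by metis
  have "(\<lambda>s. \<phi> (pres K r s)) holomorphic_on ball w e - {w}"
    using e(2) by (intro vholomorphic_functional[OF vholomorphic_subset[OF pres_holomorphic[OF K(2)]] \<phi>]) auto
  then have "((\<lambda>s. \<phi> (pres K r s)) has_contour_integral 2 * pi * \<i> * residue (\<lambda>s. \<phi> (pres K r s)) w) (circlepath w (e/2))"
    using e(1) by (intro base_residue[of "ball w e"]) auto
  with e(3)[of "e/2", OF _ _ \<phi>] e(1)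
  have "2 * of_real pi * \<i> * \<phi> (rproj K r w) = 2 * pi * \<i> * residue (\<lambda>s. \<phi> (pres K r s)) w"
    by (intro has_contour_integral_unique) auto
  then show ?thesis by simp
qed

lemma finite_poles_in: "bounded S \<Longrightarrow> finite (poles_in K r S)"
proof -
  assume "bounded S"
  then obtain R where "S \<subseteq> cball 0 R" using bounded_subset_ballD[of S 0] ball_subset_cball by blast
  then show ?thesis
    by (intro finite_subset[OF _ finite_poles[OF K, of 0 R r]]) (auto simp: poles_in_def)
qed

lemma rproj_sum_contour:
  assumes \<phi>: "cfunctional \<phi>" and \<epsilon>: "0 < \<epsilon>" and inv: "\<And>s. dist a s = \<epsilon> \<Longrightarrow> invertible_op (pencil K r s)"
  shows "((\<lambda>s. \<phi> (pres K r s)) has_contour_integral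
            (2 * of_real pi * \<i> * (\<Sum>w\<in>poles_in K r (ball a \<epsilon>). \<phi> (rproj K r w)))) (circlepath a \<epsilon>)"
proof -
  \<comment> \<open>The residue theorem needs an open domain around the closed disc. Poles in the
    extra ring of width 1 have winding number 0 and drop out.\<close>
  define Z where "Z = poles_in K r (ball a (\<epsilon> + 1))"
  have fin: "finite Z" unfolding Z_def by (rule finite_poles_in) simp
  have hol: "(\<lambda>s. \<phi> (pres K r s)) holomorphic_on ball a (\<epsilon> + 1) - Z"
    by (intro vholomorphic_functional[OF vholomorphic_subset[OF pres_holomorphic[OF K(2)]] \<phi>])
       (auto simp: Z_def poles_in_def)
  have path: "path_image (circlepath a \<epsilon>) \<subseteq> ball a (\<epsilon> + 1) - Z"
    using \<epsilon> inv by (auto simp: Z_def poles_in_def)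
  have "contour_integral (circlepath a \<epsilon>) (\<lambda>s. \<phi> (pres K r s)) =
      2 * pi * \<i> * (\<Sum>w\<in>Z. winding_number (circlepath a \<epsilon>) w * residue (\<lambda>s. \<phi> (pres K r s)) w)"
    using \<epsilon> path
    by (intro Residue_theorem[OF open_ball connected_ball fin hol])
       (auto intro!: winding_number_zero_outside[of _ "cball a \<epsilon>"])
  also have "(\<Sum>w\<in>Z. winding_number (circlepath a \<epsilon>) w * residue (\<lambda>s. \<phi> (pres K r s)) w)
      = (\<Sum>w\<in>poles_in K r (ball a \<epsilon>). \<phi> (rproj K r w))"
  proof (rule sum.mono_neutral_cong_right[OF fin])
    show "poles_in K r (ball a \<epsilon>) \<subseteq> Z" by (auto simp: Z_def poles_in_def)
    show "\<forall>w\<in>Z - poles_in K r (ball a \<epsilon>). winding_number (circlepath a \<epsilon>) w * residue (\<lambda>s. \<phi> (pres K r s)) w = 0"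
    proof
      fix w assume w: "w \<in> Z - poles_in K r (ball a \<epsilon>)"
      then have "dist a w \<noteq> \<epsilon>" "\<not> dist a w < \<epsilon>" using inv by (auto simp: Z_def poles_in_def)
      then have "w \<notin> cball a \<epsilon>" by auto
      then have "winding_number (circlepath a \<epsilon>) w = 0"
        using \<epsilon> by (intro winding_number_zero_outside[of _ "cball a \<epsilon>"]) auto
      then show "winding_number (circlepath a \<epsilon>) w * residue (\<lambda>s. \<phi> (pres K r s)) w = 0" by simp
    qed
    fix w assume "w \<in> poles_in K r (ball a \<epsilon>)"
    then have "winding_number (circlepath a \<epsilon>) w = 1"
      by (intro winding_number_circlepath) (auto simp: poles_in_def dist_norm norm_minus_commute)
    then show "winding_number (circlepath a \<epsilon>) w * residue (\<lambda>s. \<phi> (pres K r s)) w = \<phi> (rproj K r w)"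
      by (simp add: residue_pres[OF \<phi>])
  qed
  finally have eq: "contour_integral (circlepath a \<epsilon>) (\<lambda>s. \<phi> (pres K r s)) =
      2 * of_real pi * \<i> * (\<Sum>w\<in>poles_in K r (ball a \<epsilon>). \<phi> (rproj K r w))" by simp
  have "(\<lambda>s. \<phi> (pres K r s)) contour_integrable_on (circlepath a \<epsilon>)"
    using path by (intro contour_integrable_holomorphic_simple[OF hol]) (auto intro: finite_imp_closed fin open_Diff)
  then show ?thesis using has_contour_integral_integral unfolding eq[symmetric] by blast
qed

end

section \<open>Adjoints, ranks and the spectral theorem in finite rank\<close>

section \<open>Adjoints and ranks\<close>

text \<open>A relation between two given operators: the adjoint of the sandwiched resolvent at z is
  at hand as the one at the conjugate of z, so none has to be constructed.\<close>

definition is_adj :: "('a::complex_inner \<Rightarrow>\<^sub>L 'a) \<Rightarrow> ('a \<Rightarrow>\<^sub>L 'a) \<Rightarrow> bool" where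
  "is_adj A B \<longleftrightarrow> (\<forall>x y. cinner (A x) y = cinner x (B y))"

lemma is_adjD: "is_adj A B \<Longrightarrow> cinner (A x) y = cinner x (B y)"
  by (simp add: is_adj_def)

lemma is_adj_sym: "is_adj A B \<Longrightarrow> is_adj B A"
  unfolding is_adj_def by (metis cinner_commute)

lemma is_adj_compose: "is_adj A B \<Longrightarrow> is_adj A' B' \<Longrightarrow> is_adj (A o\<^sub>L A') (B' o\<^sub>L B)"
  by (simp add: is_adj_def)

lemma pres_adj:
  assumes K: "clinear_blinfun K" "clinear_blinfun K'" "is_adj K K'" and r: "cnj r = r"
    and inv: "invertible_op (pencil K r s)" "invertible_op (pencil K' r (cnj s))"
  shows "cinner (pres K r s x) y = cinner x (pres K' r (cnj s) y)"
proof -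
  have i: "is_inverse (pencil K' r (cnj s)) (inv_op (pencil K' r (cnj s)))"
    by (rule is_inverse_inv_op[OF inv(2)])
  define z where "z = inv_op (pencil K' r (cnj s)) y"
  have y: "y = pencil K' r (cnj s) z" by (simp add: z_def is_inverse_apply[OF i])
  have "K' z = inv_op (pencil K' r (cnj s)) (pencil K' r (cnj s) (K' z))"
    by (simp add: is_inverse_apply[OF i])
  also have "pencil K' r (cnj s) (K' z) = K' (pencil K' r (cnj s) z)"
    by (simp add: pencil_apply blinfun.add_right clinear_blinfunD[OF K(2)])
  finally have K'z: "K' z = pres K' r (cnj s) y" by (simp add: pres_eqI[OF i] y[symmetric])
  have "cinner (pres K r s x) y = cinner (pencil K r s (pres K r s x)) z"
    unfolding y by (simp add: pencil_apply cinner_add_left cinner_add_right cinner_scaleC_left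
        cinner_scaleC_right is_adjD[OF K(3)] r)
  also have "\<dots> = cinner x (K' z)" by (simp add: pres_apply(1)[OF inv(1) K(1)] is_adjD[OF K(3)])
  finally show ?thesis by (simp add: K'z)
qed

text \<open>Conjugation carries a circle around \<open>w\<close> to one around \<open>cnj w\<close>
  with reversed orientation; the resulting sign cancels against the conjugation of the factor 2 pi
  i.\<close>

lemma rproj_adj:
  fixes K K' :: "'a::complex_hilbert \<Rightarrow>\<^sub>L 'a"
  assumes K: "approximable K" "clinear_blinfun K" and K': "approximable K'" "clinear_blinfun K'"
    and adj: "is_adj K K'" and r: "cnj r = r"
  shows "is_adj (rproj K r w) (rproj K' r (cnj w))"
  unfolding is_adj_def
proof (intro allI)
  fix x y
  obtain e where e: "e > 0" "\<And>s. s \<in> ball w e - {w} \<Longrightarrow> invertible_op (pencil K r s)"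
    "\<And>\<epsilon> \<phi>. 0 < \<epsilon> \<Longrightarrow> \<epsilon> < e \<Longrightarrow> cfunctional \<phi> \<Longrightarrow>
      ((\<lambda>s. \<phi> (pres K r s)) has_contour_integral (2 * of_real pi * \<i> * \<phi> (rproj K r w))) (circlepath w \<epsilon>)"
    using rproj_contour[OF K] by metis
  obtain e' where e': "e' > 0" "\<And>s. s \<in> ball (cnj w) e' - {cnj w} \<Longrightarrow> invertible_op (pencil K' r s)"
    "\<And>\<epsilon> \<phi>. 0 < \<epsilon> \<Longrightarrow> \<epsilon> < e' \<Longrightarrow> cfunctional \<phi> \<Longrightarrow>
      ((\<lambda>s. \<phi> (pres K' r s)) has_contour_integral (2 * of_real pi * \<i> * \<phi> (rproj K' r (cnj w)))) (circlepath (cnj w) \<epsilon>)"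
    using rproj_contour[OF K'] by metis
  define d where "d = min e e' / 2"
  have d: "0 < d" "d < e" "d < e'" using e(1) e'(1) by (auto simp: d_def)
  define f where "f s = cinner y (pres K r s x)" for s
  have 1: "contour_integral (circlepath w d) f = 2 * of_real pi * \<i> * cinner y (rproj K r w x)"
    unfolding f_def by (rule contour_integral_unique[OF e(3)[OF d(1,2) cfunctional_cinner']])
  have 2: "contour_integral (circlepath (cnj w) d) (cnj \<circ> f \<circ> cnj) = 2 * of_real pi * \<i> * cinner x (rproj K' r (cnj w) y)"
  proof (rule contour_integral_unique, rule has_contour_integral_eq[OF e'(3)[OF d(1,3) cfunctional_cinner']])
    fix s assume "s \<in> path_image (circlepath (cnj w) d)"
    then have ds: "dist (cnj w) s = d" using d by simp
    then have "dist w (cnj s) = d" by (metis complex_cnj_cnj complex_cnj_diff complex_mod_cnj dist_norm)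
    moreover have "s \<noteq> cnj w" "cnj s \<noteq> w" using ds d(1) by auto
    ultimately have "invertible_op (pencil K r (cnj s))" "invertible_op (pencil K' r s)"
      using e(2)[of "cnj s"] e'(2)[of s] ds d by auto
    then have "cinner (pres K r (cnj s) x) y = cinner x (pres K' r s y)"
      using pres_adj[OF K(2) K'(2) adj r, of "cnj s"] by simp
    then show "cinner x (pres K' r s y) = (cnj \<circ> f \<circ> cnj) s"
      by (simp add: f_def cinner_commute[of y, symmetric]) (metis cinner_commute)
  qed
  have rev: "cnj \<circ> circlepath (cnj w) d = reversepath (circlepath w d)"
  proof
    fix t
    have "exp (2 * of_real pi * \<i> * of_real (1 - t)) = exp (2 * of_real pi * \<i> + (- (2 * of_real pi * \<i> * of_real t)))"
      by (simp add: algebra_simps)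
    also have "\<dots> = exp (- (2 * of_real pi * \<i> * of_real t))" unfolding exp_add by simp
    finally show "(cnj \<circ> circlepath (cnj w) d) t = reversepath (circlepath w d) t"
      by (simp add: circlepath reversepath_def exp_cnj)
  qed
  have "contour_integral (reversepath (circlepath w d)) f = cnj (2 * of_real pi * \<i> * cinner x (rproj K' r (cnj w) y))"
    unfolding rev[symmetric] 2[symmetric] by (rule contour_integral_cnj) simp
  moreover have "contour_integral (reversepath (circlepath w d)) f = - (2 * of_real pi * \<i> * cinner y (rproj K r w x))"
    by (simp add: contour_integral_reversepath 1)
  ultimately have "cinner y (rproj K r w x) = cnj (cinner x (rproj K' r (cnj w) y))" by simp
  then show "cinner (rproj K r w x) y = cinner x (rproj K' r (cnj w) y)"
    by (metis cinner_commute complex_cnj_cnj)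
qed

text \<open>\<open>Q\<close> annihilates the orthogonal complement of the range of \<open>P\<close>,
  so its range is the image of the finite-dimensional range of \<open>P\<close>.\<close>

lemma crank_adj_le:
  assumes adj: "is_adj P Q" and lin: "clinear_blinfun P" "clinear_blinfun Q"
    and fin: "finite_dim (range (blinfun_apply P))"
  shows "crank Q \<le> crank P" "finite_dim (range (blinfun_apply Q))"
proof -
  obtain B where B: "finite B" "B \<subseteq> range P" "range P \<subseteq> complex_vector.span B" "card B = cdim (range P)"
    using finite_dim_basis[OF fin] by metis
  interpret Q: Vector_Spaces.linear scaleC scaleC "blinfun_apply Q" by (rule clinear_linear[OF lin(2)])
  have "Q y \<in> complex_vector.span (Q ` B)" for y
  proof -
    obtain w where w: "w \<in> range P" "\<And>u. u \<in> range P \<Longrightarrow> cinner u (y - w) = 0"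
      using cinner.orthogonal_decomposition[OF fin subspace_range[OF lin(1)] cinner_positive_on, where x = y] by metis
    have "Q (y - w) = 0"
    proof (rule cinner_eqI)
      fix u show "cinner u (Q (y - w)) = cinner u 0"
        using w(2)[of "P u"] by (simp add: is_adjD[OF adj])
    qed
    then have "Q y = Q w" by (simp add: blinfun.diff_right)
    then show ?thesis using w(1) B(3) by (simp add: Q.span_image image_subset_iff subset_iff)
  qed
  then have sub: "range Q \<subseteq> complex_vector.span (Q ` B)" by auto
  show "finite_dim (range Q)" unfolding finite_dim_def using sub B(1) by blast
  have "cdim (range Q) \<le> card (Q ` B)" using sub B(1) by (intro complex_vector.dim_le_card) auto
  also have "\<dots> \<le> card B" by (rule card_image_le[OF B(1)])
  finally show "crank Q \<le> crank P" by (simp add: crank_def B(4))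
qed

text \<open>\<open>L\<close> maps one residue range into the other and is injective there: a zero of
  \<open>L\<close> is a zero of \<open>K\<close>, and \<open>K\<close> is injective on root
  spaces.\<close>

lemma crank_rproj_intertwine_le:
  fixes K K' :: "'a::complex_hilbert \<Rightarrow>\<^sub>L 'a"
  assumes K: "approximable K" "clinear_blinfun K" and K': "approximable K'" "clinear_blinfun K'"
    and L: "clinear_blinfun L" "\<And>x. L (K x) = K' (L x)" "\<And>x. L x = 0 \<Longrightarrow> K x = 0"
  shows "crank (rproj K r w) \<le> crank (rproj K' r w)"
  unfolding crank_def
proof (rule linear_inj_cdim_le(2)[OF clinear_linear[OF L(1)] subspace_range[OF clinear_rproj[OF K]]])
  show "finite_dim (range (rproj K' r w))" by (rule finite_dim_rproj[OF K'])
  show "L ` range (rproj K r w) \<subseteq> range (rproj K' r w)"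
    using rproj_intertwine[OF K K' L(1,2)] by auto
  fix x assume "x \<in> range (rproj K r w)" "L x = 0"
  then show "x = 0" using rproj_kernel[OF K] L(3) by auto
qed

text \<open>Two exchanges that preserve rank: T J and J T are intertwined by \<open>J\<close> in one
  direction and by \<open>T\<close> in the other, and the adjoint of J T is S J.\<close>

lemma crank_rproj_cnj:
  fixes S T J :: "'a::complex_hilbert \<Rightarrow>\<^sub>L 'a"
  assumes T: "approximable T" "clinear_blinfun T" and S: "approximable S" "clinear_blinfun S"
    and adj: "is_adj T S" and J: "clinear_blinfun J" "is_adj J J" and r: "cnj r = r"
  shows "crank (rproj (S o\<^sub>L J) r (cnj w)) = crank (rproj (T o\<^sub>L J) r w)"
proof -
  have TJ: "approximable (T o\<^sub>L J)" "clinear_blinfun (T o\<^sub>L J)"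
    and JT: "approximable (J o\<^sub>L T)" "clinear_blinfun (J o\<^sub>L T)"
    and SJ: "approximable (S o\<^sub>L J)" "clinear_blinfun (S o\<^sub>L J)"
    using T S J(1) approximable_compose by auto
  have "crank (rproj (T o\<^sub>L J) r w) = crank (rproj (J o\<^sub>L T) r w)"
    by (intro antisym crank_rproj_intertwine_le[OF TJ JT J(1)] crank_rproj_intertwine_le[OF JT TJ T(2)]) auto
  also have "\<dots> = crank (rproj (S o\<^sub>L J) r (cnj w))"
  proof -
    have a: "is_adj (rproj (J o\<^sub>L T) r w) (rproj (S o\<^sub>L J) r (cnj w))"
      by (rule rproj_adj[OF JT SJ is_adj_compose[OF J(2) adj] r])
    show ?thesis
      by (intro antisym crank_adj_le(1)[OF a] crank_adj_le(1)[OF is_adj_sym[OF a]]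
          clinear_rproj[OF JT] clinear_rproj[OF SJ] finite_dim_rproj[OF JT] finite_dim_rproj[OF SJ])
  qed
  finally show ?thesis by simp
qed

section \<open>Spectral decomposition of self-adjoint operators of finite rank\<close>

text \<open>Horner evaluation of p(S) at the vector \<open>x\<close>.\<close>

definition poly_op :: "('a::complex_normed_vector \<Rightarrow>\<^sub>L 'a) \<Rightarrow> complex poly \<Rightarrow> 'a \<Rightarrow> 'a" where
  "poly_op S p x = fold_coeffs (\<lambda>a v. a *\<^sub>C x + S v) p 0"

lemma poly_op_0 [simp]: "poly_op S 0 x = 0"
  by (simp add: poly_op_def)

lemma poly_op_pCons [simp]: "poly_op S (pCons a p) x = a *\<^sub>C x + S (poly_op S p x)"
  by (cases "a = 0 \<and> p = 0") (auto simp: poly_op_def)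

lemma poly_op_add: "poly_op S (p + q) x = poly_op S p x + poly_op S q x"
  by (induction p q rule: poly_induct2) (simp_all add: scaleC_left_distrib blinfun.add_right)

lemma poly_op_smult: "clinear_blinfun S \<Longrightarrow> poly_op S (smult c p) x = c *\<^sub>C poly_op S p x"
  by (induction p) (simp_all add: scaleC_right_distrib scaleC_scaleC clinear_blinfunD)

lemma poly_op_monom: "clinear_blinfun S \<Longrightarrow> poly_op S (monom c n) x = c *\<^sub>C opow S n x"
  by (induction n) (simp_all add: monom_0 monom_Suc clinear_blinfunD)

lemma poly_op_sum: "poly_op S (\<Sum>i\<in>I. f i) x = (\<Sum>i\<in>I. poly_op S (f i) x)"
  by (induction I rule: infinite_finite_induct) (simp_all add: poly_op_add)

text \<open>Split off a root \<open>\<kappa>\<close> of \<open>p\<close>: either the cofactor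
  \<open>q\<close> annihilates \<open>x\<close> as well and has smaller degree, or q(S) x is an
  eigenvector.\<close>

lemma poly_op_zero_imp_eigenvector:
  assumes S: "clinear_blinfun S" and p: "p \<noteq> 0" and x: "x \<noteq> 0" "poly_op S p x = 0"
  shows "\<exists>\<kappa> q. poly_op S q x \<noteq> 0 \<and> S (poly_op S q x) = \<kappa> *\<^sub>C poly_op S q x"
  using p x(2)
proof (induction "degree p" arbitrary: p rule: less_induct)
  case less
  show ?case
  proof (cases "degree p = 0")
    case True
    then obtain c where "p = [:c:]" by (rule degree_eq_zeroE)
    then show ?thesis using less.prems x(1) by simp
  next
    case False
    then have "\<exists>i\<in>{1..degree p}. coeff p i \<noteq> 0"
      by (intro bexI[of _ "degree p"]) auto
    then obtain \<kappa> where "(\<Sum>i\<le>degree p. coeff p i * \<kappa> ^ i) = 0"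
      using fundamental_theorem_of_algebra[of "coeff p" "degree p"] by blast
    then have "poly p \<kappa> = 0" by (simp add: poly_altdef)
    then obtain q where q: "p = [:- \<kappa>, 1:] * q" by (metis poly_eq_0_iff_dvd dvdE)
    have q0: "q \<noteq> 0" using less.prems(1) unfolding q by auto
    moreover have "degree q < degree p" unfolding q using q0 by (subst degree_mult_eq) simp_all
    moreover have "S (poly_op S q x) = \<kappa> *\<^sub>C poly_op S q x"
    proof -
      have "p = smult (- \<kappa>) q + pCons 0 q" by (simp add: q)
      then have "poly_op S p x = - (\<kappa> *\<^sub>C poly_op S q x) + S (poly_op S q x)"
        by (simp only: poly_op_add poly_op_smult[OF S] poly_op_pCons) simp
      then show ?thesis using less.prems(2) by (simp add: neg_eq_iff_add_eq_0[symmetric] add.commute)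
    qed
    ultimately show ?thesis using less.hyps[of q] by blast
  qed
qed

lemma eigenvector_exists:
  assumes S: "clinear_blinfun S" and fin: "finite_dim (range (blinfun_apply S))" and x: "x \<noteq> 0"
  shows "\<exists>\<kappa> q. poly_op S q x \<noteq> 0 \<and> S (poly_op S q x) = \<kappa> *\<^sub>C poly_op S q x"
proof -
  obtain B where B: "finite B" "range S \<subseteq> complex_vector.span B" using fin unfolding finite_dim_def by blast
  \<comment> \<open>Starting with exponent 1 keeps all iterates in the range of \<open>S\<close>,
    hence in the span of \<open>B\<close>; there is one more of them than independence
    permits.\<close>
  define I where "I = {1..card B + 1}"
  define f where "f i = opow S i x" for i
  have fB: "f ` I \<subseteq> complex_vector.span B"
  proof
    fix y assume "y \<in> f ` I"
    then obtain i where i: "i \<in> I" "y = f i" by auto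
    then obtain k where "i = Suc k" by (cases i) (auto simp: I_def)
    then have "y \<in> range S" using i(2) by (simp add: f_def)
    then show "y \<in> complex_vector.span B" using B(2) by blast
  qed
  have finI: "finite I" by (simp add: I_def)
  have "\<exists>c. (\<exists>i\<in>I. c i \<noteq> 0) \<and> (\<Sum>i\<in>I. c i *\<^sub>C f i) = 0"
  proof (cases "inj_on f I")
    case False
    then obtain i j where ij: "i \<in> I" "j \<in> I" "i \<noteq> j" "f i = f j" unfolding inj_on_def by blast
    \<comment> \<open>Repeated iterates collapse in the image set, so the relation between them is
      written down directly.\<close>
    define c where "c k = (if k = i then 1 else if k = j then - 1 else (0::complex))" for k
    have "(\<Sum>k\<in>I. c k *\<^sub>C f k) = (\<Sum>k\<in>{i, j}. c k *\<^sub>C f k)"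
      by (rule sum.mono_neutral_right[OF finI]) (use ij in \<open>auto simp: c_def\<close>)
    also have "\<dots> = 0" using ij by (simp add: c_def)
    finally show ?thesis using ij(1) by (intro exI[of _ c]) (auto simp: c_def)
  next
    case True
    have "complex_vector.dependent (f ` I)"
    proof (rule ccontr)
      assume "\<not> complex_vector.dependent (f ` I)"
      from complex_vector.independent_span_bound[OF B(1) this fB]
      have "card (f ` I) \<le> card B" by simp
      then show False using card_image[OF True] by (simp add: I_def)
    qed
    then obtain u v where u: "(\<Sum>w\<in>f ` I. u w *\<^sub>C w) = 0" "v \<in> f ` I" "u v \<noteq> 0"
      using complex_vector.dependent_finite[of "f ` I"] finI by blast
    then have "(\<Sum>i\<in>I. u (f i) *\<^sub>C f i) = 0" by (simp add: sum.reindex[OF True])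
    then show ?thesis using u(2,3) by (intro exI[of _ "\<lambda>i. u (f i)"]) auto
  qed
  then obtain c i where c: "i \<in> I" "c i \<noteq> 0" "(\<Sum>i\<in>I. c i *\<^sub>C f i) = 0" by blast
  define p where "p = (\<Sum>i\<in>I. monom (c i) i)"
  have "coeff p i = c i" using c(1) finI by (simp add: p_def coeff_sum coeff_monom)
  then have "p \<noteq> 0" using c(2) by auto
  moreover have "poly_op S p x = 0" using c(3) by (simp add: p_def poly_op_sum poly_op_monom[OF S] f_def)
  ultimately show ?thesis using poly_op_zero_imp_eigenvector[OF S _ x] by blast
qed

lemma selfadjointD:
  assumes "selfadjoint_blinfun S"
  shows "clinear_blinfun S" "cinner (S x) y = cinner x (S y)"
  using assms by (auto simp: selfadjoint_blinfun_def)

lemma selfadjoint_arith: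
  "selfadjoint_blinfun S \<Longrightarrow> selfadjoint_blinfun T \<Longrightarrow> selfadjoint_blinfun (S + T)"
  "selfadjoint_blinfun S \<Longrightarrow> selfadjoint_blinfun T \<Longrightarrow> selfadjoint_blinfun (S - T)"
  "selfadjoint_blinfun S \<Longrightarrow> selfadjoint_blinfun (- S)"
  "selfadjoint_blinfun S \<Longrightarrow> selfadjoint_blinfun (of_real a *\<^sub>C S)"
  unfolding selfadjoint_blinfun_def
  by (simp_all add: blinfun.add_left blinfun.diff_left blinfun.minus_left cinner_add_left cinner_add_right
      cinner_diff_left cinner_diff_right cinner_scaleC_left cinner_scaleC_right)

lemma selfadjoint_rank_one: "selfadjoint_blinfun (rank_one e e)"
  unfolding selfadjoint_blinfun_def
proof (intro conjI allI)
  fix x y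
  show "cinner (rank_one e e x) y = cinner x (rank_one e e y)"
    by (simp add: cinner_scaleC_left cinner_scaleC_right cinner_commute[of x e, symmetric])
qed simp

lemma selfadjoint_eigenvalue_real:
  assumes S: "selfadjoint_blinfun S" and e: "S e = \<kappa> *\<^sub>C e" "e \<noteq> 0"
  shows "\<kappa> = of_real (Re \<kappa>)"
proof -
  have "cinner (S e) e = cinner e (S e)" by (rule selfadjointD(2)[OF S])
  then have "cnj \<kappa> * cinner e e = \<kappa> * cinner e e"
    unfolding e(1) by (simp only: cinner_scaleC_left cinner_scaleC_right)
  then have "cnj \<kappa> = \<kappa>" using e(2) by (simp add: cinner_self)
  then show ?thesis by (simp add: complex_eq_iff)
qed

lemma selfadjoint_eigenvector:
  assumes S: "selfadjoint_blinfun S" and fin: "finite_dim (range (blinfun_apply S))" and nz: "S \<noteq> 0"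
  obtains \<mu> :: real and e where "\<mu> \<noteq> 0" "norm e = 1" "S e = of_real \<mu> *\<^sub>C e"
proof -
  note lin = selfadjointD(1)[OF S]
  obtain y where "S y \<noteq> 0" using nz by (metis blinfun_eqI zero_blinfun.rep_eq)
  \<comment> \<open>Starting inside the range keeps the eigenvector in the range, where a
    self-adjoint operator has no null vector except 0; so the eigenvalue found is not 0.\<close>
  define x where "x = S y"
  have x: "x \<noteq> 0" using \<open>S y \<noteq> 0\<close> by (simp add: x_def)
  obtain \<kappa> q where v: "poly_op S q x \<noteq> 0" "S (poly_op S q x) = \<kappa> *\<^sub>C poly_op S q x"
    using eigenvector_exists[OF lin fin x] by blast
  define v where "v = poly_op S q x"
  have "v \<in> range S"
    unfolding v_def
  proof (induction q)
    case 0
    show ?case by (rule range_eqI[of _ _ 0]) simp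
  next
    case (pCons a q)
    then obtain z where "poly_op S q x = S z" by auto
    then show ?case
      by (intro range_eqI[of _ _ "a *\<^sub>C y + S z"]) (simp add: x_def blinfun.add_right clinear_blinfunD[OF lin])
  qed
  then obtain z where z: "v = S z" by auto
  have "\<kappa> \<noteq> 0"
  proof
    assume "\<kappa> = 0"
    then have "S v = 0" using v(2) by (simp add: v_def)
    have "cinner v v = cinner z (S v)" unfolding z using selfadjointD(2)[OF S] by metis
    also have "\<dots> = 0" by (simp add: \<open>S v = 0\<close>)
    finally show False using v(1) by (simp add: v_def cinner_self)
  qed
  moreover have "\<kappa> = of_real (Re \<kappa>)" by (rule selfadjoint_eigenvalue_real[OF S v(2,1)])
  ultimately have "Re \<kappa> \<noteq> 0" by (metis of_real_0)
  moreover define e where "e = complex_of_real (1 / norm v) *\<^sub>C v"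
  have "norm e = 1" using v(1) by (simp add: e_def v_def norm_scaleC norm_divide)
  moreover have "S e = of_real (Re \<kappa>) *\<^sub>C e"
    using v(2) \<open>\<kappa> = of_real (Re \<kappa>)\<close>
    by (simp add: e_def v_def clinear_blinfunD[OF lin] scaleC_scaleC mult.commute)
  ultimately show ?thesis using that by blast
qed

definition jordan_decomposition :: "('a::complex_inner \<Rightarrow>\<^sub>L 'a) \<Rightarrow> ('a \<Rightarrow>\<^sub>L 'a) \<Rightarrow> ('a \<Rightarrow>\<^sub>L 'a) \<Rightarrow> bool" where
  "jordan_decomposition S P N \<longleftrightarrow>
     positive_blinfun P \<and> positive_blinfun N \<and> S = P - N \<and> P o\<^sub>L N = 0"

text \<open>\<open>P\<close> is bounded below by \<open>c\<close> as a form on its own range; for a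
  positive \<open>P\<close> of finite rank, \<open>c\<close> is a lower bound of the non-zero
  eigenvalues. It is the margin by which signs survive a small perturbation.\<close>

definition spectral_gap :: "real \<Rightarrow> ('a::complex_inner \<Rightarrow>\<^sub>L 'a) \<Rightarrow> bool" where
  "spectral_gap c P \<longleftrightarrow> (\<forall>x. c * (norm (P x))\<^sup>2 \<le> Re (cinner (P x) (P (P x))))"

lemma positiveD:
  assumes "positive_blinfun P"
  shows "selfadjoint_blinfun P" "clinear_blinfun P" "cinner (P x) y = cinner x (P y)" "0 \<le> Re (cinner x (P x))"
  using assms by (auto simp: positive_blinfun_def selfadjoint_blinfun_def)

lemma jordan_decomposition_swap:
  assumes "jordan_decomposition S P N" shows "jordan_decomposition (- S) N P"
proof -
  have P: "positive_blinfun P" "positive_blinfun N" "P o\<^sub>L N = 0" "S = P - N"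
    using assms by (auto simp: jordan_decomposition_def)
  have "N o\<^sub>L P = 0"
  proof (intro blinfun_eqI cinner_eqI)
    fix x u
    have "cinner u ((N o\<^sub>L P) x) = cinner ((P o\<^sub>L N) u) x"
      by (simp add: positiveD(3)[OF P(1)] positiveD(3)[OF P(2)])
    then show "cinner u ((N o\<^sub>L P) x) = cinner u ((0::'a \<Rightarrow>\<^sub>L 'a) x)" by (simp add: P(3))
  qed
  then show ?thesis using P by (simp add: jordan_decomposition_def)
qed

lemma jordan_apply:
  assumes "jordan_decomposition S P N"
  shows "S x = P x - N x" "P (N x) = 0" "N (P x) = 0"
proof -
  have "S = P - N" "P o\<^sub>L N = 0" "N o\<^sub>L P = 0"
    using assms jordan_decomposition_swap[OF assms] unfolding jordan_decomposition_def by auto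
  then show "S x = P x - N x" "P (N x) = 0" "N (P x) = 0"
    by (simp_all add: blinfun.diff_left flip: blinfun_apply_blinfun_compose)
qed

text \<open>N S = - N N, so the square of the norm of \<open>N e\<close> equals
  \<open>- \<mu>\<close> times a non-negative number. As this holds in every decomposition, it is
  the source of uniqueness.\<close>

lemma jordan_positive_eigenvector:
  assumes J: "jordan_decomposition S P N" and \<mu>: "0 \<le> \<mu>" "S e = of_real \<mu> *\<^sub>C e"
  shows "P e = of_real \<mu> *\<^sub>C e" "N e = 0"
proof -
  have P: "positive_blinfun P" "positive_blinfun N" using J by (auto simp: jordan_decomposition_def)
  have "N (S e) = - N (N e)" using jordan_apply[OF J] by (simp add: blinfun.diff_right)
  then have "- N (N e) = of_real \<mu> *\<^sub>C N e" unfolding \<mu>(2) by (simp add: clinear_blinfunD[OF positiveD(2)[OF P(2)]])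
  then have NN: "N (N e) = - (of_real \<mu> *\<^sub>C N e)" by (metis minus_minus)
  have "(norm (N e))\<^sup>2 = Re (cinner (N e) (N e))" by (simp add: cinner_self)
  also have "cinner (N e) (N e) = cinner e (N (N e))" by (rule positiveD(3)[OF P(2)])
  also have "\<dots> = - (of_real \<mu> * cinner e (N e))" by (simp add: NN cinner_scaleC_right)
  finally have "(norm (N e))\<^sup>2 = - (\<mu> * Re (cinner e (N e)))" by simp
  moreover have "0 \<le> \<mu> * Re (cinner e (N e))" using \<mu>(1) positiveD(4)[OF P(2)] by simp
  ultimately have "(norm (N e))\<^sup>2 \<le> 0" by simp
  then show N: "N e = 0" by simp
  show "P e = of_real \<mu> *\<^sub>C e" using jordan_apply(1)[OF J, of e] \<mu>(2) N by simp
qed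

text \<open>Uniqueness is included because \<open>pos_part\<close> and \<open>neg_part\<close> are
  definite descriptions, and it has to travel through the induction together with existence.\<close>

definition spectral :: "('a::complex_inner \<Rightarrow>\<^sub>L 'a) \<Rightarrow> bool" where
  "spectral S \<longleftrightarrow> (\<exists>P N c. 0 < c \<and> jordan_decomposition S P N \<and> spectral_gap c P \<and> spectral_gap c N \<and>
      (\<forall>P' N'. jordan_decomposition S P' N' \<longrightarrow> P' = P \<and> N' = N))"

lemma spectral_uminus:
  assumes "spectral S" shows "spectral (- S)"
proof -
  obtain P N c where *: "0 < c" "jordan_decomposition S P N" "spectral_gap c P" "spectral_gap c N"
      "\<And>P' N'. jordan_decomposition S P' N' \<Longrightarrow> P' = P \<and> N' = N"
    using assms unfolding spectral_def by blast
  have "P' = N \<and> N' = P" if "jordan_decomposition (- S) P' N'" for P' N'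
    using *(5)[of N' P'] jordan_decomposition_swap[OF that] by simp
  then show ?thesis unfolding spectral_def using * jordan_decomposition_swap[OF *(2)] by blast
qed

lemma spectral_0: "spectral (0 :: 'a::complex_inner \<Rightarrow>\<^sub>L 'a)"
proof -
  have pos: "positive_blinfun (0 :: 'a \<Rightarrow>\<^sub>L 'a)"
    by (simp add: positive_blinfun_def selfadjoint_blinfun_def)
  have "P = 0 \<and> N = 0" if J: "jordan_decomposition (0 :: 'a \<Rightarrow>\<^sub>L 'a) P N" for P N
  proof -
    have "P x = 0 \<and> N x = 0" for x
      using jordan_positive_eigenvector[OF J, of 0 x] by simp
    then show ?thesis by (simp add: blinfun_eqI)
  qed
  moreover have "jordan_decomposition (0 :: 'a \<Rightarrow>\<^sub>L 'a) 0 0"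
    using pos by (simp add: jordan_decomposition_def compose_simps)
  moreover have "spectral_gap 1 (0 :: 'a \<Rightarrow>\<^sub>L 'a)" by (simp add: spectral_gap_def)
  ultimately show ?thesis
    unfolding spectral_def using zero_less_one by blast
qed

text \<open>Deflation by an eigenvector with positive eigenvalue. Every decomposition of
  \<open>S\<close> puts \<open>e\<close> entirely into its positive part, and subtracting
  \<open>E\<close> there gives a decomposition of \<open>S - E\<close>; this is how uniqueness is
  inherited.\<close>

lemma spectral_add_eigenvector:
  fixes S :: "'a::complex_inner \<Rightarrow>\<^sub>L 'a"
  assumes S: "selfadjoint_blinfun S" and \<mu>: "0 < \<mu>" "S e = of_real \<mu> *\<^sub>C e" "norm e = 1"
    and sp: "spectral (S - of_real \<mu> *\<^sub>C rank_one e e)"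
  shows "spectral S"
proof -
  define E where "E = of_real \<mu> *\<^sub>C rank_one e e"
  have Ex: "E x = (of_real \<mu> * cinner e x) *\<^sub>C e" for x by (simp add: E_def scaleC_scaleC)
  have ee: "cinner e e = 1" using \<mu>(3) by (simp add: cinner_self)
  have saE: "selfadjoint_blinfun E" unfolding E_def by (intro selfadjoint_arith selfadjoint_rank_one)
  obtain P N c where *: "0 < c" "jordan_decomposition (S - E) P N" "spectral_gap c P" "spectral_gap c N"
      "\<And>P' N'. jordan_decomposition (S - E) P' N' \<Longrightarrow> P' = P \<and> N' = N"
    using sp unfolding spectral_def E_def by blast
  have pos: "positive_blinfun P" "positive_blinfun N" using *(2) by (auto simp: jordan_decomposition_def)
  have "(S - E) e = of_real 0 *\<^sub>C e" by (simp add: blinfun.diff_left \<mu>(2) Ex ee)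
  from jordan_positive_eigenvector[OF *(2) order.refl this]
  have Pe: "P e = 0" "N e = 0" by simp_all
  have eP: "cinner e (P x) = 0" "cinner e (N x) = 0" "cinner (P x) e = 0" for x
    using positiveD(3)[OF pos(1), of e x] positiveD(3)[OF pos(2), of e x] positiveD(3)[OF pos(1), of x e] Pe
    by simp_all
  define Q where "Q = P + E"
  have Qx: "Q x = P x + (of_real \<mu> * cinner e x) *\<^sub>C e" for x by (simp add: Q_def blinfun.add_left Ex)
  have quad: "Re (cinner x (E x)) = \<mu> * (cmod (cinner e x))\<^sup>2" for x
  proof -
    have "cinner x (E x) = of_real \<mu> * (cinner e x * cnj (cinner e x))"
      by (simp add: Ex cinner_scaleC_right cinner_commute[of x e])
    then show ?thesis by (simp add: complex_norm_square[symmetric] del: of_real_power)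
  qed
  have "positive_blinfun Q"
    using pos(1) saE \<mu>(1) unfolding positive_blinfun_def Q_def
    by (auto intro!: selfadjoint_arith add_nonneg_nonneg simp: blinfun.add_left cinner_add_right quad)
  moreover have "S = Q - N" using *(2) by (simp add: jordan_decomposition_def Q_def algebra_simps)
  moreover have "Q o\<^sub>L N = 0"
    by (rule blinfun_eqI) (simp add: Qx jordan_apply[OF *(2)] eP)
  ultimately have J: "jordan_decomposition S Q N" using pos by (simp add: jordan_decomposition_def)
  have gap: "spectral_gap (min c \<mu>) Q"
    unfolding spectral_gap_def
  proof
    fix x
    define a where "a = of_real \<mu> * cinner e x"
    have QQ: "Q (Q x) = P (P x) + (of_real \<mu> * a) *\<^sub>C e"
    proof -
      have "P (Q x) = P (P x)"
        unfolding Qx by (simp add: blinfun.add_right clinear_blinfunD[OF positiveD(2)[OF pos(1)]] Pe)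
      moreover have "cinner e (Q x) = a"
        unfolding Qx by (simp add: a_def cinner_add_right eP cinner_scaleC_right ee)
      ultimately show ?thesis by (subst Qx) simp
    qed
    have ca: "cnj a * a = of_real ((cmod a)\<^sup>2)" by (metis complex_norm_square mult.commute)
    have "complex_of_real ((norm (Q x))\<^sup>2) = cinner (P x) (P x) + cnj a * a"
      unfolding cinner_self[symmetric] Qx a_def[symmetric]
      by (simp add: cinner_add_left cinner_add_right cinner_scaleC_left cinner_scaleC_right eP ee)
    also have "\<dots> = of_real ((norm (P x))\<^sup>2 + (cmod a)\<^sup>2)"
      unfolding ca cinner_self of_real_add ..
    finally have 1: "(norm (Q x))\<^sup>2 = (norm (P x))\<^sup>2 + (cmod a)\<^sup>2" by (simp only: of_real_eq_iff)
    have "cinner (Q x) (Q (Q x)) = cinner (P x) (P (P x)) + of_real \<mu> * (cnj a * a)"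
      unfolding QQ unfolding Qx[of x] a_def[symmetric]
      by (simp add: cinner_add_left cinner_add_right cinner_scaleC_left cinner_scaleC_right eP ee)
    also note ca
    finally have 2: "Re (cinner (Q x) (Q (Q x))) = Re (cinner (P x) (P (P x))) + \<mu> * (cmod a)\<^sup>2"
      by (simp only: plus_complex.sel of_real_mult[symmetric] Re_complex_of_real)
    have "min c \<mu> * (norm (Q x))\<^sup>2 = min c \<mu> * (norm (P x))\<^sup>2 + min c \<mu> * (cmod a)\<^sup>2"
      unfolding 1 by (simp add: distrib_left)
    also have "\<dots> \<le> c * (norm (P x))\<^sup>2 + \<mu> * (cmod a)\<^sup>2"
      by (intro add_mono mult_right_mono) auto
    also have "\<dots> \<le> Re (cinner (Q x) (Q (Q x)))"
      using *(3) unfolding 2 spectral_gap_def by simp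
    finally show "min c \<mu> * (norm (Q x))\<^sup>2 \<le> Re (cinner (Q x) (Q (Q x)))" .
  qed
  have gapN: "spectral_gap (min c \<mu>) N"
    unfolding spectral_gap_def
  proof
    fix x
    have "min c \<mu> * (norm (N x))\<^sup>2 \<le> c * (norm (N x))\<^sup>2" by (intro mult_right_mono) auto
    then show "min c \<mu> * (norm (N x))\<^sup>2 \<le> Re (cinner (N x) (N (N x)))"
      using *(4) unfolding spectral_gap_def by (meson order.trans)
  qed
  have "Q' = Q \<and> N' = N" if J': "jordan_decomposition S Q' N'" for Q' N'
  proof -
    have pos': "positive_blinfun Q'" "positive_blinfun N'" using J' by (auto simp: jordan_decomposition_def)
    have Qe: "Q' e = of_real \<mu> *\<^sub>C e" "N' e = 0"
      using jordan_positive_eigenvector[OF J' _ \<mu>(2)] \<mu>(1) by simp_all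
    have eQ: "cinner e (Q' x) = of_real \<mu> * cinner e x" "cinner e (N' x) = 0" for x
      using positiveD(3)[OF pos'(1), of e x] positiveD(3)[OF pos'(2), of e x] Qe
      by (simp_all add: cinner_scaleC_left)
    have "0 \<le> Re (cinner x ((Q' - E) x))" for x
    proof -
      \<comment> \<open>Testing on the component of \<open>x\<close> orthogonal to \<open>e\<close>
        reduces positivity of \<open>Q' - E\<close> to that of \<open>Q'\<close>.\<close>
      define y where "y = x - cinner e x *\<^sub>C e"
      have "Q' y = (Q' - E) x"
        by (simp add: y_def blinfun.diff_left blinfun.diff_right clinear_blinfunD[OF positiveD(2)[OF pos'(1)]]
            Qe Ex scaleC_scaleC mult.commute)
      moreover have "cinner e ((Q' - E) x) = 0"
        by (simp add: blinfun.diff_left cinner_diff_right eQ Ex cinner_scaleC_right ee)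
      ultimately have "cinner y (Q' y) = cinner x ((Q' - E) x)"
        by (simp add: y_def cinner_diff_left cinner_scaleC_left)
      then show ?thesis using positiveD(4)[OF pos'(1), of y] by simp
    qed
    then have "positive_blinfun (Q' - E)"
      using selfadjoint_arith(2)[OF positiveD(1)[OF pos'(1)] saE] by (simp add: positive_blinfun_def)
    moreover have "S - E = (Q' - E) - N'" using J' by (simp add: jordan_decomposition_def)
    moreover have "(Q' - E) o\<^sub>L N' = 0"
      by (rule blinfun_eqI) (simp add: blinfun.diff_left Ex jordan_apply[OF J'] eQ)
    ultimately have "jordan_decomposition (S - E) (Q' - E) N'" using pos' by (simp add: jordan_decomposition_def)
    from *(5)[OF this] show ?thesis by (simp add: Q_def diff_eq_eq)
  qed
  moreover have "0 < min c \<mu>" using *(1) \<mu>(1) by simp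
  ultimately show ?thesis
    unfolding spectral_def using J gap gapN by blast
qed

text \<open>Induction on the rank: \<open>e\<close> lies in the range of \<open>S\<close> but is
  orthogonal to the range of \<open>S - E\<close>, so deflation lowers the rank. A negative
  eigenvalue is treated by passing to \<open>- S\<close>.\<close>

lemma spectral_finite_rank:
  fixes S :: "'a::complex_inner \<Rightarrow>\<^sub>L 'a"
  assumes "selfadjoint_blinfun S" "finite_dim (range (blinfun_apply S))"
  shows "spectral S"
  using assms
proof (induction "cdim (range (blinfun_apply S))" arbitrary: S rule: less_induct)
  case less
  show ?case
  proof (cases "S = 0")
    case False
    obtain \<mu> :: real and e where e: "\<mu> \<noteq> 0" "norm e = 1" "S e = of_real \<mu> *\<^sub>C e"
      using selfadjoint_eigenvector[OF less.prems False] by metis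
    define E where "E = of_real \<mu> *\<^sub>C rank_one e e"
    note lin = selfadjointD(1)[OF less.prems(1)]
    have sa: "selfadjoint_blinfun (S - E)" unfolding E_def by (intro selfadjoint_arith selfadjoint_rank_one less.prems)
    have ee: "cinner e e = 1" using e(2) by (simp add: cinner_self)
    have ran: "(S - E) x = S (x - cinner e x *\<^sub>C e)" for x
      by (simp add: E_def blinfun.diff_left blinfun.diff_right clinear_blinfunD[OF lin] e(3) scaleC_scaleC mult.commute)
    have orth: "cinner e ((S - E) x) = 0" for x
    proof -
      have "cinner e (S x) = cinner (S e) x" by (simp add: selfadjointD(2)[OF less.prems(1)])
      also have "\<dots> = of_real \<mu> * cinner e x" by (simp add: e(3) cinner_scaleC_left)
      finally show ?thesis by (simp add: E_def blinfun.diff_left cinner_diff_right cinner_scaleC_right ee)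
    qed
    have sub: "range (S - E) \<subseteq> range S" using ran by auto
    have fin: "finite_dim (range (S - E))" by (rule finite_dim_subset[OF less.prems(2) sub])
    have eS: "e \<in> range S"
      by (rule range_eqI[of _ _ "(1 / of_real \<mu>) *\<^sub>C e"]) (simp add: clinear_blinfunD[OF lin] e(3) scaleC_scaleC e(1))
    have "cdim (range (S - E)) < cdim (range S)"
    proof -
      obtain B where B: "finite B" "B \<subseteq> range (S - E)" "complex_vector.independent B" "card B = cdim (range (S - E))"
        using finite_dim_basis[OF fin] by metis
      obtain C where C: "finite C" "range S \<subseteq> complex_vector.span C" "card C = cdim (range S)"
        using finite_dim_basis[OF less.prems(2)] by metis
      have "\<And>y. y \<in> complex_vector.span B \<Longrightarrow> y \<in> range (S - E)"
        using complex_vector.span_minimal[OF B(2) subspace_range[OF selfadjointD(1)[OF sa]]] by blast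
      then have nB: "e \<notin> complex_vector.span B" using orth ee by force
      then have "complex_vector.independent (insert e B)" by (rule complex_vector.independent_insertI[OF _ B(3)])
      moreover have "insert e B \<subseteq> complex_vector.span C" using B(2) sub C(2) eS by blast
      ultimately have "card (insert e B) \<le> card C" using complex_vector.independent_span_bound[OF C(1)] by blast
      moreover have "e \<notin> B" using nB complex_vector.span_base by blast
      ultimately show ?thesis using B(1,4) C(3) by simp
    qed
    from less.hyps[OF this sa fin] have sp: "spectral (S - E)" .
    show ?thesis
    proof (cases "\<mu> > 0")
      case True
      then show ?thesis using spectral_add_eigenvector[OF less.prems(1) True e(3,2)] sp by (simp add: E_def)
    next
      case False
      have "spectral (- (S - E))" by (rule spectral_uminus[OF sp])
      then have "spectral (- S - of_real (- \<mu>) *\<^sub>C rank_one e e)" by (simp add: E_def)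
      then have "spectral (- S)"
        using False e
        by (intro spectral_add_eigenvector[OF selfadjoint_arith(3)[OF less.prems(1)], of "- \<mu>" e])
          (simp_all add: blinfun.minus_left)
      then show ?thesis using spectral_uminus[of "- S"] by simp
    qed
  qed (simp add: spectral_0)
qed

lemma pos_neg_part:
  fixes S :: "'a::complex_inner \<Rightarrow>\<^sub>L 'a"
  assumes "selfadjoint_blinfun S" "finite_dim (range (blinfun_apply S))"
  obtains c where "0 < c" "jordan_decomposition S (pos_part S) (neg_part S)"
    "spectral_gap c (pos_part S)" "spectral_gap c (neg_part S)"
    "pos_part (- S) = neg_part S" "neg_part (- S) = pos_part S"
proof -
  have parts: "pos_part T = P \<and> neg_part T = N"
    if J: "jordan_decomposition T P N" and u: "\<And>P' N'. jordan_decomposition T P' N' \<Longrightarrow> P' = P \<and> N' = N"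
    for T P N :: "'a \<Rightarrow>\<^sub>L 'a"
    unfolding pos_part_def neg_part_def jordan_decomposition_def[symmetric]
  proof (intro conjI the_equality)
    show "\<exists>N. jordan_decomposition T P N" "\<exists>P. jordan_decomposition T P N" using J by blast+
  next
    fix P' assume "\<exists>N. jordan_decomposition T P' N"
    then show "P' = P" using u by blast
  next
    fix N' assume "\<exists>P. jordan_decomposition T P N'"
    then show "N' = N" using u by blast
  qed
  obtain P N c where *: "0 < c" "jordan_decomposition S P N" "spectral_gap c P" "spectral_gap c N"
      "\<And>P' N'. jordan_decomposition S P' N' \<Longrightarrow> P' = P \<and> N' = N"
    using spectral_finite_rank[OF assms] unfolding spectral_def by blast
  have "P' = N \<and> N' = P" if "jordan_decomposition (- S) P' N'" for P' N'
    using *(5)[of N' P'] jordan_decomposition_swap[OF that] by simp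
  then have "pos_part (- S) = N" "neg_part (- S) = P"
    using parts[OF jordan_decomposition_swap[OF *(2)]] by simp_all
  moreover have "pos_part S = P" "neg_part S = N" using parts[OF *(2,5)] by simp_all
  ultimately show ?thesis using that[OF *(1)] *(2-4) by simp
qed

text \<open>On its own range \<open>P\<close> is injective by the gap and coincides with
  \<open>S\<close>, since \<open>N\<close> vanishes there.\<close>

lemma finite_dim_jordan:
  assumes J: "jordan_decomposition S P N" and gap: "spectral_gap c P" "0 < c"
    and fin: "finite_dim (range (blinfun_apply S))"
  shows "finite_dim (range (blinfun_apply P))"
proof -
  have pos: "positive_blinfun P" using J by (simp add: jordan_decomposition_def)
  show ?thesis
  proof (rule linear_inj_cdim_le(1)[OF clinear_linear[OF positiveD(2)[OF pos]] subspace_range[OF positiveD(2)[OF pos]] _ _ fin])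
    fix x assume "x \<in> range P" "P x = 0"
    then obtain y where "x = P y" "P (P y) = 0" by auto
    have "c * (norm (P y))\<^sup>2 \<le> Re (cinner (P y) (P (P y)))" using gap(1) unfolding spectral_gap_def by blast
    then have "c * (norm x)\<^sup>2 \<le> 0" using \<open>x = P y\<close> \<open>P (P y) = 0\<close> by simp
    then show "x = 0" using gap(2) by (simp add: mult_le_0_iff)
  next
    show "P ` range P \<subseteq> range S"
    proof
      fix y assume "y \<in> P ` range P"
      then obtain x where "y = P (P x)" by auto
      then have "y = S (P x)" by (simp add: jordan_apply[OF J])
      then show "y \<in> range S" by simp
    qed
  qed
qed

lemma crank_le_parts:
  fixes S P N :: "'a::complex_inner \<Rightarrow>\<^sub>L 'a"
  assumes S: "\<And>x. S x = P x - N x" and fin: "finite_dim (range (blinfun_apply P))" "finite_dim (range (blinfun_apply N))"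
  shows "crank S \<le> crank P + crank N"
proof -
  obtain B where B: "finite B" "range P \<subseteq> complex_vector.span B" "card B = cdim (range P)"
    using finite_dim_basis[OF fin(1)] by metis
  obtain C where C: "finite C" "range N \<subseteq> complex_vector.span C" "card C = cdim (range N)"
    using finite_dim_basis[OF fin(2)] by metis
  have "S x \<in> complex_vector.span (B \<union> C)" for x
  proof -
    have "P x \<in> complex_vector.span (B \<union> C)" "N x \<in> complex_vector.span (B \<union> C)"
      using B(2) C(2) complex_vector.span_mono[of B "B \<union> C"] complex_vector.span_mono[of C "B \<union> C"] by auto
    then show ?thesis unfolding S by (rule complex_vector.span_diff)
  qed
  then have "cdim (range S) \<le> card (B \<union> C)" using B(1) C(1) by (intro complex_vector.dim_le_card) auto
  also have "\<dots> \<le> card B + card C" by (rule card_Un_le)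
  finally show ?thesis by (simp add: crank_def B(3) C(3))
qed

section \<open>Definite spectral subspaces, stability of projections and the count of poles\<close>

section \<open>Spectral subspaces of dissipative operators are definite\<close>

text \<open>
  Each factor enlarges the subspace; the part of the larger subspace which is orthogonal to the
  smaller one for the form \<open>h\<close> consists of vectors that are eigenvectors modulo the smaller one, and
  on these the sign of \<open>h\<close> can be read off from the dissipativity of \<open>K\<close>.
\<close>

lemma positive_on_pencil_prod:
  fixes \<sigma> :: real and K :: "'b::complex_inner \<Rightarrow>\<^sub>L 'b"
  assumes h: "hermitian_form h" and K: "approximable K" "clinear_blinfun K" and r: "Im r = 0"
    and diss: "\<And>x. K x \<noteq> 0 \<Longrightarrow> 0 < \<sigma> * Im (h x (K x))"
    and ws: "\<And>w. w \<in> set ws \<Longrightarrow> 0 < \<sigma> * Im w"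
  shows "hermitian_form.positive_on h {x. pencil_prod K r ws x = 0}"
  using ws
proof (induction ws)
  case Nil
  show ?case by (simp add: hermitian_form.positive_on_def[OF h])
next
  case (Cons w ws)
  interpret hermitian_form h by (rule h)
  define V where "V = {x. pencil_prod K r ws x = 0}"
  have pos: "positive_on V" unfolding V_def using Cons by auto
  have V: "finite_dim V" "complex_vector.subspace V"
    unfolding V_def using K by (auto intro: finite_dim_pencil_prod subspace_kernel clinear_pencil_prod)
  note lin = clinear_pencil[OF K(2), of r w]
  show ?case
    unfolding positive_on_def
  proof (intro ballI impI)
    fix x assume x: "x \<in> {x. pencil_prod K r (w # ws) x = 0}" "x \<noteq> 0"
    obtain w1 where w1: "w1 \<in> V" "\<And>u. u \<in> V \<Longrightarrow> h u (x - w1) = 0"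
      using orthogonal_decomposition[OF V pos, of x] by metis
    define v where "v = x - w1"
    have "pencil K r w x \<in> V" "pencil K r w w1 \<in> V"
      using x(1) w1(1) by (simp_all add: V_def pencil_prod_commute[OF K(2)])
    then have Xv: "pencil K r w v \<in> V"
      unfolding v_def blinfun.diff_right by (rule complex_vector.subspace_diff[OF V(2)])
    have orth: "h u v = 0" "h v u = 0" if "u \<in> V" for u
      using w1(2)[OF that] commute[of v u] by (simp_all add: v_def)
    have hv: "0 < Re (h v v)" if v0: "v \<noteq> 0"
    proof -
      define a c where "a = Re (h v v)" and "c = h v (K v)"
      \<comment> \<open>On the kernel of \<open>K\<close> the pencil is the identity, so
        \<open>v\<close> would lie in \<open>V\<close> and be orthogonal to itself.\<close>
      have Kv: "K v \<noteq> 0"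
      proof
        assume "K v = 0"
        then have "v \<in> V" using Xv by (simp add: pencil_apply)
        then show False using pos v0 orth(1)[of v] by (auto simp: positive_on_def)
      qed
      have "h v (pencil K r w v) = 0" by (rule orth(2)[OF Xv])
      then have "complex_of_real a + (w - r) * c = 0"
        by (simp add: pencil_apply add_right scale_right a_def c_def flip: self_real)
      \<comment> \<open>Multiplying by \<open>cnj (w - r)\<close> leaves a real coefficient in front
        of \<open>c\<close>. As \<open>r\<close> is real, the imaginary part reads
        \<open>a * Im w = (cmod (w - r))\<^sup>2 * Im c\<close>, which ties the sign of the form at
        \<open>v\<close> to the half-plane of \<open>w\<close>.\<close>
      moreover have "complex_of_real a * cnj (w - r) + of_real ((cmod (w - r))\<^sup>2) * c
          = (complex_of_real a + (w - r) * c) * cnj (w - r)"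
        unfolding complex_norm_square by (simp add: algebra_simps)
      ultimately have "complex_of_real a * cnj (w - r) + of_real ((cmod (w - r))\<^sup>2) * c = 0" by simp
      from arg_cong[OF this, of Im] have eq: "a * Im w = (cmod (w - r))\<^sup>2 * Im c" using r by simp
      have "0 < \<sigma> * Im w" using Cons.prems by simp
      then have "w \<noteq> r" using r by auto
      then have "0 < (cmod (w - r))\<^sup>2 * (\<sigma> * Im c)"
        using diss[OF Kv] by (simp add: c_def)
      also have "\<dots> = a * (\<sigma> * Im w)" using eq by (simp add: mult.left_commute)
      finally show ?thesis using \<open>0 < \<sigma> * Im w\<close> unfolding a_def by (simp add: zero_less_mult_iff)
    qed
    have "h (w1 + v) (w1 + v) = h w1 w1 + h v v"
      by (simp add: add_left add_right orth[OF w1(1)])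
    then have "h x x = h w1 w1 + h v v" by (simp add: v_def)
    moreover have "0 \<le> Re (h w1 w1)" "w1 \<noteq> 0 \<Longrightarrow> 0 < Re (h w1 w1)"
      using pos w1(1) by (cases "w1 = 0"; auto simp: positive_on_def intro: less_imp_le)+
    moreover have "0 \<le> Re (h v v)" using hv by (cases "v = 0") (auto intro: less_imp_le)
    moreover have "w1 \<noteq> 0 \<or> v \<noteq> 0" using x(2) by (auto simp: v_def)
    ultimately show "0 < Re (h x x)" using hv by (auto intro: add_pos_nonneg add_nonneg_pos)
  qed
qed

definition rproj_sum :: "('a::complex_hilbert \<Rightarrow>\<^sub>L 'a) \<Rightarrow> complex \<Rightarrow> complex set \<Rightarrow> 'a \<Rightarrow>\<^sub>L 'a" where
  "rproj_sum K r U = (\<Sum>w\<in>U. rproj K r w)"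

lemma rproj_sum_apply: "rproj_sum K r U x = (\<Sum>w\<in>U. rproj K r w x)"
  by (simp add: rproj_sum_def blinfun.sum_left)

context
  fixes K :: "'a::complex_hilbert \<Rightarrow>\<^sub>L 'a" and r :: complex
  assumes K: "approximable K" "clinear_blinfun K"
begin

text \<open>One list serves all points of \<open>U\<close>: nilpotent powers are concatenated, and
  since the factors commute each residue meets the power that annihilates it.\<close>

lemma rproj_annihilated:
  assumes "finite U"
  shows "\<exists>ws. set ws \<subseteq> U \<and> (\<forall>w\<in>U. \<forall>x. pencil_prod K r ws (rproj K r w x) = 0)"
  using assms
proof (induction U)
  case (insert w U)
  then obtain ws where ws: "set ws \<subseteq> U" "\<And>w x. w \<in> U \<Longrightarrow> pencil_prod K r ws (rproj K r w x) = 0" by blast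
  obtain n where n: "\<And>x. opow (pencil K r w) n (rproj K r w x) = 0"
    using rproj_nilpotent[OF K, of r w] by blast
  show ?case
  proof (intro exI[of _ "replicate n w @ ws"] conjI ballI allI)
    show "set (replicate n w @ ws) \<subseteq> insert w U" using ws(1) by auto
    fix w' x assume "w' \<in> insert w U"
    then show "pencil_prod K r (replicate n w @ ws) (rproj K r w' x) = 0"
      using ws(2)[of w'] n by (intro pencil_prod_append_zero[OF K(2)]) (auto simp: pencil_prod_replicate)
  qed
qed auto

lemma clinear_rproj_sum: "clinear_blinfun (rproj_sum K r U)"
  unfolding rproj_sum_def by (intro clinear_blinfun_sum clinear_rproj[OF K])

lemma rproj_sum_annihilated:
  assumes "finite U"
  shows "\<exists>ws. set ws \<subseteq> U \<and> (\<forall>x. pencil_prod K r ws (rproj_sum K r U x) = 0)"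
proof -
  obtain ws where ws: "set ws \<subseteq> U" "\<And>w x. w \<in> U \<Longrightarrow> pencil_prod K r ws (rproj K r w x) = 0"
    using rproj_annihilated[OF assms] by blast
  then have "pencil_prod K r ws (rproj_sum K r U x) = 0" for x
    by (simp add: rproj_sum_apply blinfun.sum_right)
  then show ?thesis using ws(1) by blast
qed

lemma finite_dim_rproj_sum:
  assumes "finite U" shows "finite_dim (range (blinfun_apply (rproj_sum K r U)))"
proof -
  obtain ws where ws: "\<And>x. pencil_prod K r ws (rproj_sum K r U x) = 0"
    using rproj_sum_annihilated[OF assms] by blast
  then show ?thesis by (intro finite_dim_subset[OF finite_dim_pencil_prod[OF K, of r ws]]) auto
qed

lemma rproj_sum_absorb:
  assumes "finite U" "finite W" shows "rproj_sum K r U (rproj_sum K r W x) = rproj_sum K r (U \<inter> W) x"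
proof -
  have "rproj_sum K r U (rproj_sum K r W x) = (\<Sum>a\<in>U. \<Sum>w\<in>W. if a = w then rproj K r w x else 0)"
    by (simp add: rproj_sum_apply blinfun.sum_right rproj_rproj[OF K]) (rule sum.swap)
  also have "\<dots> = (\<Sum>a\<in>U. if a \<in> W then rproj K r a x else 0)"
    using assms by (intro sum.cong refl) (simp add: sum.delta)
  also have "\<dots> = rproj_sum K r (U \<inter> W) x"
    using assms by (simp add: rproj_sum_apply sum.inter_restrict)
  finally show ?thesis .
qed

lemma rproj_sum_disjoint:
  assumes "finite U" "finite W" "U \<inter> W = {}"
  shows "rproj_sum K r (U \<union> W) x = rproj_sum K r U x + rproj_sum K r W x"
  using assms by (simp add: rproj_sum_apply sum.union_disjoint)

text \<open>Each projection is the identity on its own range and zero on the other, so the union of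
  two bases is independent; the reverse inequality is subadditivity of rank.\<close>

lemma crank_rproj_sum_disjoint:
  assumes U: "finite U" "finite W" "U \<inter> W = {}"
  shows "crank (rproj_sum K r (U \<union> W)) = crank (rproj_sum K r U) + crank (rproj_sum K r W)"
proof -
  let ?P = "rproj_sum K r U" and ?Q = "rproj_sum K r W" and ?E = "rproj_sum K r (U \<union> W)"
  have fin: "finite_dim (range ?P)" "finite_dim (range ?Q)" "finite_dim (range ?E)"
    using U by (simp_all add: finite_dim_rproj_sum)
  obtain B where B: "finite B" "B \<subseteq> range ?P" "complex_vector.independent B" "card B = cdim (range ?P)"
    using finite_dim_basis[OF fin(1)] by metis
  obtain C where C: "finite C" "C \<subseteq> range ?Q" "complex_vector.independent C" "card C = cdim (range ?Q)"
    using finite_dim_basis[OF fin(2)] by metis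
  obtain D where D: "finite D" "range ?E \<subseteq> complex_vector.span D" "card D = cdim (range ?E)"
    using finite_dim_basis[OF fin(3)] by metis
  have PB: "?P b = b" "?Q b = 0" "?E b = b" if b: "b \<in> B" for b
  proof -
    obtain z where z: "b = ?P z" using B(2) b by auto
    have WU: "W \<inter> U = {}" using U(3) by auto
    show "?P b = b" "?Q b = 0" "?E b = b"
      unfolding z rproj_sum_absorb[OF U(1,1)] rproj_sum_absorb[OF U(2,1)] rproj_sum_absorb[OF finite_UnI[OF U(1,2)] U(1)] WU
      by (simp_all add: rproj_sum_apply Int_absorb1 Int_commute)
  qed
  have QC: "?P c = 0" "?Q c = c" "?E c = c" if c: "c \<in> C" for c
  proof -
    obtain z where z: "c = ?Q z" using C(2) c by auto
    show "?P c = 0" "?Q c = c" "?E c = c"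
      unfolding z rproj_sum_absorb[OF U(1,2)] rproj_sum_absorb[OF U(2,2)] rproj_sum_absorb[OF finite_UnI[OF U(1,2)] U(2)] U(3)
      by (simp_all add: rproj_sum_apply Int_absorb1 Int_commute)
  qed
  have disj: "B \<inter> C = {}"
  proof (rule ccontr)
    assume "B \<inter> C \<noteq> {}"
    then obtain b where "b \<in> B" "b \<in> C" by auto
    then have "b = 0" using PB(1)[of b] QC(1)[of b] by simp
    then show False using \<open>b \<in> B\<close> B(3) complex_vector.dependent_zero by blast
  qed
  have "complex_vector.independent (B \<union> C)"
  proof (rule complex_vector.independent_if_scalars_zero)
    fix f x assume sum: "(\<Sum>x\<in>B \<union> C. f x *\<^sub>C x) = 0" and x: "x \<in> B \<union> C"
    have split: "(\<Sum>x\<in>B. f x *\<^sub>C x) + (\<Sum>x\<in>C. f x *\<^sub>C x) = 0"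
      using sum by (simp add: sum.union_disjoint[OF B(1) C(1) disj])
    have P: "?P (\<Sum>x\<in>B. f x *\<^sub>C x) = (\<Sum>x\<in>B. f x *\<^sub>C x)" "?P (\<Sum>x\<in>C. f x *\<^sub>C x) = 0"
      by (simp_all add: blinfun.sum_right clinear_blinfunD[OF clinear_rproj_sum] PB QC cong: sum.cong)
    have Bz: "(\<Sum>x\<in>B. f x *\<^sub>C x) = 0"
      using arg_cong[OF split, of "blinfun_apply ?P"] by (simp add: blinfun.add_right P)
    then have Cz: "(\<Sum>x\<in>C. f x *\<^sub>C x) = 0" using split by simp
    show "f x = 0"
      using x complex_vector.independentD[OF B(3,1) order.refl Bz] complex_vector.independentD[OF C(3,1) order.refl Cz]
      by auto
  qed (use B(1) C(1) in auto)
  moreover have "B \<union> C \<subseteq> complex_vector.span D"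
  proof -
    have "B \<union> C \<subseteq> range ?E" using PB(3) QC(3) by (metis Un_iff rangeI subsetI)
    then show ?thesis using D(2) by blast
  qed
  ultimately have "card (B \<union> C) \<le> card D" using complex_vector.independent_span_bound[OF D(1)] by blast
  then have "cdim (range ?P) + cdim (range ?Q) \<le> cdim (range ?E)"
    using card_Un_disjoint[OF B(1) C(1) disj] B(4) C(4) D(3) by simp
  moreover have "crank ?E \<le> crank ?P + crank (- ?Q)"
  proof (rule crank_le_parts[OF _ fin(1)])
    show "?E x = ?P x - (- ?Q) x" for x by (simp add: rproj_sum_disjoint[OF U] blinfun.minus_left)
    have "range (- ?Q) \<subseteq> range ?Q"
    proof
      fix y assume "y \<in> range (- ?Q)"
      then obtain x where "y = ?Q (- x)" by (auto simp: blinfun.minus_left blinfun.minus_right)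
      then show "y \<in> range ?Q" by simp
    qed
    then show "finite_dim (range (- ?Q))" by (rule finite_dim_subset[OF fin(2)])
  qed
  moreover have "range (- ?Q) = range ?Q"
  proof -
    have 1: "(- ?Q) x = ?Q (- x)" and 2: "?Q x = (- ?Q) (- x)" for x
      by (simp_all add: blinfun.minus_left blinfun.minus_right)
    show ?thesis
    proof (intro equalityI image_subsetI)
      fix x
      show "(- ?Q) x \<in> range ?Q" unfolding 1 by (rule rangeI)
      show "?Q x \<in> range (- ?Q)" by (subst 2) (rule rangeI)
    qed
  qed
  ultimately show ?thesis by (simp add: crank_def)
qed

lemma crank_rproj_sum: "finite U \<Longrightarrow> crank (rproj_sum K r U) = (\<Sum>w\<in>U. crank (rproj K r w))"
proof (induction U rule: finite_induct)
  case empty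
  have "range (rproj_sum K r {}) = {0}" by (auto simp: rproj_sum_def)
  then have "cdim (range (rproj_sum K r {})) \<le> card ({} :: 'a set)"
    by (intro complex_vector.dim_le_card) (auto simp: complex_vector.span_zero)
  then show ?case by (simp add: crank_def)
next
  case (insert w U)
  then have "crank (rproj_sum K r ({w} \<union> U)) = crank (rproj_sum K r {w}) + crank (rproj_sum K r U)"
    by (intro crank_rproj_sum_disjoint) auto
  moreover have "rproj_sum K r {w} = rproj K r w" by (simp add: rproj_sum_def)
  ultimately show ?case using insert by simp
qed

end

section \<open>Stability of the total residue projection\<close>

lemma inverse_pencil_bounded_on_compact:
  fixes K :: "'a::complex_hilbert \<Rightarrow>\<^sub>L 'a"
  assumes K: "clinear_blinfun K" and C: "compact C" "\<And>s. s \<in> C \<Longrightarrow> invertible_op (pencil K r s)"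
  obtains M where "0 < M" "\<And>s. s \<in> C \<Longrightarrow> norm (inv_op (pencil K r s)) \<le> M"
proof -
  have "vholomorphic_on (\<lambda>s. inv_op (pencil K r s)) {s. invertible_op (pencil K r s)}"
    using is_inverse_inv_op by (intro inverse_pencil_holomorphic[OF K _ open_invertible_pencil]) auto
  then have "continuous_on C (\<lambda>s. inv_op (pencil K r s))"
    using C(2) by (intro continuous_on_subset[OF vholomorphic_continuous]) auto
  then have "compact ((\<lambda>s. inv_op (pencil K r s)) ` C)" using C(1) by (rule compact_continuous_image)
  then obtain M where "0 < M" "\<forall>x\<in>(\<lambda>s. inv_op (pencil K r s)) ` C. norm x \<le> M"
    using compact_imp_bounded bounded_pos by blast
  then show ?thesis using that by blast
qed

text \<open>The difference of the two families is exactly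
  \<open>N' o\<^sub>L ((K' - K) o\<^sub>L N)\<close>, and the smallness condition bounds
  \<open>N'\<close> by twice \<open>M\<close>; hence the constant.\<close>

lemma pres_perturb:
  fixes K K' :: "'a::complex_hilbert \<Rightarrow>\<^sub>L 'a"
  assumes K: "clinear_blinfun K" "clinear_blinfun K'" and N: "is_inverse (pencil K r s) N" "norm N \<le> M"
    and small: "cmod (s - r) * norm (K' - K) * M \<le> 1/2" and M: "0 < M"
  shows "invertible_op (pencil K' r s)" "norm (pres K' r s - pres K r s) \<le> 2 * M * M * norm (K' - K)"
proof -
  have E: "pencil K' r s = pencil K r s + (s - r) *\<^sub>C (K' - K)"
    by (simp add: pencil_def scaleC_diff_right)
  have le: "norm ((s - r) *\<^sub>C (K' - K)) * norm N \<le> 1/2"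
  proof -
    have "norm ((s - r) *\<^sub>C (K' - K)) * norm N \<le> cmod (s - r) * norm (K' - K) * M"
      unfolding norm_scaleC using N(2) by (intro mult_left_mono) auto
    then show ?thesis using small by simp
  qed
  have "norm ((s - r) *\<^sub>C (K' - K)) * norm N < 1" using le by simp
  from is_inverse_perturb[OF N(1) this]
  obtain N' where N': "is_inverse (pencil K' r s) N'"
    "norm N' \<le> norm N / (1 - norm ((s - r) *\<^sub>C (K' - K)) * norm N)"
    unfolding E by blast
  show "invertible_op (pencil K' r s)" using N'(1) by (rule invertible_opI)
  have "norm N / (1 - norm ((s - r) *\<^sub>C (K' - K)) * norm N) \<le> norm N / (1/2)"
    using le by (intro divide_left_mono) auto
  then have N'M: "norm N' \<le> 2 * M" using N'(2) N(2) by simp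
  have linN: "clinear_blinfun N" using clinear_inverse[OF N(1)] K by auto
  have linN': "clinear_blinfun N'" using clinear_inverse[OF N'(1)] K by auto
  have "pres K' r s - pres K r s = N' o\<^sub>L ((K' - K) o\<^sub>L N)"
  proof (rule blinfun_eqI)
    fix x
    define z where "z = N x"
    have x: "x = pencil K r s z" by (simp add: z_def is_inverse_apply[OF N(1)])
    have "N (K x) = K z"
    proof -
      have "K x = pencil K r s (K z)"
        by (simp add: x pencil_apply blinfun.add_right clinear_blinfunD[OF K(1)])
      then show ?thesis by (simp add: is_inverse_apply[OF N(1)])
    qed
    moreover have "N' (K' x) = N' (K' z + (s - r) *\<^sub>C K' (K z))"
      by (simp add: x pencil_apply blinfun.add_right clinear_blinfunD[OF K(2)])
    moreover have "N' ((s - r) *\<^sub>C K' (K z)) = K z - N' (K z)"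
      using is_inverse_apply(2)[OF N'(1), of "K z"] by (simp add: pencil_apply blinfun.add_right eq_diff_eq add.commute)
    ultimately show "(pres K' r s - pres K r s) x = (N' o\<^sub>L ((K' - K) o\<^sub>L N)) x"
      by (simp add: pres_eqI[OF N(1)] pres_eqI[OF N'(1)] blinfun.diff_left blinfun.diff_right
          blinfun.add_right z_def[symmetric])
  qed
  then have "norm (pres K' r s - pres K r s) \<le> norm N' * (norm (K' - K) * norm N)"
    by (simp only:) (rule order.trans[OF norm_blinfun_compose mult_left_mono[OF norm_blinfun_compose norm_ge_zero]])
  also have "\<dots> \<le> (2 * M) * (norm (K' - K) * M)"
    using N'M N(2) M by (intro mult_mono) auto
  finally show "norm (pres K' r s - pres K r s) \<le> 2 * M * M * norm (K' - K)" by (simp add: mult_ac)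
qed

lemma norm_blinfun_le_cinner:
  fixes T :: "'a::complex_inner \<Rightarrow>\<^sub>L 'a"
  assumes "\<And>u x. cmod (cinner u (T x)) \<le> C * norm u * norm x" "0 \<le> C"
  shows "norm T \<le> C"
proof (rule norm_blinfun_bound[OF assms(2)])
  fix x
  show "norm (T x) \<le> C * norm x"
    using assms(1)[of _ x] assms(2) by (intro norm_le_if_cinner_le) (auto simp: mult_ac)
qed

text \<open>The circle is fixed before \<open>y\<close> moves. The limit pencil is uniformly
  invertible on it, so the families converge uniformly there, and so do their integrals, which
  collect all the poles inside.\<close>

lemma rproj_sum_tendsto:
  fixes K :: "'b \<Rightarrow> 'a::complex_hilbert \<Rightarrow>\<^sub>L 'a"
  assumes K: "\<forall>\<^sub>F y in F. approximable (K y) \<and> clinear_blinfun (K y)"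
    and K0: "approximable K0" "clinear_blinfun K0" and lim: "(K \<longlongrightarrow> K0) F"
  obtains e where "0 < e" "\<And>\<epsilon>. 0 < \<epsilon> \<Longrightarrow> \<epsilon> < e \<Longrightarrow>
    ((\<lambda>y. rproj_sum (K y) r (poles_in (K y) r (ball a \<epsilon>))) \<longlongrightarrow> rproj K0 r a) F"
proof -
  obtain e where e: "e > 0" "\<And>s. s \<in> ball a e - {a} \<Longrightarrow> invertible_op (pencil K0 r s)"
    "\<And>\<epsilon> \<phi>. 0 < \<epsilon> \<Longrightarrow> \<epsilon> < e \<Longrightarrow> cfunctional \<phi> \<Longrightarrow>
      ((\<lambda>s. \<phi> (pres K0 r s)) has_contour_integral (2 * of_real pi * \<i> * \<phi> (rproj K0 r a))) (circlepath a \<epsilon>)"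
    using rproj_contour[OF K0] by metis
  have "((\<lambda>y. rproj_sum (K y) r (poles_in (K y) r (ball a \<epsilon>))) \<longlongrightarrow> rproj K0 r a) F"
    if \<epsilon>: "0 < \<epsilon>" "\<epsilon> < e" for \<epsilon>
  proof -
    have inv0: "invertible_op (pencil K0 r s)" if "s \<in> sphere a \<epsilon>" for s
      using that \<epsilon> by (intro e(2)) auto
    obtain M where M: "0 < M" "\<And>s. s \<in> sphere a \<epsilon> \<Longrightarrow> norm (inv_op (pencil K0 r s)) \<le> M"
      using inverse_pencil_bounded_on_compact[OF K0(2) compact_sphere inv0] by metis
    \<comment> \<open>An upper bound for the distance of the circle from the base point; the
      threshold \<open>1 / (2 * R * M)\<close> below then yields the smallness condition of
      \<open>pres_perturb\<close>.\<close>
    define R where "R = cmod (a - r) + \<epsilon>"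
    have R: "0 < R" using \<epsilon> by (simp add: R_def add_nonneg_pos)
    have dK: "((\<lambda>y. norm (K y - K0)) \<longlongrightarrow> 0) F"
      using lim by (simp add: tendsto_norm_zero_iff LIM_zero_iff)
    have "\<forall>\<^sub>F y in F. norm (K y - K0) < 1 / (2 * R * M)"
      using order_tendstoD(2)[OF dK] R M(1) by simp
    with K have "\<forall>\<^sub>F y in F. norm (rproj_sum (K y) r (poles_in (K y) r (ball a \<epsilon>)) - rproj K0 r a)
        \<le> 2 * M * M * \<epsilon> * norm (K y - K0)"
    proof eventually_elim
      case (elim y)
      let ?E = "rproj_sum (K y) r (poles_in (K y) r (ball a \<epsilon>))"
      have Ky: "approximable (K y)" "clinear_blinfun (K y)" using elim by auto
      have sm: "cmod (s - r) * norm (K y - K0) * M \<le> 1/2" if s: "s \<in> sphere a \<epsilon>" for s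
      proof -
        have "cmod (s - r) \<le> cmod (s - a) + cmod (a - r)" using norm_triangle_ineq[of "s - a" "a - r"] by simp
        then have "cmod (s - r) \<le> R" using s by (simp add: R_def dist_norm norm_minus_commute)
        then have "cmod (s - r) * norm (K y - K0) * M \<le> R * norm (K y - K0) * M"
          using M(1) by (intro mult_right_mono) auto
        also have "\<dots> \<le> 1/2" using elim(2) R M(1) by (simp add: field_simps)
        finally show ?thesis .
      qed
      note pert = pres_perturb[OF K0(2) Ky(2) is_inverse_inv_op[OF inv0] M(2) sm M(1)]
      have inv: "invertible_op (pencil (K y) r s)" if "dist a s = \<epsilon>" for s
        using pert(1)[of s] that by simp
      show ?case
      proof (rule norm_blinfun_le_cinner)
        fix u x
        let ?\<phi> = "\<lambda>T :: 'a \<Rightarrow>\<^sub>L 'a. cinner u (T x)"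
        have 1: "((\<lambda>s. ?\<phi> (pres (K y) r s)) has_contour_integral
            (2 * of_real pi * \<i> * ?\<phi> ?E)) (circlepath a \<epsilon>)"
          using rproj_sum_contour[OF Ky cfunctional_cinner'[of u x] \<epsilon>(1) inv]
          by (simp add: rproj_sum_apply cinner_sum_right)
        have "((\<lambda>s. ?\<phi> (pres (K y) r s) - ?\<phi> (pres K0 r s)) has_contour_integral
            (2 * of_real pi * \<i> * ?\<phi> ?E - 2 * of_real pi * \<i> * ?\<phi> (rproj K0 r a))) (circlepath a \<epsilon>)"
          by (rule has_contour_integral_diff[OF 1 e(3)[OF \<epsilon> cfunctional_cinner']])
        then have "cmod (2 * of_real pi * \<i> * ?\<phi> ?E - 2 * of_real pi * \<i> * ?\<phi> (rproj K0 r a))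
            \<le> (norm u * (2 * M * M * norm (K y - K0) * norm x)) * (2 * pi * \<epsilon>)"
        proof (rule has_contour_integral_bound_circlepath)
          fix s assume "cmod (s - a) = \<epsilon>"
          then have s: "s \<in> sphere a \<epsilon>" by (simp add: dist_norm norm_minus_commute)
          have "cmod (?\<phi> (pres (K y) r s) - ?\<phi> (pres K0 r s)) = cmod (cinner u ((pres (K y) r s - pres K0 r s) x))"
            by (simp add: blinfun.diff_left cinner_diff_right)
          also have "\<dots> \<le> norm u * norm ((pres (K y) r s - pres K0 r s) x)" by (rule norm_cinner_le)
          also have "\<dots> \<le> norm u * (norm (pres (K y) r s - pres K0 r s) * norm x)"
            by (intro mult_left_mono norm_blinfun) simp
          also have "\<dots> \<le> norm u * (2 * M * M * norm (K y - K0) * norm x)"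
            by (intro mult_left_mono mult_right_mono pert(2)[OF s s s]) auto
          finally show "cmod (?\<phi> (pres (K y) r s) - ?\<phi> (pres K0 r s))
              \<le> norm u * (2 * M * M * norm (K y - K0) * norm x)" .
        qed (use M(1) \<epsilon> in auto)
        also have "2 * of_real pi * \<i> * ?\<phi> ?E - 2 * of_real pi * \<i> * ?\<phi> (rproj K0 r a)
            = 2 * of_real pi * \<i> * ?\<phi> (?E - rproj K0 r a)"
          by (simp add: blinfun.diff_left cinner_diff_right right_diff_distrib)
        finally have "2 * pi * cmod (?\<phi> (?E - rproj K0 r a))
            \<le> 2 * pi * (2 * M * M * \<epsilon> * norm (K y - K0) * norm u * norm x)"
          by (simp add: norm_mult mult_ac)
        then show "cmod (?\<phi> (?E - rproj K0 r a)) \<le> 2 * M * M * \<epsilon> * norm (K y - K0) * norm u * norm x"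
          by (simp add: mult_ac)
      qed (use M(1) \<epsilon> in auto)
    qed
    moreover have "((\<lambda>y. 2 * M * M * \<epsilon> * norm (K y - K0)) \<longlongrightarrow> 0) F"
      using tendsto_mult_right_zero[OF dK] by simp
    ultimately have "((\<lambda>y. rproj_sum (K y) r (poles_in (K y) r (ball a \<epsilon>)) - rproj K0 r a) \<longlongrightarrow> 0) F"
      by (rule Lim_null_comparison)
    then show ?thesis by (simp add: LIM_zero_iff)
  qed
  then show ?thesis using that e(1) by blast
qed

section \<open>Non-degeneracy of the resonance matrix\<close>

text \<open>Null vectors of a semidefinite form lie in its radical. The form is that of
  \<open>D\<close>, twice the imaginary part of \<open>T\<close>; minimality at \<open>u\<close> in
  every direction \<open>v\<close> gives D u = 0.\<close>

lemma dissipative_zero: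
  fixes T S :: "'a::complex_inner \<Rightarrow>\<^sub>L 'a"
  assumes adj: "is_adj T S" and diss: "\<And>u. 0 \<le> Im (cinner u (T u))" and u: "Im (cinner u (T u)) = 0"
  shows "T u = S u"
proof -
  define D where "D x = - \<i> *\<^sub>C (T x - S x)" for x
  have SD: "cinner x (S y) = cnj (cinner y (T x))" for x y
    using is_adjD[OF adj, of x y] cinner_commute[of "T x" y] by simp
  have quad: "Re (cinner x (D x)) = 2 * Im (cinner x (T x))" for x
    by (simp add: D_def cinner_scaleC_right cinner_diff_right SD)
  have symm: "Re (cinner x (D y)) = Re (cinner y (D x))" for x y
    by (simp add: D_def cinner_scaleC_right cinner_diff_right SD)
  have lin: "D (x + complex_of_real t *\<^sub>C y) = D x + complex_of_real t *\<^sub>C D y" for x y t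
    by (simp add: D_def blinfun.add_right blinfun.scaleR_right scaleC_of_real scaleC_right_distrib scaleC_diff_right
        scaleR_right_diff_distrib)
       (simp add: scaleC_of_real[symmetric] scaleC_scaleC mult.commute algebra_simps)
  have zero: "Re (cinner v (D u)) = 0" for v
  proof -
    have "- Re (cinner v (D u)) = 0"
    proof (rule real_minimum_zero)
      fix t :: real
      have "0 \<le> Re (cinner (u + complex_of_real t *\<^sub>C v) (D (u + complex_of_real t *\<^sub>C v)))"
        unfolding quad using diss by simp
      also have "\<dots> = Re (cinner u (D u)) + t * Re (cinner u (D v)) + t * Re (cinner v (D u)) + t\<^sup>2 * Re (cinner v (D v))"
        unfolding lin by (simp add: cinner_add_left cinner_add_right cinner_scaleC_left cinner_scaleC_right
            power2_eq_square algebra_simps)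
      also have "\<dots> = t\<^sup>2 * Re (cinner v (D v)) - 2 * t * (- Re (cinner v (D u)))"
        using u by (simp add: quad symm[of u v])
      finally show "0 \<le> t\<^sup>2 * Re (cinner v (D v)) - 2 * t * (- Re (cinner v (D u)))" .
    qed
    then show ?thesis by simp
  qed
  from zero[of "D u"] have "D u = 0" by (simp add: cinner_self)
  then have "\<i> *\<^sub>C D u = 0" by simp
  then show ?thesis by (simp add: D_def scaleC_scaleC)
qed

text \<open>\<open>N\<close> below is the radical of the form on the range of the projection. On it
  S J agrees with T J, so it is invariant and, if non-zero, contains an eigenvector
  \<open>v\<close>; then \<open>J v\<close> is an eigenvector of J S, hence fixed by
  \<open>?Q\<close>, which also annihilates it.\<close>

lemma resonance_matrix_injective:
  fixes T S J :: "'a::complex_hilbert \<Rightarrow>\<^sub>L 'a"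
  assumes T: "approximable T" "clinear_blinfun T" and S: "approximable S" "clinear_blinfun S"
    and adj: "is_adj T S" and diss: "\<And>u. 0 \<le> Im (cinner u (T u))" and J: "selfadjoint_blinfun J"
    and r: "cnj r = r" "cnj a = a"
    and x: "x \<in> range (rproj (T o\<^sub>L J) r a)" "rproj (J o\<^sub>L S) r a (J x) = 0"
  shows "x = 0"
proof (rule ccontr)
  assume x0: "x \<noteq> 0"
  define K K' where "K = T o\<^sub>L J" and "K' = J o\<^sub>L S"
  note linJ = selfadjointD(1)[OF J]
  have K: "approximable K" "clinear_blinfun K" and K': "approximable K'" "clinear_blinfun K'"
    using T S linJ approximable_compose by (auto simp: K_def K'_def)
  have adjJ: "is_adj J J" using selfadjointD(2)[OF J] by (simp add: is_adj_def)
  have adjK: "is_adj K K'" unfolding K_def K'_def by (rule is_adj_compose[OF adj adjJ])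
  let ?P = "rproj K r a" and ?Q = "rproj K' r a" and ?X = "pencil K r a"
  have adjP: "is_adj ?P ?Q" using rproj_adj[OF K K' adjK r(1), of a] by (simp add: r(2))
  define N where "N = {x. ?P x = x \<and> ?Q (J x) = 0}"
  have S_eq: "S (J y) = K y" if y: "y \<in> N" for y
  proof -
    \<comment> \<open>\<open>K y\<close> stays in the range of \<open>?P\<close>, so its adjoint
      \<open>?Q\<close> can be moved onto \<open>J y\<close>, where it vanishes; thus the
      dissipation of \<open>T\<close> at \<open>J y\<close> is zero.\<close>
    have Ky: "K y = ?P (K y)"
      using rproj_commute[OF K K(2), where x = y and w = a and r = r] y by (simp add: N_def)
    have "cinner (J y) (K y) = cinner (J y) (?P (K y))" using Ky by simp
    also have "\<dots> = cinner (?Q (J y)) (K y)" by (simp add: is_adjD[OF is_adj_sym[OF adjP]])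
    also have "\<dots> = 0" using y by (simp add: N_def)
    finally have "Im (cinner (J y) (T (J y))) = 0" by (simp add: K_def)
    from dissipative_zero[OF adj diss this] show ?thesis by (simp add: K_def)
  qed
  have KN: "K y \<in> N" if y: "y \<in> N" for y
  proof -
    have "?Q (J (K y)) = ?Q (K' (J y))" by (simp add: K'_def S_eq[OF y])
    also have "\<dots> = K' (?Q (J y))" using rproj_commute[OF K' K'(2), where x = "J y" and w = a and r = r] by simp
    also have "\<dots> = 0" using y by (simp add: N_def)
    finally show ?thesis using rproj_commute[OF K K(2), where x = y and w = a and r = r] y by (simp add: N_def)
  qed
  have XN: "?X y \<in> N" if "y \<in> N" for y
    using KN[OF that] that clinear_rproj[OF K] clinear_rproj[OF K'] linJ
    by (simp add: N_def pencil_apply blinfun.add_right clinear_blinfunD)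
  have xN: "x \<in> N" using x rproj_rproj[OF K] by (auto simp: N_def K_def K'_def)
  have powN: "opow ?X n x \<in> N" for n by (induction n) (simp_all add: xN XN)
  obtain m where m: "\<And>z. opow ?X m (?P z) = 0" using rproj_nilpotent[OF K, of r a] by blast
  have "opow ?X m x = 0" using m[of x] xN by (simp add: N_def)
  \<comment> \<open>The last non-zero member of the nilpotent chain of \<open>x\<close> is a genuine
    eigenvector.\<close>
  define k where "k = (LEAST k. opow ?X k x = 0)"
  have k: "opow ?X k x = 0" unfolding k_def by (rule LeastI[of _ m]) fact
  have "k \<noteq> 0" using k x0 by (cases k) auto
  then obtain j where j: "k = Suc j" by (cases k) auto
  define v where "v = opow ?X j x"
  have v0: "v \<noteq> 0" unfolding v_def using not_less_Least[of j "\<lambda>k. opow ?X k x = 0"] j by (auto simp: k_def)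
  have Xv: "?X v = 0" using k by (simp add: j v_def)
  have vN: "v \<in> N" by (simp add: v_def powN)
  have "pencil K' r a (J v) = J (?X v)"
    by (simp add: pencil_apply blinfun.add_right clinear_blinfunD[OF linJ] K'_def S_eq[OF vN])
  then have "opow (pencil K' r a) 1 (J v) = 0" by (simp add: Xv)
  from rproj_on_nilpotent[OF K' this, of a] have "?Q (J v) = J v" by simp
  then have "J v = 0" using vN by (simp add: N_def)
  then have "K v = 0" by (simp add: K_def)
  then show False using Xv v0 by (simp add: pencil_apply)
qed

section \<open>Counting the split poles\<close>

lemma mapped_rank_le:
  fixes P L :: "'a::complex_inner \<Rightarrow>\<^sub>L 'a"
  assumes "clinear_blinfun P" "clinear_blinfun L" "finite_dim (range (blinfun_apply L))"
    and "\<And>x. x \<in> range (blinfun_apply P) \<Longrightarrow> L x = 0 \<Longrightarrow> x = 0"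
  shows "crank P \<le> crank L"
  unfolding crank_def
  by (rule linear_inj_cdim_le(2)[OF clinear_linear[OF assms(2)] subspace_range[OF assms(1)] assms(4) _ assms(3)]) auto

text \<open>\<open>T\<close> and \<open>J\<close> are kept abstract because the count is applied
  twice: to the family above the real axis, and to the negative of the family below it together with
  \<open>- J\<close>.\<close>

theorem split_poles_count:
  fixes T :: "real \<Rightarrow> 'a::complex_hilbert \<Rightarrow>\<^sub>L 'a" and T0 S0 J :: "'a \<Rightarrow>\<^sub>L 'a"
  assumes T: "\<And>y. 0 < y \<Longrightarrow> approximable (T y)" "\<And>y. 0 < y \<Longrightarrow> clinear_blinfun (T y)"
    and diss: "\<And>y u. 0 < y \<Longrightarrow> 0 \<le> Im (cinner u (T y u))"
    and strict: "\<And>y u. 0 < y \<Longrightarrow> Im (cinner u (T y u)) = 0 \<Longrightarrow> T y u = 0"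
    and lim: "(T \<longlongrightarrow> T0) (at_right 0)"
    and S0: "approximable S0" "clinear_blinfun S0" "is_adj T0 S0"
    and J: "selfadjoint_blinfun J" and r: "cnj r = r" "cnj a = a"
    and real_inv: "\<And>y s. 0 < y \<Longrightarrow> Im s = 0 \<Longrightarrow> invertible_op (pencil (T y o\<^sub>L J) r s)"
  defines "Smat \<equiv> rproj (J o\<^sub>L S0) r a o\<^sub>L J o\<^sub>L rproj (T0 o\<^sub>L J) r a"
  shows "selfadjoint_blinfun Smat" "finite_dim (range (blinfun_apply Smat))"
    "\<forall>\<^sub>F \<epsilon> in at_right 0. \<forall>\<^sub>F y in at_right 0.
       (\<Sum>w\<in>poles_in (T y o\<^sub>L J) r (ball a \<epsilon> \<inter> {w. 0 < Im w}). crank (rproj (T y o\<^sub>L J) r w)) = crank (pos_part Smat) \<and>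
       (\<Sum>w\<in>poles_in (T y o\<^sub>L J) r (ball a \<epsilon> \<inter> {w. Im w < 0}). crank (rproj (T y o\<^sub>L J) r w)) = crank (neg_part Smat)"
proof -
  note linJ = selfadjointD(1)[OF J]
  have adjJ: "is_adj J J" using selfadjointD(2)[OF J] by (simp add: is_adj_def)
  have pos_ev: "\<forall>\<^sub>F y in at_right (0::real). 0 < y" by (simp add: eventually_at_right_less)
  have nb: "at_right (0::real) \<noteq> bot" by (rule trivial_limit_at_right_real)
  have T0: "approximable T0" "clinear_blinfun T0"
    using pos_ev T by (auto intro!: approximable_limit[OF lim nb] clinear_blinfun_limit[OF lim nb] elim: eventually_mono)
  define K where "K y = T y o\<^sub>L J" for y
  define K0 where "K0 = T0 o\<^sub>L J"
  define K' where "K' = J o\<^sub>L S0"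
  have K: "approximable (K y)" "clinear_blinfun (K y)" if "0 < y" for y
    using T[OF that] linJ approximable_compose by (auto simp: K_def)
  have K0: "approximable K0" "clinear_blinfun K0" and K': "approximable K'" "clinear_blinfun K'"
    using T0 S0 linJ approximable_compose by (auto simp: K0_def K'_def)
  have diss0: "0 \<le> Im (cinner u (T0 u))" for u
  proof (rule tendsto_lowerbound[OF _ _ nb])
    show "((\<lambda>y. Im (cinner u (T y u))) \<longlongrightarrow> Im (cinner u (T0 u))) (at_right 0)"
      by (intro tendsto_intros lim)
    show "\<forall>\<^sub>F y in at_right 0. 0 \<le> Im (cinner u (T y u))"
      using pos_ev by eventually_elim (rule diss)
  qed
  let ?P0 = "rproj K0 r a" and ?Q0 = "rproj K' r a"
  have linP0: "clinear_blinfun ?P0" and linQ0: "clinear_blinfun ?Q0"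
    using clinear_rproj K0 K' by auto
  have "is_adj K0 K'" unfolding K0_def K'_def by (rule is_adj_compose[OF S0(3) adjJ])
  then have adjP: "is_adj ?P0 ?Q0" using rproj_adj[OF K0 K' _ r(1), of a] by (simp add: r(2))
  have Sm: "Smat x = ?Q0 (J (?P0 x))" for x by (simp add: Smat_def K0_def K'_def)
  have SmJ: "cinner x (Smat x) = cinner (?P0 x) (J (?P0 x))" for x
    by (simp add: Sm is_adjD[OF adjP])
  have "is_adj Smat Smat"
    unfolding is_adj_def Sm
    by (simp add: is_adjD[OF adjP] is_adjD[OF is_adj_sym[OF adjP]] is_adjD[OF adjJ])
  moreover have "clinear_blinfun Smat"
    unfolding Smat_def using linP0 linQ0 linJ by (auto simp: K0_def K'_def)
  ultimately show sa: "selfadjoint_blinfun Smat" by (auto simp: selfadjoint_blinfun_def is_adj_def)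
  show fin: "finite_dim (range (blinfun_apply Smat))"
    by (rule finite_dim_subset[OF finite_dim_rproj[OF K', of r a]]) (auto simp: Sm)
  obtain c where c: "0 < c" "jordan_decomposition Smat (pos_part Smat) (neg_part Smat)"
    "spectral_gap c (pos_part Smat)" "spectral_gap c (neg_part Smat)"
    using pos_neg_part[OF sa fin] by metis
  define Sp Sn where "Sp = pos_part Smat" and "Sn = neg_part Smat"
  have jd: "jordan_decomposition Smat Sp Sn" and gaps: "spectral_gap c Sp" "spectral_gap c Sn"
    using c by (simp_all add: Sp_def Sn_def)
  have linS: "clinear_blinfun Sp" "clinear_blinfun Sn"
    using jd positiveD(2) by (auto simp: jordan_decomposition_def)
  have Spx: "c * (norm x)\<^sup>2 \<le> Re (cinner (?P0 x) (J (?P0 x)))" if "x \<in> range Sp" for x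
    using that gaps(1) by (auto simp: SmJ[symmetric] jordan_apply[OF jd] spectral_gap_def)
  have Snx: "c * (norm x)\<^sup>2 \<le> - Re (cinner (?P0 x) (J (?P0 x)))" if "x \<in> range Sn" for x
    using that gaps(2) by (auto simp: SmJ[symmetric] jordan_apply[OF jd] spectral_gap_def)
  have rank0: "crank ?P0 \<le> crank Sp + crank Sn"
  proof -
    have "crank ?P0 \<le> crank Smat"
    proof (rule mapped_rank_le[OF linP0 selfadjointD(1)[OF sa] fin])
      fix x assume x: "x \<in> range ?P0" "Smat x = 0"
      then have "?P0 x = x" using rproj_rproj[OF K0] by auto
      then show "x = 0"
        using x resonance_matrix_injective[OF T0 S0 diss0 J r, of x] by (simp add: Sm K0_def K'_def)
    qed
    also have "\<dots> \<le> crank Sp + crank Sn"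
      by (rule crank_le_parts[OF jordan_apply(1)[OF jd]])
        (rule finite_dim_jordan[OF jd gaps(1) c(1) fin],
         rule finite_dim_jordan[OF jordan_decomposition_swap[OF jd] gaps(2) c(1)],
         rule finite_dim_subset[OF fin], auto simp: blinfun.minus_left simp flip: blinfun.minus_right)
    finally show ?thesis .
  qed
  have Klim: "(K \<longlongrightarrow> K0) (at_right 0)"
    unfolding K_def K0_def by (intro bounded_bilinear.tendsto[OF bounded_bilinear_blinfun_compose] lim tendsto_const)
  have Kev: "\<forall>\<^sub>F y in at_right 0. approximable (K y) \<and> clinear_blinfun (K y)"
    using pos_ev by eventually_elim (simp add: K)
  obtain e where e: "0 < e" "\<And>\<epsilon>. 0 < \<epsilon> \<Longrightarrow> \<epsilon> < e \<Longrightarrow>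
    ((\<lambda>y. rproj_sum (K y) r (poles_in (K y) r (ball a \<epsilon>))) \<longlongrightarrow> ?P0) (at_right 0)"
    using rproj_sum_tendsto[OF Kev K0 Klim, of r a] by blast
  have main: "\<forall>\<^sub>F y in at_right 0.
       (\<Sum>w\<in>poles_in (K y) r (ball a \<epsilon> \<inter> {w. 0 < Im w}). crank (rproj (K y) r w)) = crank Sp \<and>
       (\<Sum>w\<in>poles_in (K y) r (ball a \<epsilon> \<inter> {w. Im w < 0}). crank (rproj (K y) r w)) = crank Sn"
    if \<epsilon>: "0 < \<epsilon>" "\<epsilon> < e" for \<epsilon>
  proof -
    define E where "E y = rproj_sum (K y) r (poles_in (K y) r (ball a \<epsilon>))" for y
    have Elim: "(E \<longlongrightarrow> ?P0) (at_right 0)" unfolding E_def by (rule e(2)[OF \<epsilon>])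
    \<comment> \<open>This product bounds the difference between the forms of \<open>E y\<close> and
      \<open>?P0\<close>, relative to the squared norm; it has to fall below the gap
      \<open>c\<close>.\<close>
    have "((\<lambda>y. norm J * (norm (E y) + norm ?P0) * norm (E y - ?P0)) \<longlongrightarrow> norm J * (norm ?P0 + norm ?P0) * norm (?P0 - ?P0)) (at_right 0)"
      by (intro tendsto_intros Elim)
    then have ev1: "\<forall>\<^sub>F y in at_right 0. norm J * (norm (E y) + norm ?P0) * norm (E y - ?P0) < c"
      by (rule order_tendstoD) (simp add: c(1))
    have "((\<lambda>y. norm (E y - ?P0)) \<longlongrightarrow> norm (?P0 - ?P0)) (at_right 0)" by (intro tendsto_intros Elim)
    then have ev2: "\<forall>\<^sub>F y in at_right 0. norm (E y - ?P0) < 1" by (rule order_tendstoD) simp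
    show ?thesis
      using pos_ev ev1 ev2
    proof eventually_elim
      case (elim y)
      note y = elim(1)
      note Ky = K[OF y]
      define Zp Zn where "Zp = poles_in (K y) r (ball a \<epsilon> \<inter> {w. 0 < Im w})"
        and "Zn = poles_in (K y) r (ball a \<epsilon> \<inter> {w. Im w < 0})"
      have finZ: "finite Zp" "finite Zn"
        unfolding Zp_def Zn_def by (intro finite_poles_in[OF Ky] bounded_subset[OF bounded_ball]; auto)+
      have disj: "Zp \<inter> Zn = {}" by (auto simp: Zp_def Zn_def poles_in_def)
      \<comment> \<open>Real points are never poles for \<open>y > 0\<close>, so the two half-planes
        account for all of them.\<close>
      have Z: "poles_in (K y) r (ball a \<epsilon>) = Zp \<union> Zn"
        using real_inv[OF y] by (auto simp: Zp_def Zn_def poles_in_def K_def) (metis linorder_cases)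
      define Ep En where "Ep = rproj_sum (K y) r Zp" and "En = rproj_sum (K y) r Zn"
      have linE: "clinear_blinfun (E y)" "clinear_blinfun Ep" "clinear_blinfun En"
        by (simp_all add: E_def Ep_def En_def clinear_rproj_sum[OF Ky])
      have Esum: "E y x = Ep x + En x" for x
        unfolding E_def Ep_def En_def Z by (rule rproj_sum_disjoint[OF Ky finZ disj])
      have finE: "finite_dim (range Ep)" "finite_dim (range En)"
        unfolding Ep_def En_def by (simp_all add: finite_dim_rproj_sum[OF Ky] finZ)
      have rankE: "crank (E y) = crank Ep + crank En"
        unfolding E_def Ep_def En_def Z by (rule crank_rproj_sum_disjoint[OF Ky finZ disj])
      have Eidem: "E y (E y x) = E y x" for x
        unfolding E_def Z using rproj_sum_absorb[OF Ky finite_UnI[OF finZ] finite_UnI[OF finZ]] by simp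
      interpret h: hermitian_form "\<lambda>x z. cinner x (J z)"
        by unfold_locales (simp_all add: blinfun.add_right clinear_blinfunD[OF linJ] cinner_add_right cinner_scaleC_right
            is_adjD[OF adjJ, symmetric] cinner_commute[symmetric])
      have hK: "0 < Im (cinner x (J (K y x)))" if nz: "K y x \<noteq> 0" for x
      proof -
        have "cinner x (J (K y x)) = cinner (J x) (T y (J x))" by (simp add: K_def is_adjD[OF adjJ])
        moreover have "Im (cinner (J x) (T y (J x))) \<noteq> 0" using strict[OF y, of "J x"] nz by (auto simp: K_def)
        ultimately show ?thesis using diss[OF y, of "J x"] by simp
      qed
      have Imr: "Im r = 0" using r(1) by (simp add: complex_eq_iff)
      have posE: "0 < Re (cinner (Ep x) (J (Ep x)))" if nz: "Ep x \<noteq> 0" for x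
      proof -
        obtain ws where ws: "set ws \<subseteq> Zp" "\<And>x. pencil_prod (K y) r ws (Ep x) = 0"
          using rproj_sum_annihilated[OF Ky finZ(1)] unfolding Ep_def by blast
        have "h.positive_on {x. pencil_prod (K y) r ws x = 0}"
        proof (rule positive_on_pencil_prod[OF h.hermitian_form_axioms Ky Imr, of 1])
          fix w assume "w \<in> set ws"
          then show "0 < 1 * Im w" using ws(1) by (auto simp: Zp_def poles_in_def)
        qed (simp add: hK)
        then show ?thesis using ws(2) nz by (simp add: h.positive_on_def)
      qed
      have negE: "Re (cinner (En x) (J (En x))) < 0" if nz: "En x \<noteq> 0" for x
      proof -
        obtain ws where ws: "set ws \<subseteq> Zn" "\<And>x. pencil_prod (K y) r ws (En x) = 0"
          using rproj_sum_annihilated[OF Ky finZ(2)] unfolding En_def by blast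
        have "hermitian_form.positive_on (\<lambda>x z. - cinner x (J z)) {x. pencil_prod (K y) r ws x = 0}"
        proof (rule positive_on_pencil_prod[OF h.uminus Ky Imr, of "-1"])
          fix w assume "w \<in> set ws"
          then show "0 < - 1 * Im w" using ws(1) by (auto simp: Zn_def poles_in_def)
        qed (simp add: hK)
        then show ?thesis using ws(2) nz by (simp add: hermitian_form.positive_on_def[OF h.uminus])
      qed
      have close: "\<bar>Re (cinner (E y x) (J (E y x))) - Re (cinner (?P0 x) (J (?P0 x)))\<bar> < c * (norm x)\<^sup>2" if x: "x \<noteq> 0" for x
      proof -
        have "cinner (E y x) (J (E y x)) - cinner (?P0 x) (J (?P0 x))
            = cinner ((E y - ?P0) x) (J (E y x)) + cinner (?P0 x) (J ((E y - ?P0) x))"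
          by (simp add: blinfun.diff_left blinfun.diff_right cinner_diff_left cinner_diff_right)
        then have "cmod (cinner (E y x) (J (E y x)) - cinner (?P0 x) (J (?P0 x)))
            \<le> norm ((E y - ?P0) x) * norm (J (E y x)) + norm (?P0 x) * norm (J ((E y - ?P0) x))"
          by (metis norm_triangle_mono norm_cinner_le)
        also have "\<dots> \<le> (norm (E y - ?P0) * norm x) * (norm J * (norm (E y) * norm x))
            + (norm ?P0 * norm x) * (norm J * (norm (E y - ?P0) * norm x))"
          by (intro add_mono mult_mono norm_blinfun order.trans[OF norm_blinfun mult_left_mono[OF norm_blinfun]]
              mult_nonneg_nonneg norm_ge_zero)
        also have "\<dots> = norm J * (norm (E y) + norm ?P0) * norm (E y - ?P0) * (norm x)\<^sup>2"
          by (simp add: power2_eq_square algebra_simps)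
        also have "\<dots> < c * (norm x)\<^sup>2" using elim(2) x by (intro mult_strict_right_mono) auto
        finally show ?thesis
          by (rule order.strict_trans1[OF abs_Re_le_cmod[of "cinner (E y x) (J (E y x)) - cinner (?P0 x) (J (?P0 x))", simplified]])
      qed
      \<comment> \<open>If \<open>Ep\<close> annihilated a non-zero vector of the range of
        \<open>Sp\<close>, its image under \<open>E y\<close> would lie in the negative subspace,
        whereas closeness to \<open>?P0\<close> keeps the form positive there.\<close>
      have p: "crank Sp \<le> crank Ep"
      proof (rule mapped_rank_le[OF linS(1) linE(2) finE(1)])
        fix x assume x: "x \<in> range Sp" "Ep x = 0"
        then have "E y x = En x" by (simp add: Esum)
        then have "Re (cinner (E y x) (J (E y x))) \<le> 0" using negE[of x] by (cases "En x = 0") auto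
        then show "x = 0" using Spx[OF x(1)] close[of x] by (cases "x = 0") auto
      qed
      have q: "crank Sn \<le> crank En"
      proof (rule mapped_rank_le[OF linS(2) linE(3) finE(2)])
        fix x assume x: "x \<in> range Sn" "En x = 0"
        then have "E y x = Ep x" by (simp add: Esum)
        then have "0 \<le> Re (cinner (E y x) (J (E y x)))" using posE[of x] by (cases "Ep x = 0") auto
        then show "x = 0" using Snx[OF x(1)] close[of x] by (cases "x = 0") auto
      qed
      \<comment> \<open>Two projections at distance less than 1: no non-zero vector fixed by
        \<open>E y\<close> is annihilated by \<open>?P0\<close>. This closes the chain of rank
        inequalities.\<close>
      have "crank (E y) \<le> crank ?P0"
      proof (rule mapped_rank_le[OF linE(1) linP0 finite_dim_rproj[OF K0]])
        fix x assume x: "x \<in> range (E y)" "?P0 x = 0"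
        then have "(E y - ?P0) x = x" using Eidem by (auto simp: blinfun.diff_left)
        then have "norm x \<le> norm (E y - ?P0) * norm x" using norm_blinfun[of "E y - ?P0" x] by simp
        then show "x = 0" using elim(3) mult_less_cancel_right2[of "norm (E y - ?P0)" "norm x"] by fastforce
      qed
      then have "crank Ep = crank Sp \<and> crank En = crank Sn" using p q rank0 rankE by linarith
      then show ?case
        using crank_rproj_sum[OF Ky finZ(1)] crank_rproj_sum[OF Ky finZ(2)]
        by (simp add: Ep_def En_def Zp_def Zn_def)
    qed
  qed
  have "\<forall>\<^sub>F \<epsilon> in at_right 0. 0 < \<epsilon> \<and> \<epsilon> < e"
    using e(1) eventually_at_right_real[of 0 e] by simp
  then show "\<forall>\<^sub>F \<epsilon> in at_right 0. \<forall>\<^sub>F y in at_right 0.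
       (\<Sum>w\<in>poles_in (T y o\<^sub>L J) r (ball a \<epsilon> \<inter> {w. 0 < Im w}). crank (rproj (T y o\<^sub>L J) r w)) = crank (pos_part Smat) \<and>
       (\<Sum>w\<in>poles_in (T y o\<^sub>L J) r (ball a \<epsilon> \<inter> {w. Im w < 0}). crank (rproj (T y o\<^sub>L J) r w)) = crank (neg_part Smat)"
    by eventually_elim (use main in \<open>simp add: K_def Sp_def Sn_def\<close>)
qed

section \<open>Self-adjoint unbounded operators and the sandwiched resolvent\<close>

section \<open>Unbounded operators\<close>

lemma linear_uopD:
  assumes "linear_uop T"
  shows "(0, 0) \<in> T" "(x, u) \<in> T \<Longrightarrow> (y, v) \<in> T \<Longrightarrow> (x + y, u + v) \<in> T"
    "(x, u) \<in> T \<Longrightarrow> (c *\<^sub>C x, c *\<^sub>C u) \<in> T" "(x, u) \<in> T \<Longrightarrow> (x, v) \<in> T \<Longrightarrow> u = v"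
  using assms unfolding linear_uop_def single_valued_def by blast+

lemma uop_adjD: "(y, v) \<in> uop_adj T \<Longrightarrow> (x, u) \<in> T \<Longrightarrow> cinner u y = cinner x v"
  unfolding uop_adj_def by auto

lemma uop_adjI: "(\<And>x u. (x, u) \<in> T \<Longrightarrow> cinner u y = cinner x v) \<Longrightarrow> (y, v) \<in> uop_adj T"
  unfolding uop_adj_def by auto

lemma uop_adj_add: "(x, u) \<in> uop_adj T \<Longrightarrow> (y, v) \<in> uop_adj T \<Longrightarrow> (x + y, u + v) \<in> uop_adj T"
  by (rule uop_adjI) (simp add: cinner_add_right uop_adjD)

lemma uop_adj_scaleC: "(x, u) \<in> uop_adj T \<Longrightarrow> (c *\<^sub>C x, c *\<^sub>C u) \<in> uop_adj T"
  by (rule uop_adjI) (simp add: cinner_scaleC_right uop_adjD)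

lemma uop_adj_limit:
  assumes "\<And>n. (X n, U n) \<in> uop_adj T" "X \<longlonglongrightarrow> x" "U \<longlonglongrightarrow> u"
  shows "(x, u) \<in> uop_adj T"
proof (rule uop_adjI)
  fix y v assume yv: "(y, v) \<in> T"
  have "(\<lambda>n. cinner v (X n)) \<longlonglongrightarrow> cinner v x" by (intro tendsto_intros assms)
  moreover have "(\<lambda>n. cinner v (X n)) \<longlonglongrightarrow> cinner y u"
    by (simp add: uop_adjD[OF assms(1) yv]) (intro tendsto_intros assms)
  ultimately show "cinner v x = cinner y u" by (rule LIMSEQ_unique)
qed

lemma csubspace_closure:
  fixes S :: "'a::complex_normed_vector set"
  assumes S: "complex_vector.subspace S" shows "complex_vector.subspace (closure S)"
proof (rule complex_vector.subspaceI)
  show "0 \<in> closure S" using complex_vector.subspace_0[OF S] closure_subset by auto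
  fix x y c assume "x \<in> closure S"
  then obtain X where X: "\<And>n. X n \<in> S" "X \<longlonglongrightarrow> x" unfolding closure_sequential by blast
  have "(\<lambda>n. c *\<^sub>C X n) \<longlonglongrightarrow> c *\<^sub>C x" by (intro tendsto_intros X(2))
  then show "c *\<^sub>C x \<in> closure S"
    unfolding closure_sequential using complex_vector.subspace_scale[OF S X(1)]
    by (intro exI[of _ "\<lambda>n. c *\<^sub>C X n"]) simp
  assume "y \<in> closure S"
  then obtain Y where Y: "\<And>n. Y n \<in> S" "Y \<longlonglongrightarrow> y" unfolding closure_sequential by blast
  have "(\<lambda>n. X n + Y n) \<longlonglongrightarrow> x + y" by (intro tendsto_intros X(2) Y(2))
  then show "x + y \<in> closure S"
    unfolding closure_sequential using complex_vector.subspace_add[OF S X(1) Y(1)]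
    by (intro exI[of _ "\<lambda>n. X n + Y n"]) simp
qed

text \<open>Projecting a vector \<open>(0, v)\<close> with \<open>v\<close> orthogonal to the domain of the adjoint onto the graph.\<close>

lemma dense_domain_adjoint:
  fixes F :: "('h::complex_hilbert, 'k::complex_hilbert) uop"
  assumes lin: "linear_uop F" and cl: "closed F"
  shows "closure (Domain (uop_adj F)) = UNIV"
proof (rule ccontr)
  assume ne: "closure (Domain (uop_adj F)) \<noteq> UNIV"
  have "complex_vector.subspace (Domain (uop_adj F))"
  proof (rule complex_vector.subspaceI)
    have "(0, 0) \<in> uop_adj F" by (rule uop_adjI) simp
    then show "0 \<in> Domain (uop_adj F)" by (rule DomainI)
  qed (auto intro: uop_adj_add uop_adj_scaleC)
  then obtain v where v: "v \<noteq> 0" "\<And>y. y \<in> closure (Domain (uop_adj F)) \<Longrightarrow> cinner y v = 0"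
    using orthogonal_vector_exists[OF closed_closure csubspace_closure ne] by metis
  have sub: "subspace F"
  proof (rule subspaceI)
    show "0 \<in> F" using linear_uopD(1)[OF lin] by (simp add: zero_prod_def)
    fix p q :: "'h \<times> 'k" and c assume p: "p \<in> F"
    show "c *\<^sub>R p \<in> F"
      using linear_uopD(3)[OF lin, of "fst p" "snd p" "of_real c"] p by (simp add: scaleC_of_real scaleR_prod_def)
    assume "q \<in> F"
    then show "p + q \<in> F" using p linear_uopD(2)[OF lin, of "fst p" "snd p" "fst q" "snd q"] by (simp add: plus_prod_def)
  qed
  have para: "(norm (p + q))\<^sup>2 + (norm (p - q))\<^sup>2 = 2 * (norm p)\<^sup>2 + 2 * (norm q)\<^sup>2" for p q :: "'h \<times> 'k"
    using parallelogram_law[of "fst p" "fst q"] parallelogram_law[of "snd p" "snd q"] by (simp add: norm_Pair_sq)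
  obtain p where p: "p \<in> F" "\<And>m. m \<in> F \<Longrightarrow> norm ((0, v) - p) \<le> norm ((0, v) - m)"
    using closest_point_exists[OF para cl sub, of "(0, v)"] by metis
  define x u where "x = fst p" and "u = snd p"
  have pxu: "(x, u) \<in> F" "p = (x, u)" using p(1) by (simp_all add: x_def u_def)
  \<comment> \<open>The residual \<open>(a, b)\<close> is orthogonal to the graph, which says that
    \<open>(b, - a)\<close> belongs to the adjoint. So \<open>b\<close> lies in the domain of the
    adjoint and is orthogonal to \<open>v\<close>; this forces \<open>x\<close> and \<open>b\<close>
    to vanish and puts \<open>(0, v)\<close> into the graph.\<close>
  define a b where "a = - x" and "b = v - u"
  have re: "Re (cinner m1 a + cinner m2 b) = 0" if m: "(m1, m2) \<in> F" for m1 m2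
  proof (rule real_minimum_zero)
    fix t :: real
    have "p + t *\<^sub>R (m1, m2) \<in> F" using sub p(1) m by (simp add: subspace_add subspace_scale del: scaleR_Pair)
    moreover have e1: "(0, v) - (p + t *\<^sub>R (m1, m2)) = (a - t *\<^sub>R m1, b - t *\<^sub>R m2)"
      and e2: "(0, v) - p = (a, b)"
      by (simp_all add: pxu(2) a_def b_def diff_diff_eq2 diff_diff_eq[symmetric])
    moreover note p(2)
    ultimately have "(norm ((0, v) - p))\<^sup>2 \<le> (norm ((0, v) - (p + t *\<^sub>R (m1, m2))))\<^sup>2"
      by (intro power_mono norm_ge_zero) blast
    then have "(norm a)\<^sup>2 + (norm b)\<^sup>2 \<le> (norm (a - t *\<^sub>R m1))\<^sup>2 + (norm (b - t *\<^sub>R m2))\<^sup>2"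
      unfolding e1 e2 norm_Pair_sq by simp
    moreover have "Re (cinner a m1) = Re (cinner m1 a)" "Re (cinner b m2) = Re (cinner m2 b)"
      using cinner_commute[of a m1] cinner_commute[of b m2] by simp_all
    moreover have "(norm (y - t *\<^sub>R m))\<^sup>2 = (norm y)\<^sup>2 + t\<^sup>2 * (norm m)\<^sup>2 - 2 * t * Re (cinner y m)" for y m :: 'h
      by (simp add: norm_diff_sq scaleC_of_real[symmetric] cinner_scaleC_right norm_scaleC power_mult_distrib)
    moreover have "(norm (y - t *\<^sub>R m))\<^sup>2 = (norm y)\<^sup>2 + t\<^sup>2 * (norm m)\<^sup>2 - 2 * t * Re (cinner y m)" for y m :: 'k
      by (simp add: norm_diff_sq scaleC_of_real[symmetric] cinner_scaleC_right norm_scaleC power_mult_distrib)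
    ultimately show "0 \<le> t\<^sup>2 * ((norm m1)\<^sup>2 + (norm m2)\<^sup>2) - 2 * t * Re (cinner m1 a + cinner m2 b)"
      by (simp only: plus_complex.sel distrib_left)
  qed
  have zero: "cinner m1 a + cinner m2 b = 0" if m: "(m1, m2) \<in> F" for m1 m2
    using re[OF m] re[OF linear_uopD(3)[OF lin m, of \<i>]]
    by (simp add: cinner_scaleC_left complex_eq_iff)
  have "(b, - a) \<in> uop_adj F"
  proof (rule uop_adjI)
    fix m1 m2 assume "(m1, m2) \<in> F"
    then have "cinner m1 a + cinner m2 b = 0" by (rule zero)
    then show "cinner m2 b = cinner m1 (- a)" by (simp add: eq_neg_iff_add_eq_0 add.commute)
  qed
  then have "b \<in> Domain (uop_adj F)" by (rule DomainI)
  then have "b \<in> closure (Domain (uop_adj F))" by (rule subsetD[OF closure_subset])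
  then have bv: "cinner b v = 0" by (rule v(2))
  have vb: "cinner v b = 0" using bv cinner_commute[of v b] by simp
  have "cinner x a + cinner u b = 0" by (rule zero[OF pxu(1)])
  moreover have "u = v - b" by (simp add: b_def)
  ultimately have "- cinner x x - cinner b b = 0" by (simp add: a_def cinner_diff_left vb)
  then have "- complex_of_real ((norm x)\<^sup>2 + (norm b)\<^sup>2) = 0" by (simp add: cinner_self)
  then have "(norm x)\<^sup>2 + (norm b)\<^sup>2 = 0" by (simp only: neg_equal_0_iff_equal of_real_eq_0_iff)
  then have "x = 0" "b = 0" by (simp_all add: add_nonneg_eq_0_iff)
  then have "(0, v) \<in> F" using pxu(1) by (simp add: b_def)
  from linear_uopD(4)[OF lin this linear_uopD(1)[OF lin]] v(1) show False by simp
qed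

lemma resolvent_iff: "(f, x) \<in> resolvent T z \<longleftrightarrow> (x, f + z *\<^sub>C x) \<in> T"
proof
  assume "(f, x) \<in> resolvent T z"
  then obtain u where "(x, u) \<in> T" "f = u - z *\<^sub>C x"
    unfolding resolvent_def uop_add_def uop_scale_def by auto
  then show "(x, f + z *\<^sub>C x) \<in> T" by simp
next
  assume "(x, f + z *\<^sub>C x) \<in> T"
  moreover have "(x, (- z) *\<^sub>C x) \<in> uop_scale (- z) Id" unfolding uop_scale_def by blast
  ultimately have "(x, (f + z *\<^sub>C x) + (- z) *\<^sub>C x) \<in> uop_add T (uop_scale (- z) Id)"
    unfolding uop_add_def by blast
  then show "(f, x) \<in> resolvent T z" unfolding resolvent_def by simp
qed

lemma selfadjoint_uop_symmetric:
  assumes "selfadjoint_uop H" "(x, u) \<in> H" "(y, v) \<in> H"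
  shows "cinner u y = cinner x v"
proof -
  have "(y, v) \<in> uop_adj H" using assms(1,3) by (simp add: selfadjoint_uop_def)
  then show ?thesis using assms(2) by (rule uop_adjD)
qed

lemma selfadjoint_uop_quadratic:
  assumes H: "selfadjoint_uop H" and xf: "(x, f + z *\<^sub>C x) \<in> H"
  shows "Im (cinner f x) = Im z * (norm x)\<^sup>2"
proof -
  have "cinner (f + z *\<^sub>C x) x = cinner x (f + z *\<^sub>C x)" by (rule selfadjoint_uop_symmetric[OF H xf xf])
  from arg_cong[OF this, of Im] have "Im (cinner f x) - Im z * (norm x)\<^sup>2 = Im (cinner x f) + Im z * (norm x)\<^sup>2"
    by (simp add: cinner_add_left cinner_add_right cinner_scaleC_left cinner_scaleC_right cinner_self)
  moreover have "Im (cinner x f) = - Im (cinner f x)" using cinner_commute[of x f] by simp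
  ultimately show ?thesis by simp
qed

text \<open>The basic criterion: the estimate \<open>est\<close> and closedness of the adjoint make
  the range of H - z closed, and a non-zero vector orthogonal to it would be an eigenvector of the
  self-adjoint \<open>H\<close> for the non-real value \<open>cnj z\<close>.\<close>

lemma resolvent_total:
  fixes H :: "('h::complex_hilbert, 'h) uop"
  assumes H: "selfadjoint_uop H" and z: "Im z \<noteq> 0"
  shows "\<exists>x. (f, x) \<in> resolvent H z"
proof -
  have lin: "linear_uop H" and adj: "uop_adj H = H" using H by (auto simp: selfadjoint_uop_def)
  define M where "M = {f. \<exists>x. (x, f + z *\<^sub>C x) \<in> H}"
  have est: "\<bar>Im z\<bar> * norm x \<le> norm f" if "(x, f + z *\<^sub>C x) \<in> H" for x f
  proof (cases "x = 0")
    case False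
    have "\<bar>Im z\<bar> * (norm x)\<^sup>2 = \<bar>Im (cinner f x)\<bar>"
      using selfadjoint_uop_quadratic[OF H that] by (simp add: abs_mult)
    also have "\<dots> \<le> norm f * norm x" using abs_Im_le_cmod norm_cinner_le order.trans by blast
    finally show ?thesis using False by (simp add: power2_eq_square)
  qed simp
  have diff: "(x - y, (f - g) + z *\<^sub>C (x - y)) \<in> H"
    if "(x, f + z *\<^sub>C x) \<in> H" "(y, g + z *\<^sub>C y) \<in> H" for x y f g
    using linear_uopD(2)[OF lin that(1) linear_uopD(3)[OF lin that(2), of "-1"]]
    by (simp add: scaleC_right_distrib scaleC_diff_right algebra_simps scaleC_minus1)
  have "complex_vector.subspace M"
  proof (rule complex_vector.subspaceI)
    show "0 \<in> M" using linear_uopD(1)[OF lin] by (auto simp: M_def intro!: exI[of _ 0])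
    fix f g c assume "f \<in> M"
    then obtain x where x: "(x, f + z *\<^sub>C x) \<in> H" by (auto simp: M_def)
    have "(c *\<^sub>C x, c *\<^sub>C f + z *\<^sub>C (c *\<^sub>C x)) \<in> H"
      using linear_uopD(3)[OF lin x, of c] by (simp add: scaleC_right_distrib scaleC_scaleC mult.commute)
    then show "c *\<^sub>C f \<in> M" unfolding M_def by blast
    assume "g \<in> M"
    then obtain y where y: "(y, g + z *\<^sub>C y) \<in> H" by (auto simp: M_def)
    have "(x + y, (f + g) + z *\<^sub>C (x + y)) \<in> H"
      using linear_uopD(2)[OF lin x y] by (simp add: scaleC_right_distrib algebra_simps)
    then show "f + g \<in> M" unfolding M_def by blast
  qed
  moreover have "closed M"
    unfolding closed_sequential_limits
  proof (intro allI impI, elim conjE)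
    fix X f assume X: "\<forall>n. X n \<in> M" "X \<longlonglongrightarrow> f"
    then obtain Y where Y: "\<And>n. (Y n, X n + z *\<^sub>C Y n) \<in> H" unfolding M_def by (auto simp: choice_iff)
    have "Cauchy Y"
    proof (rule metric_CauchyI)
      fix e :: real assume "0 < e"
      then have "0 < \<bar>Im z\<bar> * e" using z by simp
      then obtain N where N: "\<And>m n. N \<le> m \<Longrightarrow> N \<le> n \<Longrightarrow> dist (X m) (X n) < \<bar>Im z\<bar> * e"
        using LIMSEQ_imp_Cauchy[OF X(2)] unfolding Cauchy_def by blast
      have "dist (Y m) (Y n) < e" if "N \<le> m" "N \<le> n" for m n
      proof -
        have "\<bar>Im z\<bar> * norm (Y m - Y n) \<le> norm (X m - X n)" by (rule est[OF diff[OF Y Y]])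
        also have "\<dots> < \<bar>Im z\<bar> * e" using N[OF that] by (simp add: dist_norm)
        finally show ?thesis using z by (simp add: dist_norm)
      qed
      then show "\<exists>M. \<forall>m\<ge>M. \<forall>n\<ge>M. dist (Y m) (Y n) < e" by blast
    qed
    then have "convergent Y" by (simp only: Cauchy_convergent_iff)
    then obtain y where y: "Y \<longlonglongrightarrow> y" unfolding convergent_def by blast
    have "(y, f + z *\<^sub>C y) \<in> uop_adj H"
    proof (rule uop_adj_limit[OF _ y])
      show "(Y n, X n + z *\<^sub>C Y n) \<in> uop_adj H" for n using Y adj by simp
      show "(\<lambda>n. X n + z *\<^sub>C Y n) \<longlonglongrightarrow> f + z *\<^sub>C y" by (intro tendsto_intros X(2) y)
    qed
    then show "f \<in> M" unfolding adj M_def by blast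
  qed
  moreover have "v = 0" if v: "\<And>m. m \<in> M \<Longrightarrow> cinner m v = 0" for v
  proof -
    have "(v, cnj z *\<^sub>C v) \<in> uop_adj H"
    proof (rule uop_adjI)
      fix x u assume "(x, u) \<in> H"
      then have "(x, (u - z *\<^sub>C x) + z *\<^sub>C x) \<in> H" by simp
      then have "u - z *\<^sub>C x \<in> M" unfolding M_def by blast
      from v[OF this] show "cinner u v = cinner x (cnj z *\<^sub>C v)"
        by (simp add: cinner_diff_left cinner_scaleC_left cinner_scaleC_right)
    qed
    then have "(v, 0 + cnj z *\<^sub>C v) \<in> H" by (simp add: adj)
    from selfadjoint_uop_quadratic[OF H this] z show ?thesis by simp
  qed
  ultimately have "M = UNIV"
  proof (intro ccontr[of "M = UNIV"])
    assume M: "complex_vector.subspace M" "closed M" "\<And>v. (\<And>m. m \<in> M \<Longrightarrow> cinner m v = 0) \<Longrightarrow> v = 0"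
      "M \<noteq> UNIV"
    show False by (rule orthogonal_vector_exists[OF M(2,1,4)]) (use M(3) in blast)
  qed
  then have "f \<in> M" by simp
  then show ?thesis by (simp add: resolvent_iff M_def)
qed

lemma resolvent_adj:
  assumes H: "selfadjoint_uop H" and "(f, x) \<in> resolvent H z" "(g, y) \<in> resolvent H (cnj z)"
  shows "cinner x g = cinner f y"
  using selfadjoint_uop_symmetric[OF H assms(2,3)[unfolded resolvent_iff]]
  by (simp add: cinner_add_left cinner_add_right cinner_scaleC_left cinner_scaleC_right)

lemma dense_eqI:
  fixes f g :: "'a::topological_space \<Rightarrow> 'b::t2_space"
  assumes "closure D = UNIV" "continuous_on UNIV f" "continuous_on UNIV g" "\<And>x. x \<in> D \<Longrightarrow> f x = g x"
  shows "f x = g x"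
proof -
  have "closed {x. f x = g x}" using assms(2,3) by (rule closed_Collect_eq)
  then have "closure D \<subseteq> {x. f x = g x}" using assms(4) by (intro closure_minimal) auto
  then show ?thesis using assms(1) by auto
qed

section \<open>Sandwiched resolvents along the line\<close>

locale resonance_line =
  fixes F :: "('h::complex_hilbert, 'k::complex_hilbert) uop"
    and J :: "'k \<Rightarrow>\<^sub>L 'k" and V :: "('h, 'h) uop" and H :: "real \<Rightarrow> ('h, 'h) uop"
  assumes linF: "linear_uop F" and closedF: "closed F"
    and J: "selfadjoint_blinfun J"
    and V: "V = F O uop_of_blinfun J O uop_adj F" and linV: "linear_uop V"
    and H_line: "\<And>r. H r = uop_add (H 0) (uop_scale (of_real r) V)"
    and H: "\<And>r. selfadjoint_uop (H r)"
    and dom: "\<And>r. Domain (H r) \<subseteq> Domain F \<inter> Domain V"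
    and cpt: "\<And>r z. Im z \<noteq> 0 \<Longrightarrow>
           \<exists>T. compact_blinfun T \<and> uop_adj F O resolvent (H r) z O F \<subseteq> uop_of_blinfun T"
begin

abbreviation T :: "complex \<Rightarrow> real \<Rightarrow> 'k \<Rightarrow>\<^sub>L 'k" where
  "T z r \<equiv> sandwiched F (H r) z"

lemmas dense = dense_domain_adjoint[OF linF closedF]

lemma sandwich_exists:
  assumes z: "Im z \<noteq> 0" and u: "u \<in> Domain (uop_adj F)"
  obtains f x w where "(u, f) \<in> uop_adj F" "(f, x) \<in> resolvent (H r) z" "(x, w) \<in> F"
proof -
  obtain f where f: "(u, f) \<in> uop_adj F" using u by auto
  obtain x where x: "(f, x) \<in> resolvent (H r) z" using resolvent_total[OF H z] by blast
  then have "x \<in> Domain F" using dom[of r] unfolding resolvent_iff by blast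
  then show ?thesis using that f x by blast
qed

text \<open>Two bounded extensions agree on the dense domain of the adjoint, so the description in
  \<open>sandwiched\<close> denotes the operator supplied by the compactness assumption.\<close>

lemma T_spec: assumes z: "Im z \<noteq> 0"
  shows "compact_blinfun (T z r)" "uop_adj F O resolvent (H r) z O F \<subseteq> uop_of_blinfun (T z r)"
proof -
  obtain T0 where T0: "compact_blinfun T0" "uop_adj F O resolvent (H r) z O F \<subseteq> uop_of_blinfun T0"
    using cpt[OF z] by blast
  have "T' = T0" if T': "uop_adj F O resolvent (H r) z O F \<subseteq> uop_of_blinfun T'" for T'
  proof (rule blinfun_eqI)
    fix u
    show "T' u = T0 u"
    proof (rule dense_eqI[OF dense, where f = "blinfun_apply T'" and g = "blinfun_apply T0" and x = u])
      fix u assume "u \<in> Domain (uop_adj F)"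
      then obtain f x w where "(u, f) \<in> uop_adj F" "(f, x) \<in> resolvent (H r) z" "(x, w) \<in> F"
        using sandwich_exists[OF z] by blast
      then have "(u, w) \<in> uop_adj F O resolvent (H r) z O F" by blast
      then show "T' u = T0 u" using T' T0(2) by (auto simp: uop_of_blinfun_def)
    qed (intro continuous_intros)+
  qed
  then have "T z r = T0" unfolding sandwiched_def using T0(2) by (intro the_equality)
  then show "compact_blinfun (T z r)" "uop_adj F O resolvent (H r) z O F \<subseteq> uop_of_blinfun (T z r)"
    using T0 by (simp_all only:)
qed

lemma T_apply:
  assumes "Im z \<noteq> 0" "(u, f) \<in> uop_adj F" "(f, x) \<in> resolvent (H r) z" "(x, w) \<in> F"
  shows "T z r u = w"
proof -
  have "(u, w) \<in> uop_adj F O resolvent (H r) z O F" using assms by blast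
  then show ?thesis using T_spec(2)[OF assms(1), of r] by (auto simp: uop_of_blinfun_def)
qed

lemma T_clinear: assumes z: "Im z \<noteq> 0" shows "clinear_blinfun (T z r)"
  unfolding clinear_blinfun_def
proof (intro allI)
  fix c u
  have lin: "linear_uop (H r)" using H by (simp add: selfadjoint_uop_def)
  show "T z r (c *\<^sub>C u) = c *\<^sub>C T z r u"
  proof (rule dense_eqI[OF dense, where f = "\<lambda>u. T z r (c *\<^sub>C u)" and g = "\<lambda>u. c *\<^sub>C T z r u" and x = u])
    show "continuous_on UNIV (\<lambda>u. T z r (c *\<^sub>C u))" "continuous_on UNIV (\<lambda>u. c *\<^sub>C T z r u)"
      by (intro continuous_intros)+
    fix u assume "u \<in> Domain (uop_adj F)"
    then obtain f x w where *: "(u, f) \<in> uop_adj F" "(f, x) \<in> resolvent (H r) z" "(x, w) \<in> F"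
      using sandwich_exists[OF z] by blast
    have "(c *\<^sub>C f, c *\<^sub>C x) \<in> resolvent (H r) z"
      using linear_uopD(3)[OF lin *(2)[unfolded resolvent_iff], of c]
      unfolding resolvent_iff by (simp add: scaleC_right_distrib scaleC_scaleC mult.commute)
    from T_apply[OF z uop_adj_scaleC[OF *(1)] this linear_uopD(3)[OF linF *(3)]] T_apply[OF z *]
    show "T z r (c *\<^sub>C u) = c *\<^sub>C T z r u" by simp
  qed
qed

lemma T_approximable: "Im z \<noteq> 0 \<Longrightarrow> approximable (T z r)"
  by (rule compact_approximable[OF T_spec(1) T_clinear])

lemma T_adj: assumes z: "Im z \<noteq> 0" shows "is_adj (T z r) (T (cnj z) r)"
  unfolding is_adj_def
proof (intro allI)
  fix u u'
  have z': "Im (cnj z) \<noteq> 0" using z by simp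
  show "cinner (T z r u) u' = cinner u (T (cnj z) r u')"
  proof (rule dense_eqI[OF dense, where f = "\<lambda>u. cinner (T z r u) u'" and g = "\<lambda>u. cinner u (T (cnj z) r u')" and x = u])
    show "continuous_on UNIV (\<lambda>u. cinner (T z r u) u')" "continuous_on UNIV (\<lambda>u. cinner u (T (cnj z) r u'))"
      by (intro continuous_intros)+
    fix u assume "u \<in> Domain (uop_adj F)"
    then obtain f x w where *: "(u, f) \<in> uop_adj F" "(f, x) \<in> resolvent (H r) z" "(x, w) \<in> F"
      using sandwich_exists[OF z] by blast
    show "cinner (T z r u) u' = cinner u (T (cnj z) r u')"
    proof (rule dense_eqI[OF dense, where f = "\<lambda>u'. cinner (T z r u) u'" and g = "\<lambda>u'. cinner u (T (cnj z) r u')" and x = "u'"])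
      show "continuous_on UNIV (\<lambda>u'. cinner (T z r u) u')" "continuous_on UNIV (\<lambda>u'. cinner u (T (cnj z) r u'))"
        by (intro continuous_intros)+
      fix u' assume "u' \<in> Domain (uop_adj F)"
      then obtain f' x' w' where q: "(u', f') \<in> uop_adj F" "(f', x') \<in> resolvent (H r) (cnj z)" "(x', w') \<in> F"
        using sandwich_exists[OF z'] by blast
      have "cinner w u' = cinner x f'" by (rule uop_adjD[OF q(1) *(3)])
      also have "\<dots> = cinner f x'" by (rule resolvent_adj[OF H *(2) q(2)])
      also have "\<dots> = cinner u w'"
        using uop_adjD[OF *(1) q(3)] cinner_commute[of f x'] cinner_commute[of u w'] by simp
      finally show "cinner (T z r u) u' = cinner u (T (cnj z) r u')"
        by (simp add: T_apply[OF z *] T_apply[OF z' q])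
    qed
  qed
qed

lemma T_quadratic:
  assumes z: "Im z \<noteq> 0" and u: "(u, f) \<in> uop_adj F" "(f, x) \<in> resolvent (H r) z"
  shows "Im (cinner u (T z r u)) = Im z * (norm x)\<^sup>2"
proof -
  have "x \<in> Domain F" using u(2) dom[of r] unfolding resolvent_iff by blast
  then obtain w where w: "(x, w) \<in> F" by auto
  have "cinner w u = cinner x f" by (rule uop_adjD[OF u(1) w])
  then have "cinner u w = cinner f x" using cinner_commute[of u w] cinner_commute[of f x] by simp
  then show ?thesis
    using selfadjoint_uop_quadratic[OF H u(2)[unfolded resolvent_iff]] T_apply[OF z u w] by simp
qed

text \<open>\<open>T_quadratic\<close> is available only on the domain of the adjoint, so a general
  \<open>u\<close> is approached by vectors from it. Convergence is claimed for the quadratic form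
  only, not for \<open>f\<close> or \<open>x\<close>.\<close>

lemma T_sequence:
  assumes z: "Im z \<noteq> 0"
  shows "\<exists>U f x. U \<longlonglongrightarrow> u \<and> (\<forall>n. (U n, f n) \<in> uop_adj F \<and> (f n, x n) \<in> resolvent (H r) z) \<and>
    (\<lambda>n. Im z * (norm (x n))\<^sup>2) \<longlonglongrightarrow> Im (cinner u (T z r u))"
proof -
  have "u \<in> closure (Domain (uop_adj F))" using dense by simp
  then obtain U where U: "\<forall>n. U n \<in> Domain (uop_adj F)" "U \<longlonglongrightarrow> u" unfolding closure_sequential by blast
  have "\<forall>n. \<exists>p. (U n, fst p) \<in> uop_adj F \<and> (fst p, snd p) \<in> resolvent (H r) z"
  proof
    fix n
    obtain f x w where "(U n, f) \<in> uop_adj F" "(f, x) \<in> resolvent (H r) z" "(x, w) \<in> F"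
      by (rule sandwich_exists[OF z U(1)[rule_format]])
    then show "\<exists>p. (U n, fst p) \<in> uop_adj F \<and> (fst p, snd p) \<in> resolvent (H r) z"
      by (intro exI[of _ "(f, x)"]) simp
  qed
  then obtain p where p: "\<forall>n. (U n, fst (p n)) \<in> uop_adj F \<and> (fst (p n), snd (p n)) \<in> resolvent (H r) z"
    by (rule choice[THEN exE])
  have "(\<lambda>n. Im (cinner (U n) (T z r (U n)))) \<longlonglongrightarrow> Im (cinner u (T z r u))"
    by (intro tendsto_intros U(2))
  moreover have "Im (cinner (U n) (T z r (U n))) = Im z * (norm (snd (p n)))\<^sup>2" for n
    using p by (intro T_quadratic[OF z]) auto
  ultimately show ?thesis using U(2) p
    by (intro exI[of _ U] exI[of _ "\<lambda>n. fst (p n)"] exI[of _ "\<lambda>n. snd (p n)"]) simp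
qed

lemma T_dissipative: assumes z: "Im z \<noteq> 0" shows "0 \<le> Im z * Im (cinner u (T z r u))"
proof -
  obtain x :: "nat \<Rightarrow> 'h" where *: "(\<lambda>n. Im z * (norm (x n))\<^sup>2) \<longlonglongrightarrow> Im (cinner u (T z r u))"
    using T_sequence[OF z, of u r] by (elim exE conjE) (rule that)
  have "(\<lambda>n. Im z * (Im z * (norm (x n))\<^sup>2)) \<longlonglongrightarrow> Im z * Im (cinner u (T z r u))"
    by (intro tendsto_intros *)
  then show ?thesis
    by (rule tendsto_lowerbound) (auto simp: mult.assoc[symmetric] simp flip: power2_eq_square)
qed

text \<open>Vanishing dissipation makes \<open>x n\<close> tend to 0, while its image
  \<open>T z r (U n)\<close> under \<open>F\<close> tends to \<open>T z r u\<close>; closedness puts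
  \<open>(0, T z r u)\<close> into the graph of \<open>F\<close>.\<close>

lemma T_strict: assumes z: "Im z \<noteq> 0" and zero: "Im (cinner u (T z r u)) = 0" shows "T z r u = 0"
proof -
  obtain U f x where *: "U \<longlonglongrightarrow> u" "\<And>n. (U n, f n) \<in> uop_adj F" "\<And>n. (f n, x n) \<in> resolvent (H r) z"
    "(\<lambda>n. Im z * (norm (x n))\<^sup>2) \<longlonglongrightarrow> 0"
    using T_sequence[OF z, of u r] unfolding zero by blast
  have "(\<lambda>n. (norm (x n))\<^sup>2) \<longlonglongrightarrow> 0"
    using tendsto_mult[OF tendsto_const[of "inverse (Im z)"] *(4)] z by (simp add: mult.assoc[symmetric])
  then have "(\<lambda>n. sqrt ((norm (x n))\<^sup>2)) \<longlonglongrightarrow> sqrt 0" by (intro tendsto_intros)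
  then have x: "x \<longlonglongrightarrow> 0" by (simp add: tendsto_norm_zero_iff)
  have "(x n, T z r (U n)) \<in> F" for n
  proof -
    have "x n \<in> Domain F" using *(3)[of n] dom[of r] unfolding resolvent_iff by blast
    then obtain w where w: "(x n, w) \<in> F" by auto
    then show ?thesis using T_apply[OF z *(2,3) w] by simp
  qed
  moreover have "(\<lambda>n. (x n, T z r (U n))) \<longlonglongrightarrow> (0, T z r u)"
    by (intro tendsto_intros x *(1))
  ultimately have "(0, T z r u) \<in> F" by (rule closed_sequentially[OF closedF])
  from linear_uopD(4)[OF linF this linear_uopD(1)[OF linF]] show ?thesis .
qed

lemma H_shift:
  assumes "(x, h) \<in> H r" "(x, v) \<in> V"
  shows "(x, h + of_real (s - r) *\<^sub>C v) \<in> H s"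
proof -
  have "(x, h) \<in> uop_add (H 0) (uop_scale (of_real r) V)" using assms(1) H_line[of r] by simp
  then obtain h0 v' where h0: "(x, h0) \<in> H 0" "(x, v') \<in> V" "h = h0 + of_real r *\<^sub>C v'"
    unfolding uop_add_def uop_scale_def by auto
  have "v' = v" by (rule linear_uopD(4)[OF linV h0(2) assms(2)])
  then have "h + of_real (s - r) *\<^sub>C v = h0 + of_real s *\<^sub>C v"
    using h0(3) by (simp add: scaleC_diff_left)
  moreover have "(x, h0 + of_real s *\<^sub>C v) \<in> H s"
    using h0(1) assms(2) unfolding H_line[of s] uop_add_def uop_scale_def by blast
  ultimately show ?thesis by simp
qed

text \<open>The second resolvent identity, with \<open>V\<close> factored through \<open>F\<close>
  so that only sandwiched resolvents occur. It is checked on the domain of the adjoint and extended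
  by density.\<close>

lemma T_resolvent_identity:
  assumes z: "Im z \<noteq> 0"
  shows "T z r - T z s = of_real (s - r) *\<^sub>C (T z s o\<^sub>L (J o\<^sub>L T z r))"
proof (rule blinfun_eqI)
  fix u
  have lin: "linear_uop (H s)" using H by (simp add: selfadjoint_uop_def)
  have "T z r u - T z s u = of_real (s - r) *\<^sub>C T z s (J (T z r u))"
  proof (rule dense_eqI[OF dense, where f = "\<lambda>u. T z r u - T z s u" and g = "\<lambda>u. of_real (s - r) *\<^sub>C T z s (J (T z r u))" and x = u])
    show "continuous_on UNIV (\<lambda>u. T z r u - T z s u)" "continuous_on UNIV (\<lambda>u. of_real (s - r) *\<^sub>C T z s (J (T z r u)))"
      by (intro continuous_intros)+
    fix u assume "u \<in> Domain (uop_adj F)"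
    then obtain f x w where *: "(u, f) \<in> uop_adj F" "(f, x) \<in> resolvent (H r) z" "(x, w) \<in> F"
      using sandwich_exists[OF z] by blast
    have Tr: "T z r u = w" by (rule T_apply[OF z *])
    have "x \<in> Domain V" using *(2) dom[of r] unfolding resolvent_iff by blast
    then obtain v where v: "(x, v) \<in> V" by auto
    \<comment> \<open>By the factorization of \<open>V\<close>, membership of \<open>x\<close> in
      its domain places \<open>J w\<close> in the domain of the adjoint, so \<open>T z s\<close> can
      be evaluated there by \<open>T_apply\<close>.\<close>
    then obtain w' where "(x, w') \<in> F" "(J w', v) \<in> uop_adj F" unfolding V by (auto simp: uop_of_blinfun_def)
    moreover have "w' = w" if "(x, w') \<in> F" for w' using linear_uopD(4)[OF linF that *(3)] .
    ultimately have Jw: "(J w, v) \<in> uop_adj F" by blast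
    obtain x' where x': "(v, x') \<in> resolvent (H s) z" using resolvent_total[OF H z] by blast
    have "x' \<in> Domain F" using x' dom[of s] unfolding resolvent_iff by blast
    then obtain w'' where w'': "(x', w'') \<in> F" by auto
    have Ts: "T z s (J w) = w''" by (rule T_apply[OF z Jw x' w''])
    define c :: complex where "c = of_real (s - r)"
    have "(x, (f + z *\<^sub>C x) + c *\<^sub>C v) \<in> H s"
      unfolding c_def by (rule H_shift[OF *(2)[unfolded resolvent_iff] v])
    from linear_uopD(2)[OF lin this linear_uopD(3)[OF lin x'[unfolded resolvent_iff], of "- c"]]
    have "(x - c *\<^sub>C x', f + z *\<^sub>C (x - c *\<^sub>C x')) \<in> H s"
      by (simp add: scaleC_right_distrib scaleC_diff_right scaleC_scaleC mult.commute algebra_simps)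
    then have "(f, x - c *\<^sub>C x') \<in> resolvent (H s) z" unfolding resolvent_iff .
    moreover have "(x - c *\<^sub>C x', w - c *\<^sub>C w'') \<in> F"
      using linear_uopD(2)[OF linF *(3) linear_uopD(3)[OF linF w'', of "- c"]] by simp
    ultimately have "T z s u = w - c *\<^sub>C w''" by (rule T_apply[OF z *(1)])
    then show "T z r u - T z s u = of_real (s - r) *\<^sub>C T z s (J (T z r u))"
      unfolding c_def[symmetric] by (simp add: Tr Ts)
  qed
  then show "(T z r - T z s) u = (of_real (s - r) *\<^sub>C (T z s o\<^sub>L (J o\<^sub>L T z r))) u"
    by (simp add: blinfun.diff_left)
qed

end

section \<open>Resolvent families along the line, boundary values and the index\<close>

section \<open>The resolvent families of the line\<close>

text \<open>The two identities say that 1 - (s - r) Ts J is a right and a left inverse of the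
  pencil; substituting it into \<open>pres\<close> leaves Ts J. The same holds with \<open>J\<close>
  on the other side.\<close>

lemma pres_line:
  fixes T0 Ts J :: "'a::complex_normed_vector \<Rightarrow>\<^sub>L 'a"
  assumes lin: "clinear_blinfun T0" "clinear_blinfun Ts" "clinear_blinfun J"
    and id: "T0 - Ts = (s - r) *\<^sub>C (Ts o\<^sub>L (J o\<^sub>L T0))" "T0 - Ts = (s - r) *\<^sub>C (T0 o\<^sub>L (J o\<^sub>L Ts))"
  shows "invertible_op (pencil (T0 o\<^sub>L J) r s)" "pres (T0 o\<^sub>L J) r s = Ts o\<^sub>L J"
    "invertible_op (pencil (J o\<^sub>L T0) r s)" "pres (J o\<^sub>L T0) r s = J o\<^sub>L Ts"
proof -
  define c where "c = s - r"
  note l = clinear_blinfunD[OF lin(1)] clinear_blinfunD[OF lin(2)] clinear_blinfunD[OF lin(3)]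
  have 1: "c *\<^sub>C Ts (J (T0 x)) = T0 x - Ts x" for x
    using id(1)[THEN arg_cong[of _ _ "\<lambda>T. blinfun_apply T x"]] by (simp add: c_def blinfun.diff_left)
  have 2: "c *\<^sub>C T0 (J (Ts x)) = T0 x - Ts x" for x
    using id(2)[THEN arg_cong[of _ _ "\<lambda>T. blinfun_apply T x"]] by (simp add: c_def blinfun.diff_left)
  have J1: "c *\<^sub>C J (Ts (J (T0 x))) = J (T0 x) - J (Ts x)" and J2: "c *\<^sub>C J (T0 (J (Ts x))) = J (T0 x) - J (Ts x)" for x
    using arg_cong[OF 1[of x], of "blinfun_apply J"] arg_cong[OF 2[of x], of "blinfun_apply J"]
    by (simp_all add: l blinfun.diff_right)
  have N: "is_inverse (pencil (T0 o\<^sub>L J) r s) (one_op - c *\<^sub>C (Ts o\<^sub>L J))"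
    unfolding is_inverse_def
    by (intro conjI blinfun_eqI)
       (simp_all add: pencil_apply blinfun.diff_left blinfun.diff_right blinfun.add_right l 1 2
          scaleC_right_distrib scaleC_diff_right flip: c_def)
  have N': "is_inverse (pencil (J o\<^sub>L T0) r s) (one_op - c *\<^sub>C (J o\<^sub>L Ts))"
    unfolding is_inverse_def
    by (intro conjI blinfun_eqI)
       (simp_all add: pencil_apply blinfun.diff_left blinfun.diff_right blinfun.add_right l J1 J2
          scaleC_right_distrib scaleC_diff_right flip: c_def)
  show "invertible_op (pencil (T0 o\<^sub>L J) r s)" "invertible_op (pencil (J o\<^sub>L T0) r s)"
    using N N' by (auto intro: invertible_opI)
  show "pres (T0 o\<^sub>L J) r s = Ts o\<^sub>L J"
    unfolding pres_eqI[OF N] by (intro blinfun_eqI) (simp add: blinfun.diff_left 1)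
  show "pres (J o\<^sub>L T0) r s = J o\<^sub>L Ts"
    unfolding pres_eqI[OF N'] by (intro blinfun_eqI) (simp add: blinfun.diff_left J1)
qed

text \<open>An injective pencil is nilpotent only on 0. So points that are not poles contribute rank
  0 and may be added freely to sums over poles.\<close>

lemma crank_rproj_invertible:
  assumes K: "approximable K" "clinear_blinfun K" and inv: "invertible_op (pencil K r w)"
  shows "crank (rproj K r w) = 0"
proof -
  obtain n where n: "\<And>x. opow (pencil K r w) n (rproj K r w x) = 0"
    using rproj_nilpotent[OF K, of r w] by blast
  have inj: "opow (pencil K r w) m x = 0 \<Longrightarrow> x = 0" for m x
  proof (induction m)
    case (Suc m)
    then have "pencil K r w (opow (pencil K r w) m x) = 0" by simp
    then have "opow (pencil K r w) m x = 0"
      using is_inverse_apply(2)[OF is_inverse_inv_op[OF inv], of "opow (pencil K r w) m x"] by simp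
    then show ?case by (rule Suc.IH)
  qed simp
  have "range (rproj K r w) \<subseteq> complex_vector.span {}" using inj[OF n] by auto
  then have "cdim (range (rproj K r w)) \<le> card ({} :: 'a set)"
    by (rule complex_vector.dim_le_card) simp
  then show ?thesis by (simp add: crank_def)
qed

lemma sum_crank_cnj:
  fixes S T J :: "'a::complex_hilbert \<Rightarrow>\<^sub>L 'a"
  assumes T: "approximable T" "clinear_blinfun T" and S: "approximable S" "clinear_blinfun S"
    and adj: "is_adj T S" and J: "clinear_blinfun J" "is_adj J J" and r: "cnj r = r" and X: "bounded X"
  shows "(\<Sum>w\<in>poles_in (S o\<^sub>L J) r (cnj ` X). crank (rproj (S o\<^sub>L J) r w))
       = (\<Sum>w\<in>poles_in (T o\<^sub>L J) r X. crank (rproj (T o\<^sub>L J) r w))"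
proof -
  have TJ: "approximable (T o\<^sub>L J)" "clinear_blinfun (T o\<^sub>L J)"
    and SJ: "approximable (S o\<^sub>L J)" "clinear_blinfun (S o\<^sub>L J)"
    using T S J(1) approximable_compose by auto
  have "bounded (cnj ` X)" using X by (auto simp: bounded_iff)
  then have fin: "finite (poles_in (T o\<^sub>L J) r X)" "finite (poles_in (S o\<^sub>L J) r (cnj ` X))"
    using X by (simp_all add: finite_poles_in[OF TJ] finite_poles_in[OF SJ])
  \<comment> \<open>A common index set for both sums, containing the poles of one family and the
    reflected poles of the other; surplus points contribute 0.\<close>
  define W where "W = poles_in (T o\<^sub>L J) r X \<union> cnj ` poles_in (S o\<^sub>L J) r (cnj ` X)"
  have W: "finite W" "W \<subseteq> X" using fin by (auto simp: W_def poles_in_def)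
  have "(\<Sum>w\<in>poles_in (T o\<^sub>L J) r X. crank (rproj (T o\<^sub>L J) r w)) = (\<Sum>w\<in>W. crank (rproj (T o\<^sub>L J) r w))"
    using W by (intro sum.mono_neutral_left) (auto simp: W_def poles_in_def intro!: crank_rproj_invertible[OF TJ])
  also have "\<dots> = (\<Sum>w\<in>W. crank (rproj (S o\<^sub>L J) r (cnj w)))"
    using crank_rproj_cnj[OF T S adj J r] by simp
  also have "\<dots> = (\<Sum>w\<in>cnj ` W. crank (rproj (S o\<^sub>L J) r w))"
    by (simp add: sum.reindex inj_on_def)
  also have "\<dots> = (\<Sum>w\<in>poles_in (S o\<^sub>L J) r (cnj ` X). crank (rproj (S o\<^sub>L J) r w))"
  proof (rule sum.mono_neutral_right)
    show "finite (cnj ` W)" using W(1) by simp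
    show "poles_in (S o\<^sub>L J) r (cnj ` X) \<subseteq> cnj ` W"
    proof
      fix w assume "w \<in> poles_in (S o\<^sub>L J) r (cnj ` X)"
      then have "cnj w \<in> W" by (simp add: W_def)
      then show "w \<in> cnj ` W" by (rule rev_image_eqI) simp
    qed
    show "\<forall>w\<in>cnj ` W - poles_in (S o\<^sub>L J) r (cnj ` X). crank (rproj (S o\<^sub>L J) r w) = 0"
    proof
      fix w assume w: "w \<in> cnj ` W - poles_in (S o\<^sub>L J) r (cnj ` X)"
      then have "w \<in> cnj ` X" using W(2) by blast
      then have "invertible_op (pencil (S o\<^sub>L J) r w)" using w by (simp add: poles_in_def)
      then show "crank (rproj (S o\<^sub>L J) r w) = 0" by (rule crank_rproj_invertible[OF SJ])
    qed
  qed
  finally show ?thesis by simp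
qed

lemma eventually_const_unique:
  fixes f :: "real \<Rightarrow> real \<Rightarrow> 'a"
  assumes "\<forall>\<^sub>F \<epsilon> in at_right 0. \<forall>\<^sub>F y in at_right 0. f \<epsilon> y = M"
    and "\<forall>\<^sub>F \<epsilon> in at_right 0. \<forall>\<^sub>F y in at_right 0. f \<epsilon> y = N"
  shows "M = N"
proof -
  have "\<forall>\<^sub>F \<epsilon> in at_right (0::real). \<forall>\<^sub>F y in at_right (0::real). M = N"
    using assms
  proof eventually_elim
    case (elim \<epsilon>)
    then show ?case by eventually_elim simp
  qed
  then show ?thesis by simp
qed

context resonance_line
begin

lemmas linJ = selfadjointD(1)[OF J]

lemma adjJ: "is_adj J J"
  using selfadjointD(2)[OF J] by (simp add: is_adj_def)

lemma T_pencil: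
  assumes z: "Im z \<noteq> 0"
  shows "invertible_op (pencil (T z r o\<^sub>L J) (of_real r) (of_real s))"
    "pres (T z r o\<^sub>L J) (of_real r) (of_real s) = T z s o\<^sub>L J"
proof -
  have id: "T z r - T z s = (of_real s - of_real r) *\<^sub>C (T z s o\<^sub>L (J o\<^sub>L T z r))"
    using T_resolvent_identity[OF z, of r s] by simp
  have "T z s - T z r = (of_real r - of_real s) *\<^sub>C (T z r o\<^sub>L (J o\<^sub>L T z s))"
    using T_resolvent_identity[OF z, of s r] by simp
  from arg_cong[OF this, of uminus]
  have id': "T z r - T z s = (of_real s - of_real r) *\<^sub>C (T z r o\<^sub>L (J o\<^sub>L T z s))"
    by (simp flip: complex_vector.scale_minus_left)
  show "invertible_op (pencil (T z r o\<^sub>L J) (of_real r) (of_real s))"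
    "pres (T z r o\<^sub>L J) (of_real r) (of_real s) = T z s o\<^sub>L J"
    using pres_line[OF T_clinear[OF z] T_clinear[OF z] linJ id id'] by simp_all
qed

text \<open>\<open>G y\<close> is \<open>\<lambda> + iy\<close> or \<open>\<lambda> - iy\<close>.\<close>

context
  fixes G :: "real \<Rightarrow> complex"
  assumes G: "\<And>y. 0 < y \<Longrightarrow> Im (G y) \<noteq> 0"
begin

lemma eventually_G: "(\<And>y. Im (G y) \<noteq> 0 \<Longrightarrow> P y) \<Longrightarrow> \<forall>\<^sub>F y in at_right 0. P y"
  using G by (auto intro: eventually_mono[OF eventually_at_right_less])

lemma limit_op:
  assumes "((\<lambda>y. T (G y) r) \<longlongrightarrow> A) (at_right 0)"
  shows "approximable A" "clinear_blinfun A"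
  by (rule approximable_limit[OF assms trivial_limit_at_right_real], rule eventually_G, erule T_approximable,
      rule clinear_blinfun_limit[OF assms trivial_limit_at_right_real], rule eventually_G, erule T_clinear)

lemma limit_identity:
  assumes A: "((\<lambda>y. T (G y) r) \<longlongrightarrow> A) (at_right 0)" and B: "((\<lambda>y. T (G y) s) \<longlongrightarrow> B) (at_right 0)"
  shows "A - B = (of_real s - of_real r) *\<^sub>C (B o\<^sub>L (J o\<^sub>L A))"
proof (rule tendsto_unique[OF trivial_limit_at_right_real])
  show "((\<lambda>y. T (G y) r - T (G y) s) \<longlongrightarrow> A - B) (at_right 0)" by (intro tendsto_intros A B)
  have "((\<lambda>y. (of_real s - of_real r) *\<^sub>C (T (G y) s o\<^sub>L (J o\<^sub>L T (G y) r)))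
      \<longlongrightarrow> (of_real s - of_real r) *\<^sub>C (B o\<^sub>L (J o\<^sub>L A))) (at_right 0)"
    by (intro tendsto_intros bounded_bilinear.tendsto[OF bounded_bilinear_blinfun_compose] A B)
  then show "((\<lambda>y. T (G y) r - T (G y) s) \<longlongrightarrow> (of_real s - of_real r) *\<^sub>C (B o\<^sub>L (J o\<^sub>L A))) (at_right 0)"
  proof (rule Lim_transform_eventually)
    show "\<forall>\<^sub>F y in at_right 0. (of_real s - of_real r) *\<^sub>C (T (G y) s o\<^sub>L (J o\<^sub>L T (G y) r)) = T (G y) r - T (G y) s"
      by (rule eventually_G) (simp add: T_resolvent_identity)
  qed
qed

lemma limit_pres:
  assumes A: "((\<lambda>y. T (G y) r) \<longlongrightarrow> A) (at_right 0)" and B: "((\<lambda>y. T (G y) s) \<longlongrightarrow> B) (at_right 0)"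
  shows "pres (A o\<^sub>L J) (of_real r) (of_real s) = B o\<^sub>L J" "pres (J o\<^sub>L A) (of_real r) (of_real s) = J o\<^sub>L B"
proof -
  from arg_cong[OF limit_identity[OF B A], of uminus]
  have id': "A - B = (of_real s - of_real r) *\<^sub>C (A o\<^sub>L (J o\<^sub>L B))"
    by (simp flip: complex_vector.scale_minus_left)
  show "pres (A o\<^sub>L J) (of_real r) (of_real s) = B o\<^sub>L J" "pres (J o\<^sub>L A) (of_real r) (of_real s) = J o\<^sub>L B"
    using pres_line[OF limit_op(2)[OF A] limit_op(2)[OF B] linJ limit_identity[OF A B] id'] by simp_all
qed

text \<open>The resolvent identity expresses \<open>T (G y) s\<close> through
  \<open>T (G y) r\<close> and the resolvent family, and both converge where the limiting pencil is
  invertible. Thus regularity at \<open>r\<close> spreads to neighbouring values.\<close>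

lemma limit_nearby:
  assumes A: "((\<lambda>y. T (G y) r) \<longlongrightarrow> A) (at_right 0)"
    and inv: "invertible_op (pencil (A o\<^sub>L J) (of_real r) (of_real s))"
  shows "\<exists>B. ((\<lambda>y. T (G y) s) \<longlongrightarrow> B) (at_right 0)"
proof -
  define K K0 where "K y = T (G y) r o\<^sub>L J" and "K0 = A o\<^sub>L J" for y
  define c :: complex where "c = of_real s - of_real r"
  define N where "N = inv_op (pencil K0 (of_real r) (of_real s))"
  define M where "M = norm N + 1"
  have M: "0 < M" "norm N \<le> M" by (simp_all add: M_def add_nonneg_pos)
  have N: "is_inverse (pencil K0 (of_real r) (of_real s)) N"
    using inv unfolding N_def K0_def by (rule is_inverse_inv_op)
  have linK0: "clinear_blinfun K0" using limit_op(2)[OF A] linJ by (auto simp: K0_def)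
  have Klim: "(K \<longlongrightarrow> K0) (at_right 0)"
    unfolding K_def K0_def by (intro bounded_bilinear.tendsto[OF bounded_bilinear_blinfun_compose] A tendsto_const)
  then have dK: "((\<lambda>y. norm (K y - K0)) \<longlongrightarrow> 0) (at_right 0)"
    by (simp add: tendsto_norm_zero_iff LIM_zero_iff)
  have "((\<lambda>y. cmod c * norm (K y - K0) * M) \<longlongrightarrow> cmod c * 0 * M) (at_right 0)"
    by (intro tendsto_intros dK)
  then have small: "\<forall>\<^sub>F y in at_right 0. cmod c * norm (K y - K0) * M < 1/2"
    by (rule order_tendstoD) simp
  have lin: "\<forall>\<^sub>F y in at_right 0. clinear_blinfun (K y)"
    by (rule eventually_G) (auto simp: K_def linJ T_clinear)
  have "\<forall>\<^sub>F y in at_right 0. norm (pres (K y) (of_real r) (of_real s) - pres K0 (of_real r) (of_real s)) \<le> 2 * M * M * norm (K y - K0)"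
    using small lin
  proof eventually_elim
    case (elim y)
    show ?case using pres_perturb(2)[OF linK0 elim(2) N M(2) _ M(1)] elim(1) by (simp add: c_def)
  qed
  moreover have "((\<lambda>y. 2 * M * M * norm (K y - K0)) \<longlongrightarrow> 0) (at_right 0)"
    using tendsto_mult_right_zero[OF dK] by simp
  ultimately have "((\<lambda>y. pres (K y) (of_real r) (of_real s) - pres K0 (of_real r) (of_real s)) \<longlongrightarrow> 0) (at_right 0)"
    by (rule Lim_null_comparison)
  then have pres_lim: "((\<lambda>y. pres (K y) (of_real r) (of_real s)) \<longlongrightarrow> pres K0 (of_real r) (of_real s)) (at_right 0)"
    by (simp add: LIM_zero_iff)
  have "((\<lambda>y. T (G y) r - c *\<^sub>C (pres (K y) (of_real r) (of_real s) o\<^sub>L T (G y) r))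
      \<longlongrightarrow> A - c *\<^sub>C (pres K0 (of_real r) (of_real s) o\<^sub>L A)) (at_right 0)"
    by (intro tendsto_intros bounded_bilinear.tendsto[OF bounded_bilinear_blinfun_compose] A pres_lim)
  then have "((\<lambda>y. T (G y) s) \<longlongrightarrow> A - c *\<^sub>C (pres K0 (of_real r) (of_real s) o\<^sub>L A)) (at_right 0)"
  proof (rule Lim_transform_eventually)
    show "\<forall>\<^sub>F y in at_right 0. T (G y) r - c *\<^sub>C (pres (K y) (of_real r) (of_real s) o\<^sub>L T (G y) r) = T (G y) s"
    proof (rule eventually_G)
      fix y assume y: "Im (G y) \<noteq> 0"
      have "T (G y) r - T (G y) s = c *\<^sub>C (T (G y) s o\<^sub>L (J o\<^sub>L T (G y) r))"
        using T_resolvent_identity[OF y, of r s] by (simp add: c_def)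
      then show "T (G y) r - c *\<^sub>C (pres (K y) (of_real r) (of_real s) o\<^sub>L T (G y) r) = T (G y) s"
        by (simp add: K_def T_pencil(2)[OF y] compose_simps(1) diff_eq_eq add.commute)
    qed
  qed
  then show ?thesis by blast
qed

end

abbreviation up :: "real \<Rightarrow> real \<Rightarrow> complex" where "up l y \<equiv> Complex l y"
abbreviation down :: "real \<Rightarrow> real \<Rightarrow> complex" where "down l y \<equiv> Complex l (- y)"

lemma Im_up: "0 < y \<Longrightarrow> Im (up l y) \<noteq> 0" and Im_down: "0 < y \<Longrightarrow> Im (down l y) \<noteq> 0"
  by simp_all

lemma regular_limits:
  assumes "l \<in> regular_set (H s) F"
  shows "((\<lambda>y. T (up l y) s) \<longlongrightarrow> T_op F (Above l) (H s)) (at_right 0)"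
    "((\<lambda>y. T (down l y) s) \<longlongrightarrow> T_op F (Below l) (H s)) (at_right 0)"
  using assms tendsto_Lim[OF trivial_limit_at_right_real] unfolding regular_set_def by auto

text \<open>Uniqueness of the extension needs a limit point of the set of regular values, and a
  single regular \<open>r\<close> has to be shown to be one. Regularity asks for both boundary
  limits, hence the intersection in \<open>U\<close>.\<close>

lemma regular_islimpt:
  assumes reg: "l \<in> regular_set (H r) F"
  shows "r islimpt {s. l \<in> regular_set (H s) F}"
proof -
  note A = regular_limits[OF reg]
  define U where "U = {s. invertible_op (pencil (T_op F (Above l) (H r) o\<^sub>L J) (of_real r) s)} \<inter>
    {s. invertible_op (pencil (T_op F (Below l) (H r) o\<^sub>L J) (of_real r) s)}"
  have "open U" unfolding U_def by (intro open_Int open_invertible_pencil)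
  moreover have "of_real r \<in> U"
    unfolding U_def by (auto simp: pencil_def is_inverse_def compose_simps intro!: invertible_opI[of _ one_op])
  ultimately obtain e where e: "0 < e" "ball (of_real r) e \<subseteq> U" using open_contains_ball by blast
  have reg': "l \<in> regular_set (H s) F" if "\<bar>s - r\<bar> < e" for s
  proof -
    have "of_real s \<in> ball (complex_of_real r) e" using that by (simp add: dist_norm norm_minus_commute flip: of_real_diff)
    then have "of_real s \<in> U" using e(2) by blast
    then show ?thesis
      using limit_nearby[OF Im_up A(1), of s] limit_nearby[OF Im_down A(2), of s]
      unfolding U_def regular_set_def by auto
  qed
  show ?thesis
    unfolding islimpt_approachable
  proof (intro allI impI)
    fix d :: real assume "0 < d"
    then show "\<exists>s\<in>{s. l \<in> regular_set (H s) F}. s \<noteq> r \<and> dist s r < d"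
      using e(1) by (intro bexI[of _ "r + min d e / 2"]) (auto simp: dist_real_def intro!: reg')
  qed
qed

text \<open>Every real base point \<open>r\<close> gives the same function, so the regular one of
  the line can be used for all \<open>y\<close> and in the limit.\<close>

lemma A_op_Nonreal:
  assumes z: "Im z \<noteq> 0"
  shows "A_op F J H (Nonreal z) = pres (T z r o\<^sub>L J) (of_real r)"
proof -
  have K: "approximable (T z r o\<^sub>L J)" "clinear_blinfun (T z r o\<^sub>L J)"
    using approximable_compose(2)[OF T_approximable[OF z] linJ] T_clinear[OF z] linJ by auto
  show ?thesis
    unfolding A_op_def
    by (rule meromorphic_extension_eqI[OF pres_vmeromorphic[OF K] pres_normalized[OF K], where r = 0])
       (simp_all add: T_pencil(2)[OF z] islimpt_UNIV)
qed

lemma A_op_boundary: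
  assumes reg: "l \<in> regular_set (H r) F"
  shows "A_op F J H (Above l) = pres (T_op F (Above l) (H r) o\<^sub>L J) (of_real r)"
    "A_op F J H (Below l) = pres (T_op F (Below l) (H r) o\<^sub>L J) (of_real r)"
    "B_op F J H (Above l) = pres (J o\<^sub>L T_op F (Above l) (H r)) (of_real r)"
    "B_op F J H (Below l) = pres (J o\<^sub>L T_op F (Below l) (H r)) (of_real r)"
proof -
  note A = regular_limits[OF reg]
  note op = limit_op[OF Im_up A(1)] limit_op[OF Im_down A(2)]
  note ext = meromorphic_extension_eqI[OF pres_vmeromorphic pres_normalized _ regular_islimpt[OF reg]]
  have set: "nonresonant_set F H (Above l) = {s. l \<in> regular_set (H s) F}"
    "nonresonant_set F H (Below l) = {s. l \<in> regular_set (H s) F}"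
    by (simp_all add: resonance_point_def)
  show "A_op F J H (Above l) = pres (T_op F (Above l) (H r) o\<^sub>L J) (of_real r)"
    unfolding A_op_def set
    by (rule ext) (use op linJ limit_pres(1)[OF Im_up A(1) regular_limits(1)] in \<open>auto intro: approximable_compose\<close>)
  show "A_op F J H (Below l) = pres (T_op F (Below l) (H r) o\<^sub>L J) (of_real r)"
    unfolding A_op_def set
    by (rule ext) (use op linJ limit_pres(1)[OF Im_down A(2) regular_limits(2)] in \<open>auto intro: approximable_compose\<close>)
  show "B_op F J H (Above l) = pres (J o\<^sub>L T_op F (Above l) (H r)) (of_real r)"
    unfolding B_op_def set
    by (rule ext) (use op linJ limit_pres(2)[OF Im_up A(1) regular_limits(1)] in \<open>auto intro: approximable_compose\<close>)
  show "B_op F J H (Below l) = pres (J o\<^sub>L T_op F (Below l) (H r)) (of_real r)"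
    unfolding B_op_def set
    by (rule ext) (use op linJ limit_pres(2)[OF Im_down A(2) regular_limits(2)] in \<open>auto intro: approximable_compose\<close>)
qed

text \<open>Uniqueness of an eventually constant value discharges the description in
  \<open>split_count\<close>; the poles of \<open>A_op\<close> are matched with points of
  non-invertibility through \<open>pres_is_pole_iff\<close>.\<close>

lemma split_count_eq:
  assumes N: "\<forall>\<^sub>F \<epsilon> in at_right 0. \<forall>\<^sub>F y in at_right 0.
      (\<Sum>w\<in>poles_in (T (up l y) r o\<^sub>L J) (of_real r) (ball (of_real a) \<epsilon> \<inter> X).
         crank (rproj (T (up l y) r o\<^sub>L J) (of_real r) w)) = N"
  shows "split_count F J H l a X = N"
proof -
  let ?f = "\<lambda>\<epsilon> y. (\<Sum>w | w \<in> ball (of_real a) \<epsilon> \<inter> X \<and> is_pole (A_op F J H (Nonreal (Complex l y))) w.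
           crank (P_op F J H (Nonreal (Complex l y)) w))"
  have eq: "(\<Sum>w\<in>poles_in (T (up l y) r o\<^sub>L J) (of_real r) (ball (of_real a) \<epsilon> \<inter> X).
         crank (rproj (T (up l y) r o\<^sub>L J) (of_real r) w)) = ?f \<epsilon> y" if "0 < y" for \<epsilon> y
  proof -
    have z: "Im (up l y) \<noteq> 0" using that by simp
    have K: "approximable (T (up l y) r o\<^sub>L J)" "clinear_blinfun (T (up l y) r o\<^sub>L J)"
      using approximable_compose(2)[OF T_approximable[OF z] linJ] T_clinear[OF z] linJ by auto
    show ?thesis
      unfolding P_op_def A_op_Nonreal[OF z, of r] rproj_def poles_in_def pres_is_pole_iff[OF K] ..
  qed
  have ev: "\<forall>\<^sub>F \<epsilon> in at_right 0. \<forall>\<^sub>F y in at_right 0. ?f \<epsilon> y = N"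
    using N
  proof eventually_elim
    case (elim \<epsilon>)
    then show ?case using eventually_at_right_less[of 0] by eventually_elim (simp add: eq)
  qed
  show ?thesis
    unfolding split_count_def
  proof (rule the_equality)
    fix M assume "\<forall>\<^sub>F \<epsilon> in at_right 0. \<forall>\<^sub>F y in at_right 0. ?f \<epsilon> y = M"
    then show "M = N" using ev by (rule eventually_const_unique)
  qed (rule ev)
qed

theorem signature_eq_resonance_index:
  assumes reg: "l \<in> regular_set (H r) F"
  shows "op_signature (Q_op F J H (Below l) a o\<^sub>L J o\<^sub>L P_op F J H (Above l) a) = resonance_index F J H l a"
    "op_signature (Q_op F J H (Above l) a o\<^sub>L J o\<^sub>L P_op F J H (Below l) a) = resonance_index F J H l a"
proof -
  define r' a' where "r' = complex_of_real r" and "a' = complex_of_real a"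
  have cnj: "cnj r' = r'" "cnj a' = a'" by (simp_all add: r'_def a'_def)
  define Lp Lm where "Lp = T_op F (Above l) (H r)" and "Lm = T_op F (Below l) (H r)"
  have lim: "((\<lambda>y. T (up l y) r) \<longlongrightarrow> Lp) (at_right 0)" "((\<lambda>y. T (down l y) r) \<longlongrightarrow> Lm) (at_right 0)"
    using regular_limits[OF reg] by (simp_all add: Lp_def Lm_def)
  note op = limit_op[OF Im_up lim(1)] limit_op[OF Im_down lim(2)]
  have conj: "cnj (up l y) = down l y" for y by (simp add: complex_eq_iff)
  have adjT: "is_adj (T (up l y) r) (T (down l y) r)" if "0 < y" for y
    using T_adj[OF Im_up[OF that], of r l] by (simp only: conj)
  have adj: "is_adj Lp Lm"
    unfolding is_adj_def
  proof (intro allI)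
    fix u v
    have "((\<lambda>y. cinner (T (up l y) r u) v) \<longlongrightarrow> cinner (Lp u) v) (at_right 0)" by (intro tendsto_intros lim)
    moreover have "((\<lambda>y. cinner u (T (down l y) r v)) \<longlongrightarrow> cinner u (Lm v)) (at_right 0)" by (intro tendsto_intros lim)
    then have "((\<lambda>y. cinner (T (up l y) r u) v) \<longlongrightarrow> cinner u (Lm v)) (at_right 0)"
      by (rule Lim_transform_eventually)
         (rule eventually_mono[OF eventually_at_right_less], simp add: is_adjD[OF adjT])
    ultimately show "cinner (Lp u) v = cinner u (Lm v)"
      using tendsto_unique[OF trivial_limit_at_right_real] by blast
  qed
  have inv: "invertible_op (pencil (T z r o\<^sub>L J) r' s)" if "Im z \<noteq> 0" "Im s = 0" for z s
    using T_pencil(1)[OF that(1), of r "Re s"] that(2) by (simp add: r'_def complex_is_Real_iff[symmetric] of_real_Re)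
  define S1 where "S1 = rproj (J o\<^sub>L Lm) r' a' o\<^sub>L J o\<^sub>L rproj (Lp o\<^sub>L J) r' a'"
  define S2 where "S2 = rproj (J o\<^sub>L Lp) r' a' o\<^sub>L J o\<^sub>L rproj (Lm o\<^sub>L J) r' a'"
  let ?n = "\<lambda>\<epsilon> y X. \<Sum>w\<in>poles_in (T (up l y) r o\<^sub>L J) r' (ball a' \<epsilon> \<inter> X). crank (rproj (T (up l y) r o\<^sub>L J) r' w)"
  have c1: "\<forall>\<^sub>F \<epsilon> in at_right 0. \<forall>\<^sub>F y in at_right 0.
      ?n \<epsilon> y {w. 0 < Im w} = crank (pos_part S1) \<and> ?n \<epsilon> y {w. Im w < 0} = crank (neg_part S1)"
    unfolding S1_def
  proof (rule split_poles_count(3)[OF _ _ _ _ lim(1) op(3,4) adj J cnj])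
    fix y u assume y: "(0::real) < y"
    show "approximable (T (up l y) r)" "clinear_blinfun (T (up l y) r)"
      using T_approximable[OF Im_up[OF y]] T_clinear[OF Im_up[OF y]] by auto
    show "0 \<le> Im (cinner u (T (up l y) r u))"
      using T_dissipative[OF Im_up[OF y], of l u r] y by (simp add: zero_le_mult_iff)
    show "T (up l y) r u = 0" if "Im (cinner u (T (up l y) r u)) = 0" using T_strict[OF Im_up[OF y] that] .
    show "invertible_op (pencil (T (up l y) r o\<^sub>L J) r' s)" if "Im s = 0" for s using inv[OF Im_up[OF y] that] .
  qed
  \<comment> \<open>The negative of the family below the axis is again dissipative. Paired with
    \<open>- J\<close> it has the same products, hence the same pencils and projections; only the
    middle factor of the matrix changes sign.\<close>
  have mJ: "selfadjoint_blinfun (- J)" by (rule selfadjoint_arith(3)[OF J])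
  have mm: "(- X) o\<^sub>L (- Y) = X o\<^sub>L Y" for X Y :: "'k \<Rightarrow>\<^sub>L 'k" by (simp add: compose_simps)
  have limm: "((\<lambda>y. - T (down l y) r) \<longlongrightarrow> - Lm) (at_right 0)" by (intro tendsto_intros lim)
  have adjm: "is_adj (- Lm) (- Lp)" using is_adj_sym[OF adj] by (simp add: is_adj_def blinfun.minus_left)
  have mS2: "rproj (J o\<^sub>L Lp) r' a' o\<^sub>L - J o\<^sub>L rproj (Lm o\<^sub>L J) r' a' = - S2"
    by (simp add: S2_def compose_simps)
  have prem: "approximable (- T (down l y) r)" "clinear_blinfun (- T (down l y) r)" if y: "(0::real) < y" for y
    using approximable_uminus[OF T_approximable[OF Im_down[OF y]]] T_clinear[OF Im_down[OF y]] by auto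
  have prem3: "0 \<le> Im (cinner u ((- T (down l y) r) u))" if y: "(0::real) < y" for y u
    using T_dissipative[OF Im_down[OF y], of l u r] y
    by (auto simp: blinfun.minus_left zero_le_mult_iff mult_le_0_iff)
  have prem4: "(- T (down l y) r) u = 0" if y: "(0::real) < y" and "Im (cinner u ((- T (down l y) r) u)) = 0" for y u
    using T_strict[OF Im_down[OF y], of u r l] that(2) by (simp add: blinfun.minus_left)
  have prem5: "invertible_op (pencil (- T (down l y) r o\<^sub>L - J) r' s)" if "0 < y" "Im s = 0" for y s
    unfolding mm by (rule inv[OF Im_down[OF that(1)] that(2)])
  have prem6: "clinear_blinfun (- Lp)" using op(2) by auto
  note count2 = split_poles_count[of "\<lambda>y. - T (down l y) r" "- Lm" "- Lp" "- J" r' a',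
      OF prem(1) prem(2) prem3 prem4 limm approximable_uminus[OF op(1)] prem6 adjm mJ cnj prem5, unfolded mm mS2]
  have sa2: "selfadjoint_blinfun (- S2)" by (rule count2(1); assumption)
  have fin2: "finite_dim (range (blinfun_apply (- S2)))" by (rule count2(2); assumption)
  have c2': "\<forall>\<^sub>F \<epsilon> in at_right 0. \<forall>\<^sub>F y in at_right 0.
       (\<Sum>w\<in>poles_in (T (down l y) r o\<^sub>L J) r' (ball a' \<epsilon> \<inter> {w. 0 < Im w}). crank (rproj (T (down l y) r o\<^sub>L J) r' w)) = crank (pos_part (- S2)) \<and>
       (\<Sum>w\<in>poles_in (T (down l y) r o\<^sub>L J) r' (ball a' \<epsilon> \<inter> {w. Im w < 0}). crank (rproj (T (down l y) r o\<^sub>L J) r' w)) = crank (neg_part (- S2))"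
    by (rule count2(3); assumption)
  have image: "cnj ` (ball a' \<epsilon> \<inter> {w. Im w < 0}) = ball a' \<epsilon> \<inter> {w. 0 < Im w}"
    "cnj ` (ball a' \<epsilon> \<inter> {w. 0 < Im w}) = ball a' \<epsilon> \<inter> {w. Im w < 0}" for \<epsilon>
  proof -
    have b: "cnj w \<in> ball a' \<epsilon>" if "w \<in> ball a' \<epsilon>" for w
      using that complex_mod_cnj[of "a' - w"] by (simp add: dist_norm cnj)
    show "cnj ` (ball a' \<epsilon> \<inter> {w. Im w < 0}) = ball a' \<epsilon> \<inter> {w. 0 < Im w}"
      "cnj ` (ball a' \<epsilon> \<inter> {w. 0 < Im w}) = ball a' \<epsilon> \<inter> {w. Im w < 0}"
      by (auto intro!: b rev_image_eqI[of "cnj _"] simp del: mem_ball)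
  qed
  \<comment> \<open>Reflection in the real axis exchanges the half-planes, and passing from
    \<open>- S2\<close> to \<open>S2\<close> exchanges positive and negative part; the two exchanges
    compensate.\<close>
  have c2: "\<forall>\<^sub>F \<epsilon> in at_right 0. \<forall>\<^sub>F y in at_right 0.
      ?n \<epsilon> y {w. Im w < 0} = crank (pos_part (- S2)) \<and> ?n \<epsilon> y {w. 0 < Im w} = crank (neg_part (- S2))"
    using c2'
  proof eventually_elim
    case (elim \<epsilon>)
    then show ?case using eventually_at_right_less[of 0]
    proof eventually_elim
      case (elim y)
      note y = elim(2)
      note flip = sum_crank_cnj[OF T_approximable[OF Im_up[OF y]] T_clinear[OF Im_up[OF y]]
          T_approximable[OF Im_down[OF y]] T_clinear[OF Im_down[OF y]] adjT[OF y] linJ adjJ cnj(1)]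
      have bd: "bounded (ball a' \<epsilon> \<inter> X)" for X by (rule bounded_subset[OF bounded_ball]) auto
      show ?case
        using elim(1) flip[OF bd, of "{w. Im w < 0}"] flip[OF bd, of "{w. 0 < Im w}"] unfolding image by simp
    qed
  qed
  obtain "pos_part S2 = neg_part (- S2)" "neg_part S2 = pos_part (- S2)"
    using pos_neg_part[OF sa2 fin2] by (metis minus_minus)
  moreover have sc1: "split_count F J H l a {w. 0 < Im w} = crank (pos_part S1)"
    "split_count F J H l a {w. Im w < 0} = crank (neg_part S1)"
    by (rule split_count_eq[where r = r], fold r'_def a'_def, rule eventually_mono[OF c1], erule eventually_mono, simp)+
  moreover have sc2: "split_count F J H l a {w. 0 < Im w} = crank (neg_part (- S2))"
    "split_count F J H l a {w. Im w < 0} = crank (pos_part (- S2))"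
    by (rule split_count_eq[where r = r], fold r'_def a'_def, rule eventually_mono[OF c2], erule eventually_mono, simp)+
  ultimately have "op_signature S1 = resonance_index F J H l a" "op_signature S2 = resonance_index F J H l a"
    by (simp_all add: op_signature_def resonance_index_def)
  then show "op_signature (Q_op F J H (Below l) a o\<^sub>L J o\<^sub>L P_op F J H (Above l) a) = resonance_index F J H l a"
    "op_signature (Q_op F J H (Above l) a o\<^sub>L J o\<^sub>L P_op F J H (Below l) a) = resonance_index F J H l a"
    unfolding Q_op_def P_op_def A_op_boundary[OF reg] S1_def S2_def rproj_def Lp_def Lm_def r'_def a'_def
    by simp_all
qed

end

theorem theorem1p33:
  fixes F :: "('h::complex_hilbert, 'k::complex_hilbert) uop"
    and J :: "'k \<Rightarrow>\<^sub>L 'k"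
    and V :: "('h, 'h) uop"
    and H :: "real \<Rightarrow> ('h, 'h) uop"
    and \<D> :: "'h set"
    and lam r_lam :: real
  assumes "separable_space (euclidean :: 'h topology)"
    and "separable_space (euclidean :: 'k topology)"
    and "linear_uop F" "closed F" "densely_defined F"
    and "uop_kernel F = {0}" "uop_kernel (uop_adj F) = {0}"
    and "selfadjoint_blinfun J"
    and "V = F O uop_of_blinfun J O uop_adj F" "selfadjoint_uop V"
    and "\<And>r. H r = uop_add (H 0) (uop_scale (of_real r) V)"
    and "\<And>r. selfadjoint_uop (H r)"
    and "closure \<D> = UNIV" "\<And>r. Domain (H r) = \<D>"
    and "\<D> \<subseteq> Domain F \<inter> Domain V"
    and "\<And>r. relatively_compact V (H r)"
    and "\<And>r z. Im z \<noteq> 0 \<Longrightarrow>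
           \<exists>T. compact_blinfun T \<and> uop_adj F O resolvent (H r) z O F \<subseteq> uop_of_blinfun T"
    and "\<And>r. AE \<mu> in lebesgue. \<mu> \<in> regular_set (H r) F"
    and "\<exists>r. lam \<in> regular_set (H r) F"
    and "resonance_point F H lam r_lam"
  shows "op_signature (Q_op F J H (Below lam) r_lam o\<^sub>L J o\<^sub>L P_op F J H (Above lam) r_lam)
           = resonance_index F J H lam r_lam \<and>
         op_signature (Q_op F J H (Above lam) r_lam o\<^sub>L J o\<^sub>L P_op F J H (Below lam) r_lam)
           = resonance_index F J H lam r_lam"
proof -
  obtain r where r: "lam \<in> regular_set (H r) F" using assms(19) by blast
  interpret resonance_line F J V H
  proof
    show "linear_uop F" "closed F" "selfadjoint_blinfun J" "V = F O uop_of_blinfun J O uop_adj F"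
      by (fact assms(3) assms(4) assms(8) assms(9))+
    show "linear_uop V" using assms(10) by (simp add: selfadjoint_uop_def)
    show "H r = uop_add (H 0) (uop_scale (of_real r) V)" for r by (rule assms(11))
    show "selfadjoint_uop (H r)" for r by (rule assms(12))
    show "Domain (H r) \<subseteq> Domain F \<inter> Domain V" for r using assms(15) unfolding assms(14) .
    show "\<exists>T. compact_blinfun T \<and> uop_adj F O resolvent (H r) z O F \<subseteq> uop_of_blinfun T"
      if "Im z \<noteq> 0" for r z using that by (rule assms(17))
  qed
  show ?thesis by (rule conjI) (rule signature_eq_resonance_index[OF r])+
qed

end
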